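(* Let $L$ be the left regular representation of the discrete group $\Gamma$. A direct integral decomposition of $L$ is obtained as follows: $$L\cong\int_{[-1,1]}^{\oplus}\pi_\lambda|_\Gamma\,|\lambda|\,d\lambda\cong\int_{[-1,1]}^{\oplus}\int_{[0,|\lambda|)}^{\oplus}\mathrm{Ind}_K^\Gamma\left(\chi_{(|\lambda|,t)}\right)|\lambda|\,dt\,d\lambda,$$ the latter acting in the Hilbert space $$\int_{[-1,1]}^{\oplus}\int_{[0,|\lambda|)}^{\oplus}l^2(\mathbb{Z})\,|\lambda|\,dt\,d\lambda .$$
   Context: For real $l,m,k$ write $\mathbf{P}_{l,m,k}=\begin{bmatrix}1&m&l\\0&1&k\\0&0&1\end{bmatrix}$. $\mathbb{H}=\{\mathbf{P}_{z,x,y}:(z,x,y)\in\mathbb{R}^3\}$ is the three-dimensional Heisenberg group, $\Gamma=\{\mathbf{P}_{l,m,k}:(l,m,k)\in\mathbb{Z}^3\}$, and $K=\{\mathbf{P}_{l,0,k}:(l,k)\in\mathbb{Z}^2\}$, an abelian subgroup of $\Gamma$. For $\lambda\neq0$, $\pi_\lambda$ is the representation of $\mathbb{H}$ on $L^2(\mathbb{R})$ given by $\pi_\lambda(\mathbf{P}_{z,x,y})f(t)=e^{2\pi iz\lambda}e^{-2\pi i\lambda yt}f(t-x)$. The character $\chi_{(|\lambda|,t)}$ of $K$ is $\chi_{(|\lambda|,t)}(\mathbf{P}_{l,0,k})=\exp\left(2\pi i(|\lambda|l+tk)\right)$. ($\Gamma$ is isomorphic to the group of operators on $L^2(\mathbb{R})$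 generated by $T_kf(x)=f(x-k)$, $k\in\mathbb{Z}$, and $M_lf(x)=e^{2\pi ilx}f(x)$, $l\in\alpha\mathbb{Z}$, for $\alpha$ a positive irrational number.) $\cong$ denotes unitary equivalence.
   Formalization: The induced representations are taken from the character χ_(λ,t) instead of the printed χ_(|λ|,t); for λ<0 the printed version is false, since the central element P_{1,0,0} would act by e^{2πi|λ|} and the spectral multiplicities would not match those of L. *)

theory Defs
  imports "HOL-Analysis.Analysis" "HOL-Algebra.Coset"
begin

section \<open>Hilbert spaces of functions and their direct integrals\<close>

(* Vectors are representatives: the inner product is only semi-definite, and x, y denote the same
   element of the Hilbert space iff hilb_eq holds. *)
record 'v hilb =
  vecs :: "'v set"
  vadd :: "'v \<Rightarrow> 'v \<Rightarrow> 'v"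
  vscale :: "complex \<Rightarrow> 'v \<Rightarrow> 'v"
  ip :: "'v \<Rightarrow> 'v \<Rightarrow> complex"

definition hilb_eq :: "'v hilb \<Rightarrow> 'v \<Rightarrow> 'v \<Rightarrow> bool" where
  "hilb_eq H x y \<longleftrightarrow>
     (let d = vadd H x (vscale H (-1) y) in ip H d d = 0)"

definition L2 :: "'a measure \<Rightarrow> ('a \<Rightarrow> complex) hilb" where
  "L2 M = \<lparr>
     vecs = {f \<in> borel_measurable M. integrable M (\<lambda>x. (cmod (f x))\<^sup>2)},
     vadd = (\<lambda>f g x. f x + g x),
     vscale = (\<lambda>c f x. c * f x),
     ip = (\<lambda>f g. LINT x|M. f x * cnj (g x))\<rparr>"

abbreviation l2 :: "'a set \<Rightarrow> ('a \<Rightarrow> complex) hilb" where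
  "l2 A \<equiv> L2 (count_space A)"

(* The measurable structure of the field H is the one generated by a family S of fundamental
   sections: a section is measurable iff its inner products with all members of S are. *)
definition direct_integral ::
  "'x measure \<Rightarrow> ('x \<Rightarrow> 'v) set \<Rightarrow> ('x \<Rightarrow> 'v hilb) \<Rightarrow> ('x \<Rightarrow> 'v) hilb" where
  "direct_integral M S H = \<lparr>
     vecs = {F. (\<forall>x\<in>space M. F x \<in> vecs (H x)) \<and>
                (\<forall>s\<in>S. (\<lambda>x. ip (H x) (F x) (s x)) \<in> borel_measurable M) \<and>
                integrable M (\<lambda>x. Re (ip (H x) (F x) (F x)))},
     vadd = (\<lambda>F G x. vadd (H x) (F x) (G x)),
     vscale = (\<lambda>c F x. vscale (H x) c (F x)),
     ip = (\<lambda>F G. LINT x|M. ip (H x) (F x) (G x))\<rparr>"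

(* For a constant field this gives weak measurability, i.e. the space L^2(M; H).  For the field
   l |-> (direct integral over [0,|l|) of a fixed space) with |l| <= 1, the constant sections are the
   vectors over [0,1), restricted to [0,|l|). *)
definition const_sections :: "'x measure \<Rightarrow> ('x \<Rightarrow> 'v hilb) \<Rightarrow> ('x \<Rightarrow> 'v) set" where
  "const_sections M H = {(\<lambda>_. v) | v. \<forall>x\<in>space M. v \<in> vecs (H x)}"

abbreviation direct_integral_const ::
  "'x measure \<Rightarrow> ('x \<Rightarrow> 'v hilb) \<Rightarrow> ('x \<Rightarrow> 'v) hilb" where
  "direct_integral_const M H \<equiv> direct_integral M (const_sections M H) H"


section \<open>Representations\<close>

record ('g, 'v) rep =
  rspace :: "'v hilb"
  act :: "'g \<Rightarrow> 'v \<Rightarrow> 'v"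

definition unitarily_equivalent ::
  "('g, 'b) monoid_scheme \<Rightarrow> ('g, 'v) rep \<Rightarrow> ('g, 'w) rep \<Rightarrow> bool" where
  "unitarily_equivalent G \<pi> \<rho> \<longleftrightarrow>
     (let V = rspace \<pi>; W = rspace \<rho> in
      \<exists>U. (\<forall>x\<in>vecs V. U x \<in> vecs W) \<and>
          (\<forall>x\<in>vecs V. \<forall>y\<in>vecs V. hilb_eq W (U (vadd V x y)) (vadd W (U x) (U y))) \<and>
          (\<forall>c. \<forall>x\<in>vecs V. hilb_eq W (U (vscale V c x)) (vscale W c (U x))) \<and>
          (\<forall>x\<in>vecs V. \<forall>y\<in>vecs V. ip W (U x) (U y) = ip V x y) \<and>
          (\<forall>y\<in>vecs W. \<exists>x\<in>vecs V. hilb_eq W (U x) y) \<and>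
          (\<forall>g\<in>carrier G. \<forall>x\<in>vecs V. hilb_eq W (U (act \<pi> g x)) (act \<rho> g (U x))))"

definition direct_integral_rep :: "'x measure \<Rightarrow> ('x \<Rightarrow> ('g, 'v) rep) \<Rightarrow> ('g, 'x \<Rightarrow> 'v) rep" where
  "direct_integral_rep M \<pi> = \<lparr>
     rspace = direct_integral_const M (\<lambda>x. rspace (\<pi> x)),
     act = (\<lambda>g F x. act (\<pi> x) g (F x))\<rparr>"

definition left_regular_rep :: "('g, 'b) monoid_scheme \<Rightarrow> ('g, 'g \<Rightarrow> complex) rep" where
  "left_regular_rep G = \<lparr>
     rspace = l2 (carrier G),
     act = (\<lambda>g f x. f (inv\<^bsub>G\<^esub> g \<otimes>\<^bsub>G\<^esub> x))\<rparr>"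

definition left_cosets :: "('g, 'b) monoid_scheme \<Rightarrow> 'g set \<Rightarrow> 'g set set" where
  "left_cosets G K = {x <#\<^bsub>G\<^esub> K | x. x \<in> carrier G}"

(* The inner product sums F * cnj F' over the cosets x K; for a unitary character sigma of K the
   summand does not depend on the point chosen in the coset. *)
definition induced_space ::
  "('g, 'b) monoid_scheme \<Rightarrow> 'g set \<Rightarrow> ('g \<Rightarrow> complex) \<Rightarrow> ('g \<Rightarrow> complex) hilb" where
  "induced_space G K \<sigma> = \<lparr>
     vecs = {F. (\<forall>x\<in>carrier G. \<forall>k\<in>K. F (x \<otimes>\<^bsub>G\<^esub> k) = inverse (\<sigma> k) * F x) \<and>
                (\<lambda>C. F (SOME x. x \<in> C)) \<in> vecs (l2 (left_cosets G K))},
     vadd = (\<lambda>F F' x. F x + F' x),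
     vscale = (\<lambda>c F x. c * F x),
     ip = (\<lambda>F F'. ip (l2 (left_cosets G K))
                     (\<lambda>C. F (SOME x. x \<in> C)) (\<lambda>C. F' (SOME x. x \<in> C)))\<rparr>"

definition induced_rep ::
  "('g, 'b) monoid_scheme \<Rightarrow> 'g set \<Rightarrow> ('g \<Rightarrow> complex) \<Rightarrow> ('g, 'g \<Rightarrow> complex) rep" where
  "induced_rep G K \<sigma> = \<lparr>
     rspace = induced_space G K \<sigma>,
     act = (\<lambda>g F x. F (inv\<^bsub>G\<^esub> g \<otimes>\<^bsub>G\<^esub> x))\<rparr>"

definition transport_rep :: "('v \<Rightarrow> 'w) \<Rightarrow> 'w hilb \<Rightarrow> ('g, 'v) rep \<Rightarrow> ('g, 'w) rep" where
  "transport_rep R W \<pi> = \<lparr>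
     rspace = W,
     act = (\<lambda>g f. R (act \<pi> g (inv_into (vecs (rspace \<pi>)) R f)))\<rparr>"


section \<open>The Heisenberg group\<close>

definition P :: "real \<Rightarrow> real \<Rightarrow> real \<Rightarrow> real^3^3" where
  "P l m k = vector [vector [1, m, l], vector [0, 1, k], vector [0, 0, 1]]"

definition Heis :: "(real^3^3) monoid" where
  "Heis = \<lparr>carrier = {P z x y | z x y. True}, mult = (**), one = mat 1\<rparr>"

definition Gam :: "(real^3^3) monoid" where
  "Gam = Heis\<lparr>carrier := {P (of_int l) (of_int m) (of_int k) | l m k. True}\<rparr>"

definition K :: "(real^3^3) set" where
  "K = {P (of_int l) 0 (of_int k) | l k. True}"

(* Coordinates of a = P z x y: z = a$1$3, x = a$1$2, y = a$2$3. *)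
definition schroedinger_rep :: "real \<Rightarrow> (real^3^3, real \<Rightarrow> complex) rep" where
  "schroedinger_rep s = \<lparr>
     rspace = L2 lborel,
     act = (\<lambda>a f t. exp (2 * pi * \<i> * (a$1$3) * s) * exp (- 2 * pi * \<i> * s * (a$2$3) * t)
                      * f (t - a$1$2))\<rparr>"

definition char_K :: "real \<Rightarrow> real \<Rightarrow> real^3^3 \<Rightarrow> complex" where
  "char_K \<omega> t a = exp (2 * pi * \<i> * (\<omega> * (a$1$3) + t * (a$2$3)))"

(* The induced representation carried to l^2(Z) through the coset representatives P 0 n 0.
   Pitfall: P l 0 0 acts as the scalar exp (2 pi i omega l) here and as exp (2 pi i s l) in
   schroedinger_rep s.  So for s < 0 the representations that occur in schroedinger_rep s are the
   Ind_K_Gam s t, with the sign of s kept, and not the Ind_K_Gam \<bar>s\<bar> t. *)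
definition Ind_K_Gam :: "real \<Rightarrow> real \<Rightarrow> (real^3^3, int \<Rightarrow> complex) rep" where
  "Ind_K_Gam \<omega> t =
     transport_rep (\<lambda>F n. F (P 0 (of_int n) 0)) (l2 UNIV) (induced_rep Gam K (char_K \<omega> t))"

(* The double integral carries the measure |s| dt ds: the density sits in the outer measure. *)
definition base_measure :: "real measure" where
  "base_measure = density (restrict_space lborel {-1..1}) (\<lambda>s. ennreal \<bar>s\<bar>)"

definition fibre_measure :: "real \<Rightarrow> real measure" where
  "fibre_measure s = restrict_space lborel {0..<\<bar>s\<bar>}"


section \<open>Sanity checks\<close>

lemma P_nth [simp]: "P l m k $ 1 $ 3 = l" "P l m k $ 1 $ 2 = m" "P l m k $ 2 $ 3 = k"
  by (simp_all add: P_def)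

lemma P_mult: "P l m k ** P l' m' k' = P (l + l' + m * k') (m + m') (k + k')"
  by (simp add: P_def matrix_matrix_mult_def vec_eq_iff forall_3 sum_3)

lemma P_one: "mat 1 = P 0 0 0"
  by (simp add: P_def mat_def vec_eq_iff forall_3)

lemma P_eq_iff [simp]: "P l m k = P l' m' k' \<longleftrightarrow> l = l' \<and> m = m' \<and> k = k'"
  by (metis P_nth)

lemma group_Heis: "group Heis"
proof (rule groupI)
  fix a assume "a \<in> carrier Heis"
  then obtain l m k where "a = P l m k" by (auto simp: Heis_def)
  then have "P (- l + m * k) (- m) (- k) \<otimes>\<^bsub>Heis\<^esub> a = \<one>\<^bsub>Heis\<^esub>"
    by (simp add: Heis_def P_mult P_one)
  then show "\<exists>b\<in>carrier Heis. b \<otimes>\<^bsub>Heis\<^esub> a = \<one>\<^bsub>Heis\<^esub>"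
    by (intro bexI[of _ "P (- l + m * k) (- m) (- k)"]) (auto simp: Heis_def)
qed (auto simp: Heis_def P_mult P_one algebra_simps)

lemma Gam_simps [simp]:
  "carrier Gam = {P (of_int l) (of_int m) (of_int k) | l m k. True}"
  "x \<otimes>\<^bsub>Gam\<^esub> y = x ** y" "\<one>\<^bsub>Gam\<^esub> = mat 1"
  by (simp_all add: Gam_def Heis_def)

lemma P_in_Gam: "P l m k \<in> carrier Gam \<longleftrightarrow> l \<in> \<int> \<and> m \<in> \<int> \<and> k \<in> \<int>"
  by (auto elim!: Ints_cases)

lemma P_in_K: "P l m k \<in> K \<longleftrightarrow> l \<in> \<int> \<and> m = 0 \<and> k \<in> \<int>"
  by (auto simp: K_def elim!: Ints_cases)

lemma Gam_cases:
  assumes "a \<in> carrier Gam"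
  obtains l m k where "a = P l m k" "l \<in> \<int>" "m \<in> \<int>" "k \<in> \<int>"
  using assms by auto

lemma K_cases:
  assumes "a \<in> K"
  obtains l k where "a = P l 0 k" "l \<in> \<int>" "k \<in> \<int>"
  using assms by (auto simp: K_def)

declare Gam_simps(1) [simp del]

lemma group_Gam: "group Gam"
proof (rule groupI)
  fix a assume "a \<in> carrier Gam"
  then show "\<exists>b\<in>carrier Gam. b \<otimes>\<^bsub>Gam\<^esub> a = \<one>\<^bsub>Gam\<^esub>"
  proof (cases rule: Gam_cases)
    case (1 l m k)
    then show ?thesis
      by (intro bexI[of _ "P (- l + m * k) (- m) (- k)"]) (auto simp: P_in_Gam P_mult P_one)
  qed
qed (auto elim!: Gam_cases simp: P_in_Gam P_mult P_one algebra_simps)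

lemma inv_Gam:
  "P l m k \<in> carrier Gam \<Longrightarrow> inv\<^bsub>Gam\<^esub> (P l m k) = P (- l + m * k) (- m) (- k)"
  by (rule group.inv_equality[OF group_Gam]) (auto simp: P_in_Gam P_mult P_one)

lemma subgroup_Gam: "subgroup (carrier Gam) Heis"
proof (rule group.subgroupI[OF group_Heis])
  fix a assume "a \<in> carrier Gam"
  then show "inv\<^bsub>Heis\<^esub> a \<in> carrier Gam"
  proof (cases rule: Gam_cases)
    case (1 l m k)
    then have "inv\<^bsub>Heis\<^esub> a = P (- l + m * k) (- m) (- k)"
      by (intro group.inv_equality[OF group_Heis]) (auto simp: Heis_def P_mult P_one)
    then show ?thesis using 1 by (simp add: P_in_Gam)
  qed
next
  fix a b assume "a \<in> carrier Gam" "b \<in> carrier Gam"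
  then show "a \<otimes>\<^bsub>Heis\<^esub> b \<in> carrier Gam"
    by (auto elim!: Gam_cases simp: Heis_def P_mult P_in_Gam)
qed (auto simp: Heis_def Gam_def)

lemma subgroup_K: "subgroup K Gam"
proof (rule group.subgroupI[OF group_Gam])
  show "K \<subseteq> carrier Gam" by (auto elim!: K_cases simp: P_in_Gam)
  show "K \<noteq> {}" by (auto simp: K_def)
next
  fix a assume "a \<in> K"
  then show "inv\<^bsub>Gam\<^esub> a \<in> K"
    by (auto elim!: K_cases simp: P_in_Gam P_in_K inv_Gam)
next
  fix a b assume "a \<in> K" "b \<in> K"
  then show "a \<otimes>\<^bsub>Gam\<^esub> b \<in> K" by (auto elim!: K_cases simp: P_in_K P_mult)
qed

lemma schroedinger_rep_P:
  "act (schroedinger_rep s) (P z x y) f t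
     = exp (2 * pi * \<i> * z * s) * exp (- 2 * pi * \<i> * s * y * t) * f (t - x)"
  by (simp add: schroedinger_rep_def)

lemma char_K_P: "char_K \<omega> t (P l 0 k) = exp (2 * pi * \<i> * (\<omega> * l + t * k))"
  by (simp add: char_K_def)

lemma left_coset_P:
  assumes "P l m k \<in> carrier Gam"
  shows "P l m k <#\<^bsub>Gam\<^esub> K = {P l' m k' | l' k'. l' \<in> \<int> \<and> k' \<in> \<int>}"
proof (intro equalityI subsetI)
  fix a assume "a \<in> P l m k <#\<^bsub>Gam\<^esub> K"
  then show "a \<in> {P l' m k' | l' k'. l' \<in> \<int> \<and> k' \<in> \<int>}"
    using assms by (auto simp: l_coset_def P_mult P_in_Gam elim!: K_cases)
next
  fix a assume "a \<in> {P l' m k' | l' k'. l' \<in> \<int> \<and> k' \<in> \<int>}"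
  then obtain l' k' where a: "a = P l' m k'" "l' \<in> \<int>" "k' \<in> \<int>" by auto
  have "P l m k \<otimes>\<^bsub>Gam\<^esub> P (l' - l - m * (k' - k)) 0 (k' - k) = a"
    by (simp add: a P_mult)
  moreover have "P (l' - l - m * (k' - k)) 0 (k' - k) \<in> K"
    using assms a by (simp add: P_in_K P_in_Gam)
  ultimately show "a \<in> P l m k <#\<^bsub>Gam\<^esub> K" unfolding l_coset_def by blast
qed

definition coset_of :: "int \<Rightarrow> (real^3^3) set" where
  "coset_of n = {P l (of_int n) k | l k. l \<in> \<int> \<and> k \<in> \<int>}"

lemma bij_coset_of: "bij_betw coset_of UNIV (left_cosets Gam K)"
  unfolding bij_betw_def
proof
  show "inj coset_of"
  proof (rule injI)
    fix m n assume "coset_of m = coset_of n"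
    moreover have "P 0 (of_int m) 0 \<in> coset_of m" by (auto simp: coset_of_def)
    ultimately show "m = n" by (auto simp: coset_of_def)
  qed
  have "left_cosets Gam K = {coset_of n | n. True}"
    unfolding left_cosets_def coset_of_def
  proof (intro equalityI subsetI; clarify)
    fix x assume "x \<in> carrier Gam"
    then show "\<exists>n. x <#\<^bsub>Gam\<^esub> K = {P l (of_int n) k | l k. l \<in> \<int> \<and> k \<in> \<int>} \<and> True"
      by (cases rule: Gam_cases) (auto simp: left_coset_P P_in_Gam elim!: Ints_cases)
  next
    fix n :: int
    show "\<exists>x. {P l (of_int n) k | l k. l \<in> \<int> \<and> k \<in> \<int>} = x <#\<^bsub>Gam\<^esub> K \<and> x \<in> carrier Gam"
      by (intro exI[of _ "P 0 (of_int n) 0"]) (simp add: left_coset_P P_in_Gam)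
  qed
  then show "range coset_of = left_cosets Gam K" by auto
qed

definition covariant :: "real \<Rightarrow> real \<Rightarrow> (real^3^3 \<Rightarrow> complex) \<Rightarrow> bool" where
  "covariant \<omega> t F \<longleftrightarrow>
     (\<forall>x\<in>carrier Gam. \<forall>k\<in>K. F (x \<otimes>\<^bsub>Gam\<^esub> k) = inverse (char_K \<omega> t k) * F x)"

lemma covariantD:
  assumes "covariant \<omega> t F" "P l m k \<in> carrier Gam"
  shows "F (P l m k) = inverse (char_K \<omega> t (P (l - m * k) 0 k)) * F (P 0 m 0)"
proof -
  have "P 0 m 0 \<in> carrier Gam" "P (l - m * k) 0 k \<in> K"
    using assms by (auto simp: P_in_Gam P_in_K)
  then have "F (P 0 m 0 \<otimes>\<^bsub>Gam\<^esub> P (l - m * k) 0 k)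
      = inverse (char_K \<omega> t (P (l - m * k) 0 k)) * F (P 0 m 0)"
    using assms(1) unfolding covariant_def by blast
  then show ?thesis by (simp add: P_mult)
qed

lemma norm_char_K: "cmod (char_K \<omega> t a) = 1"
proof -
  have "char_K \<omega> t a = cis (2 * pi * (\<omega> * (a$1$3) + t * (a$2$3)))"
    by (simp add: char_K_def cis_conv_exp algebra_simps)
  then show ?thesis by simp
qed

lemma covariant_coset:
  assumes "covariant \<omega> t F" "covariant \<omega> t F'"
  shows "F (SOME x. x \<in> coset_of n) * cnj (F' (SOME x. x \<in> coset_of n))
       = F (P 0 (of_int n) 0) * cnj (F' (P 0 (of_int n) 0))"
proof -
  have "P 0 (of_int n) 0 \<in> coset_of n" by (auto simp: coset_of_def)
  then have "(SOME x. x \<in> coset_of n) \<in> coset_of n" by (rule someI)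
  then obtain l k where lk: "(SOME x. x \<in> coset_of n) = P l (of_int n) k" "l \<in> \<int>" "k \<in> \<int>"
    unfolding coset_of_def by blast
  define c where "c = inverse (char_K \<omega> t (P (l - of_int n * k) 0 k))"
  have "P l (of_int n) k \<in> carrier Gam" using lk by (simp add: P_in_Gam)
  then have "F (P l (of_int n) k) = c * F (P 0 (of_int n) 0)"
    "F' (P l (of_int n) k) = c * F' (P 0 (of_int n) 0)"
    using assms covariantD c_def by auto
  moreover have "c * cnj c = 1"
    using complex_norm_square[of c] by (simp add: c_def norm_inverse norm_char_K del: complex_cnj_inverse)
  moreover have "(c * u) * cnj (c * v) = (c * cnj c) * (u * cnj v)" for u v
    by simp
  ultimately show ?thesis using lk(1) by simp
qed

lemma vecs_induced_space:
  "F \<in> vecs (induced_space Gam K (char_K \<omega> t)) \<longleftrightarrow>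
     covariant \<omega> t F \<and> (\<lambda>n::int. F (P 0 (of_int n) 0)) \<in> vecs (l2 UNIV)"
proof (cases "covariant \<omega> t F")
  case True
  have "(cmod (F (SOME x. x \<in> coset_of n)))\<^sup>2 = (cmod (F (P 0 (of_int n) 0)))\<^sup>2" for n
    using covariant_coset[OF True True, of n] complex_norm_square of_real_eq_iff by metis
  then show ?thesis
    using True integrable_bij_count_space[OF bij_coset_of, of "\<lambda>C. (cmod (F (SOME x. x \<in> C)))\<^sup>2"]
    by (simp add: induced_space_def L2_def covariant_def)
next
  case False
  then show ?thesis unfolding induced_space_def covariant_def by auto
qed

lemma ip_induced_space:
  assumes "covariant \<omega> t F" "covariant \<omega> t F'"
  shows "ip (induced_space Gam K (char_K \<omega> t)) F F'
       = ip (l2 UNIV) (\<lambda>n::int. F (P 0 (of_int n) 0)) (\<lambda>n. F' (P 0 (of_int n) 0))"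
  using integral_bij_count_space[OF bij_coset_of,
      of "\<lambda>C. F (SOME x. x \<in> C) * cnj (F' (SOME x. x \<in> C))"] covariant_coset[OF assms]
  by (simp add: induced_space_def L2_def)

lemma covariant_extension:
  fixes f :: "int \<Rightarrow> complex"
  obtains F where "covariant \<omega> t F" "\<And>n. F (P 0 (of_int n) 0) = f n"
proof
  let ?F = "\<lambda>a :: real^3^3. inverse (char_K \<omega> t (P (a$1$3 - a$1$2 * a$2$3) 0 (a$2$3))) * f \<lfloor>a$1$2\<rfloor>"
  show "covariant \<omega> t ?F"
    unfolding covariant_def
    by (auto elim!: Gam_cases K_cases simp: P_mult char_K_def algebra_simps simp flip: exp_minus exp_add)
  show "?F (P 0 (of_int n) 0) = f n" for n by (simp add: char_K_def)
qed

lemma Ind_K_Gam_act: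
  assumes f: "f \<in> vecs (l2 UNIV)"
  shows "act (Ind_K_Gam \<omega> t) (P (of_int l) (of_int m) (of_int k)) f n
       = exp (2 * pi * \<i> * (\<omega> * real_of_int (l - n * k) + t * real_of_int k)) * f (n - m)"
proof -
  let ?R = "\<lambda>(F :: real^3^3 \<Rightarrow> complex) n :: int. F (P 0 (of_int n) 0)"
  let ?V = "vecs (induced_space Gam K (char_K \<omega> t))"
  obtain F0 where F0: "covariant \<omega> t F0" "\<And>n. F0 (P 0 (of_int n) 0) = f n"
    using covariant_extension by blast
  then have "F0 \<in> ?V" using f by (simp add: vecs_induced_space)
  moreover have "?R F0 = f" using F0(2) by auto
  ultimately have "f \<in> ?R ` ?V" by blast
  define F where "F = inv_into ?V ?R f"
  have "F \<in> ?V" unfolding F_def using \<open>f \<in> ?R ` ?V\<close> by (rule inv_into_into)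
  then have F: "covariant \<omega> t F" by (simp add: vecs_induced_space)
  have "?R F = f" unfolding F_def using \<open>f \<in> ?R ` ?V\<close> by (rule f_inv_into_f)
  then have Ff: "F (P 0 (of_int n) 0) = f n" for n by metis
  have G: "P (of_int l) (of_int m) (of_int k) \<in> carrier Gam" by (simp add: P_in_Gam)
  have "act (Ind_K_Gam \<omega> t) (P (of_int l) (of_int m) (of_int k)) f n
      = F (inv\<^bsub>Gam\<^esub> (P (of_int l) (of_int m) (of_int k)) ** P 0 (of_int n) 0)"
    by (simp add: Ind_K_Gam_def transport_rep_def induced_rep_def F_def)
  also have "\<dots> = F (P (- of_int l + of_int m * of_int k) (of_int (n - m)) (- of_int k))"
    by (simp add: inv_Gam[OF G] P_mult)
  also have "\<dots> = inverse (char_K \<omega> t (P (- of_int l + of_int m * of_int k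
                   - of_int (n - m) * (- of_int k)) 0 (- of_int k))) * f (n - m)"
    by (subst covariantD[OF F]) (simp_all add: P_in_Gam Ff del: of_int_diff)
  also have "inverse (char_K \<omega> t (P (- of_int l + of_int m * of_int k
                   - of_int (n - m) * (- of_int k)) 0 (- of_int k)))
      = exp (2 * pi * \<i> * (\<omega> * real_of_int (l - n * k) + t * real_of_int k))"
    by (simp add: char_K_def algebra_simps flip: exp_minus)
  finally show ?thesis .
qed

lemma Ind_K_Gam_equivalent:
  "unitarily_equivalent Gam (induced_rep Gam K (char_K \<omega> t)) (Ind_K_Gam \<omega> t)"
proof -
  let ?R = "\<lambda>(F :: real^3^3 \<Rightarrow> complex) n :: int. F (P 0 (of_int n) 0)"
  let ?I = "induced_space Gam K (char_K \<omega> t)"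
  have eq: "hilb_eq (l2 UNIV) g g" for g :: "int \<Rightarrow> complex"
    by (simp add: hilb_eq_def L2_def)
  have surj: "\<exists>F\<in>vecs ?I. ?R F = f" if f: "f \<in> vecs (l2 UNIV)" for f
  proof -
    obtain F where F: "covariant \<omega> t F" "\<And>n. F (P 0 (of_int n) 0) = f n"
      using covariant_extension by blast
    then have "F \<in> vecs ?I" using f by (simp add: vecs_induced_space)
    moreover have "?R F = f" using F(2) by auto
    ultimately show ?thesis by blast
  qed
  have act: "?R (act (induced_rep Gam K (char_K \<omega> t)) g F) = act (Ind_K_Gam \<omega> t) g (?R F)"
    if g: "g \<in> carrier Gam" and F: "F \<in> vecs ?I" for g F
  proof
    fix n
    obtain l m k :: int where g': "g = P (of_int l) (of_int m) (of_int k)"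
      using g by (auto simp: Gam_def)
    have cov: "covariant \<omega> t F" using F by (simp add: vecs_induced_space)
    have "?R (act (induced_rep Gam K (char_K \<omega> t)) g F) n
        = F (P (- of_int l + of_int m * of_int k) (of_int (n - m)) (- of_int k))"
      using g by (simp add: induced_rep_def inv_Gam P_mult g')
    also have "\<dots> = inverse (char_K \<omega> t (P (- of_int l + of_int m * of_int k
                   - of_int (n - m) * (- of_int k)) 0 (- of_int k))) * ?R F (n - m)"
      by (subst covariantD[OF cov]) (simp_all add: P_in_Gam del: of_int_diff)
    also have "inverse (char_K \<omega> t (P (- of_int l + of_int m * of_int k
                   - of_int (n - m) * (- of_int k)) 0 (- of_int k)))
        = exp (2 * pi * \<i> * (\<omega> * real_of_int (l - n * k) + t * real_of_int k))"
      by (simp add: char_K_def algebra_simps flip: exp_minus)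
    also have "\<dots> * ?R F (n - m) = act (Ind_K_Gam \<omega> t) g (?R F) n"
      unfolding g' using F by (subst Ind_K_Gam_act) (simp_all add: vecs_induced_space)
    finally show "?R (act (induced_rep Gam K (char_K \<omega> t)) g F) n = act (Ind_K_Gam \<omega> t) g (?R F) n" .
  qed
  have sp: "rspace (induced_rep Gam K (char_K \<omega> t)) = ?I" "rspace (Ind_K_Gam \<omega> t) = l2 UNIV"
    by (simp_all add: induced_rep_def Ind_K_Gam_def transport_rep_def)
  have ops: "?R (vadd ?I F F') = vadd (l2 UNIV) (?R F) (?R F')"
    "?R (vscale ?I c F) = vscale (l2 UNIV) c (?R F)" for F F' c
    by (simp_all add: induced_space_def L2_def)
  show ?thesis
    unfolding unitarily_equivalent_def sp Let_def
  proof (intro exI[of _ ?R] conjI ballI allI)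
    fix F F' c
    assume F: "F \<in> vecs ?I"
    show "?R F \<in> vecs (l2 UNIV)" using F by (simp add: vecs_induced_space)
    show "hilb_eq (l2 UNIV) (?R (vscale ?I c F)) (vscale (l2 UNIV) c (?R F))"
      by (simp only: ops eq)
    assume F': "F' \<in> vecs ?I"
    show "hilb_eq (l2 UNIV) (?R (vadd ?I F F')) (vadd (l2 UNIV) (?R F) (?R F'))"
      by (simp only: ops eq)
    show "ip (l2 UNIV) (?R F) (?R F') = ip ?I F F'"
      using F F' ip_induced_space vecs_induced_space by simp
  next
    fix f :: "int \<Rightarrow> complex" assume "f \<in> vecs (l2 UNIV)"
    then obtain F where "F \<in> vecs ?I" "?R F = f" using surj by blast
    then show "\<exists>F\<in>vecs ?I. hilb_eq (l2 UNIV) (?R F) f" using eq by blast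
  next
    fix g F assume "g \<in> carrier Gam" "F \<in> vecs ?I"
    then show "hilb_eq (l2 UNIV) (?R (act (induced_rep Gam K (char_K \<omega> t)) g F))
                 (act (Ind_K_Gam \<omega> t) g (?R F))"
      by (simp only: act eq)
  qed
qed

end

theory Submission
  imports Defs
begin

text \<open>
The proof rests on orthonormal bases that the group permutes. Suppose that each of two
representations of a group \<open>G\<close> carries an orthonormal and total family of vectors \<open>e g\<close>, one for each
group element, which the group moves as it moves itself: \<open>act g (e h) = e (g h)\<close>. Matching the
coefficients of vectors with respect to the two families is then a unitary map that commutes with
the actions, so the two representations are equivalent (\<open>based_reps_equivalent\<close>). The left regular
representation has such a family, the point masses. It remains to find one section in each
direct integral whose orbit under \<open>Gam\<close> is orthonormal and total.

The centre decides where to look. The element \<open>P l 0 0\<close> acts on the fibre over \<open>s\<close> as the scalar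
\<open>exp (2 pi i l s)\<close>, so exactly the fibres over \<open>s\<close> and \<open>s - 1\<close>, for \<open>0 < s < 1\<close>, have the same
central character. Folding the integral over \<open>[-1,1]\<close> with density \<open>\<bar>s\<bar>\<close> onto \<open>[0,1)\<close> gives these two
fibres the weights \<open>s\<close> and \<open>1 - s\<close>, which add up to one. As the exponentials \<open>exp (2 pi i l s)\<close>
are orthonormal on \<open>[0,1)\<close> and determine an integrable function there, the orbit of a section
\<open>\<xi>\<close> is orthonormal and total as soon as, for each \<open>s\<close> separately, the pairs of
vectors \<open>P 0 m k \<xi> s\<close> and \<open>P 0 m k \<xi> (s - 1)\<close> form an orthonormal basis of the weighted sum of
the two fibres (\<open>cyclic_field.direct_integral_based\<close>).

For both integrals this comes down to a tiling of an interval of length one by one interval of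
length \<open>s\<close> and one of length \<open>1 - s\<close>. In the Schroedinger fibre over \<open>r\<close> take for \<open>\<xi>\<close> the indicator of
\<open>[0,1)\<close>. Writing the points of \<open>[m,m+1)\<close> as \<open>m + u / r\<close> turns this interval into \<open>[0,s)\<close> for \<open>r = s\<close>,
into \<open>(s-1,0]\<close> for \<open>r = s - 1\<close>, and the vectors, up to a phase, into
the exponentials with integer frequencies in \<open>u\<close>.
In the induced fibre, the space of square integrable functions on \<open>[0,\<bar>r\<bar>)\<close> with values in
\<open>l2 UNIV\<close>, take \<open>\<bar>r\<bar> powr (-1/2)\<close> times the coordinate vector at \<open>1\<close> if \<open>r > 0\<close> and at \<open>0\<close> if \<open>r < 0\<close>.
The two tiles are then \<open>[-s,0)\<close> and \<open>[0,1-s)\<close>. In this way both direct integrals are compared with the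
regular representation, and thereby with each other.

Two facts about the spaces are needed along the way. A direct integral of complete spaces is
complete (\<open>hilbert_DI\<close>), which is what makes coefficients realisable by a section. And sections are
only assumed weakly measurable, so the measurability of their norm has to be derived: in every
field below a fixed countable family of constant sections satisfies the Parseval identity in all
fibres at once (\<open>hilb_field_constI\<close>), and these identities come from Fourier series.
\<close>

section \<open>Semi-definite Hilbert spaces and orthonormal bases\<close>

definition nrm :: "'v hilb \<Rightarrow> 'v \<Rightarrow> real" where
  "nrm H x = sqrt (Re (ip H x x))"

definition vdiff :: "'v hilb \<Rightarrow> 'v \<Rightarrow> 'v \<Rightarrow> 'v" where
  "vdiff H x y = vadd H x (vscale H (-1) y)"

text \<open>
Vectors are representatives, so the form is only semi-definite, and the scalar product sees
a vector only through its class. Linearity is therefore expressed through \<^const>\<open>ip\<close>: vectors with the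
same products against everything are interchangeable, and no vector space laws are imposed on
representatives.
\<close>

locale pre_hilb =
  fixes H :: "'v hilb"
  assumes nonempty: "vecs H \<noteq> {}"
    and add_in: "x \<in> vecs H \<Longrightarrow> y \<in> vecs H \<Longrightarrow> vadd H x y \<in> vecs H"
    and scale_in: "x \<in> vecs H \<Longrightarrow> vscale H c x \<in> vecs H"
    and ip_add: "x \<in> vecs H \<Longrightarrow> y \<in> vecs H \<Longrightarrow> z \<in> vecs H \<Longrightarrow>
      ip H (vadd H x y) z = ip H x z + ip H y z"
    and ip_scale: "x \<in> vecs H \<Longrightarrow> z \<in> vecs H \<Longrightarrow> ip H (vscale H c x) z = c * ip H x z"
    and ip_commute: "x \<in> vecs H \<Longrightarrow> y \<in> vecs H \<Longrightarrow> ip H y x = cnj (ip H x y)"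
    and ip_nonneg: "x \<in> vecs H \<Longrightarrow> 0 \<le> Re (ip H x x)"
begin

lemma diff_in: "x \<in> vecs H \<Longrightarrow> y \<in> vecs H \<Longrightarrow> vdiff H x y \<in> vecs H"
  by (simp add: vdiff_def add_in scale_in)

lemma ip_add_right:
  assumes "x \<in> vecs H" "y \<in> vecs H" "z \<in> vecs H"
  shows "ip H z (vadd H x y) = ip H z x + ip H z y"
  using assms by (simp add: ip_commute[of _ z] add_in ip_add)

lemma ip_scale_right:
  assumes "x \<in> vecs H" "z \<in> vecs H"
  shows "ip H z (vscale H c x) = cnj c * ip H z x"
  using assms by (simp add: ip_commute[of _ z] scale_in ip_scale)

lemma ip_diff:
  assumes "x \<in> vecs H" "y \<in> vecs H" "z \<in> vecs H"
  shows "ip H (vdiff H x y) z = ip H x z - ip H y z"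
  using assms by (simp add: vdiff_def scale_in ip_add ip_scale)

lemma ip_diff_right:
  assumes "x \<in> vecs H" "y \<in> vecs H" "z \<in> vecs H"
  shows "ip H z (vdiff H x y) = ip H z x - ip H z y"
  using assms by (simp add: vdiff_def scale_in ip_add_right ip_scale_right)

lemma ip_self: "x \<in> vecs H \<Longrightarrow> ip H x x = of_real (Re (ip H x x))"
  using ip_commute[of x x] by (metis Reals_cnj_iff of_real_Re)

lemma nrm_nonneg: "x \<in> vecs H \<Longrightarrow> 0 \<le> nrm H x"
  by (simp add: nrm_def ip_nonneg)

lemma nrm_power2: "x \<in> vecs H \<Longrightarrow> (nrm H x)\<^sup>2 = Re (ip H x x)"
  by (simp add: nrm_def ip_nonneg)

text \<open>
The quadratic \<open>r \<mapsto> \<parallel>x - r a y\<parallel>\<^sup>2\<close> with \<open>a = ip H x y\<close> is nonnegative; its minimum gives the bound if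
\<open>y\<close> has positive norm, and a large \<open>r\<close> forces \<open>a = 0\<close> if \<open>y\<close> is null.
\<close>

lemma Cauchy_Schwarz:
  assumes x: "x \<in> vecs H" and y: "y \<in> vecs H"
  shows "cmod (ip H x y) \<le> nrm H x * nrm H y"
proof -
  define a where "a = ip H x y"
  define X where "X = Re (ip H x x)"
  define Y where "Y = Re (ip H y y)"
  have XY: "0 \<le> X" "0 \<le> Y" using x y by (simp_all add: X_def Y_def ip_nonneg)
  have quad: "0 \<le> X - 2 * r * (cmod a)\<^sup>2 + r\<^sup>2 * (cmod a)\<^sup>2 * Y" for r
  proof -
    define c where "c = - of_real r * a"
    have c: "vscale H c y \<in> vecs H" using y by (rule scale_in)
    have "ip H (vadd H x (vscale H c y)) (vadd H x (vscale H c y))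
        = ip H x x + cnj c * a + c * cnj a + c * cnj c * ip H y y"
      using x y c by (simp add: ip_add ip_add_right ip_scale ip_scale_right add_in a_def
          ip_commute[of x y] algebra_simps)
    also have "\<dots> = of_real X - 2 * of_real r * (a * cnj a) + (of_real r)\<^sup>2 * (a * cnj a) * of_real Y"
      using ip_self[OF x] ip_self[OF y]
      by (simp add: X_def Y_def c_def algebra_simps power2_eq_square)
    also have "\<dots> = of_real (X - 2 * r * (cmod a)\<^sup>2 + r\<^sup>2 * (cmod a)\<^sup>2 * Y)"
      by (simp add: complex_norm_square[symmetric] del: complex_mult_cnj)
    finally show ?thesis using ip_nonneg[OF add_in[OF x c]] by simp
  qed
  have "(cmod a)\<^sup>2 \<le> X * Y"
  proof (cases "Y = 0")
    case True
    show ?thesis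
    proof (cases "a = 0")
      case False
      then have "0 < (cmod a)\<^sup>2" by simp
      \<comment> \<open>Any r above X / (2 |a|^2) makes the quadratic negative.\<close>
      then have "X - 2 * ((X + 1) / (cmod a)\<^sup>2) * (cmod a)\<^sup>2 < 0" using XY by simp
      then show ?thesis using quad[of "(X + 1) / (cmod a)\<^sup>2"] True by simp
    qed (use True in simp)
  next
    case False
    then have Y: "0 < Y" using XY by simp
    have "X - 2 * (1 / Y) * (cmod a)\<^sup>2 + (1 / Y)\<^sup>2 * (cmod a)\<^sup>2 * Y = X - (cmod a)\<^sup>2 / Y"
      using Y by (simp add: power2_eq_square field_simps)
    then have "(cmod a)\<^sup>2 / Y \<le> X" using quad[of "1 / Y"] by simp
    then show ?thesis using Y by (simp add: field_simps)
  qed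
  then have "cmod a \<le> sqrt (X * Y)" by (rule real_le_rsqrt)
  then show ?thesis by (simp add: a_def nrm_def X_def Y_def real_sqrt_mult)
qed

lemma nrm_add_le:
  assumes x: "x \<in> vecs H" and y: "y \<in> vecs H"
  shows "nrm H (vadd H x y) \<le> nrm H x + nrm H y"
proof (rule power2_le_imp_le)
  have "(nrm H (vadd H x y))\<^sup>2 = (nrm H x)\<^sup>2 + (nrm H y)\<^sup>2 + 2 * Re (ip H x y)"
    using x y by (simp add: nrm_power2 add_in ip_add ip_add_right ip_commute[of x y])
  also have "Re (ip H x y) \<le> nrm H x * nrm H y"
    using Cauchy_Schwarz[OF x y] complex_Re_le_cmod order_trans by blast
  finally show "(nrm H (vadd H x y))\<^sup>2 \<le> (nrm H x + nrm H y)\<^sup>2"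
    by (simp add: power2_sum algebra_simps)
  show "0 \<le> nrm H x + nrm H y" using x y by (simp add: nrm_nonneg)
qed

lemma nrm_cong:
  assumes "x \<in> vecs H" "y \<in> vecs H" "\<And>z. z \<in> vecs H \<Longrightarrow> ip H x z = ip H y z"
  shows "nrm H x = nrm H y"
  using assms ip_commute[of x y] ip_self[of y] by (simp add: nrm_def)

lemma nrm_diff_triangle:
  assumes "x \<in> vecs H" "y \<in> vecs H" "z \<in> vecs H"
  shows "nrm H (vdiff H x z) \<le> nrm H (vdiff H x y) + nrm H (vdiff H y z)"
proof -
  have "nrm H (vdiff H x z) = nrm H (vadd H (vdiff H x y) (vdiff H y z))"
    using assms by (intro nrm_cong) (simp_all add: diff_in add_in ip_diff ip_add)
  then show ?thesis using assms nrm_add_le[of "vdiff H x y" "vdiff H y z"] by (simp add: diff_in)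
qed

lemma nrm_diff_commute:
  assumes "x \<in> vecs H" "y \<in> vecs H"
  shows "nrm H (vdiff H x y) = nrm H (vdiff H y x)"
  using assms by (simp add: nrm_def diff_in ip_diff ip_diff_right)

lemma nrm_le_add_diff:
  assumes "x \<in> vecs H" "y \<in> vecs H"
  shows "nrm H x \<le> nrm H y + nrm H (vdiff H x y)"
proof -
  have "nrm H x = nrm H (vadd H y (vdiff H x y))"
    using assms by (intro nrm_cong) (simp_all add: diff_in add_in ip_diff ip_add)
  then show ?thesis using assms nrm_add_le[of y "vdiff H x y"] by (simp add: diff_in)
qed

lemma ip_null:
  assumes "x \<in> vecs H" "z \<in> vecs H" "nrm H x = 0"
  shows "ip H x z = 0"
  using Cauchy_Schwarz[OF assms(1,2)] assms(3) by simp

lemma nrm_eq_0_iff: "x \<in> vecs H \<Longrightarrow> nrm H x = 0 \<longleftrightarrow> ip H x x = 0"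
  using ip_self[of x] by (auto simp: nrm_def)

lemma hilb_eqI:
  assumes "x \<in> vecs H" "y \<in> vecs H" "nrm H (vdiff H x y) = 0"
  shows "hilb_eq H x y"
  using assms nrm_eq_0_iff[OF diff_in[OF assms(1,2)]]
  by (simp add: hilb_eq_def vdiff_def Let_def)

lemma hilb_eq_ip:
  assumes "x \<in> vecs H" "y \<in> vecs H" "z \<in> vecs H" "hilb_eq H x y"
  shows "ip H x z = ip H y z"
  using assms ip_null[of "vdiff H x y" z] nrm_eq_0_iff[OF diff_in[OF assms(1,2)]]
  by (simp add: hilb_eq_def vdiff_def[symmetric] Let_def diff_in ip_diff)

lemma ip_polarization:
  assumes x: "x \<in> vecs H" and y: "y \<in> vecs H"
  shows "4 * ip H x y = of_real (Re (ip H (vadd H x y) (vadd H x y)))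
       - of_real (Re (ip H (vadd H x (vscale H (-1) y)) (vadd H x (vscale H (-1) y))))
       + \<i> * of_real (Re (ip H (vadd H x (vscale H \<i> y)) (vadd H x (vscale H \<i> y))))
       - \<i> * of_real (Re (ip H (vadd H x (vscale H (-\<i>) y)) (vadd H x (vscale H (-\<i>) y))))"
  using x y
  by (simp add: ip_self[symmetric] add_in scale_in)
     (simp add: ip_add ip_add_right ip_scale ip_scale_right scale_in add_in algebra_simps)

lemma finite_combination:
  assumes "finite A" "\<And>i. i \<in> A \<Longrightarrow> e i \<in> vecs H"
  shows "\<exists>y\<in>vecs H. \<forall>z\<in>vecs H. ip H y z = (\<Sum>i\<in>A. c i * ip H (e i) z)"
  using assms
proof (induction A rule: finite_induct)
  case empty
  obtain x where "x \<in> vecs H" using nonempty by blast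
  then show ?case by (intro bexI[of _ "vscale H 0 x"]) (simp_all add: scale_in ip_scale)
next
  case (insert j A)
  then obtain y where "y \<in> vecs H" "\<forall>z\<in>vecs H. ip H y z = (\<Sum>i\<in>A. c i * ip H (e i) z)"
    by auto
  then show ?case using insert
    by (intro bexI[of _ "vadd H (vscale H (c j) (e j)) y"])
       (simp_all add: scale_in add_in ip_add ip_scale)
qed

lemma telescope_le:
  assumes x: "\<And>n. x n \<in> vecs H"
  shows "nrm H (vdiff H (x (n + j)) (x n)) \<le> (\<Sum>i<j. nrm H (vdiff H (x (Suc (n + i))) (x (n + i))))"
proof (induction j)
  case 0
  then show ?case using x by (simp add: nrm_def diff_in ip_diff ip_diff_right)
next
  case (Suc j)
  then show ?case using nrm_diff_triangle[OF x[of "Suc (n + j)"] x[of "n + j"] x[of n]] by simp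
qed

end

text \<open>
Completeness in the form that absolutely convergent series converge. This form passes to direct
integrals, because the steps of a sequence of sections can be summed in almost every fibre.
\<close>

locale hilbert = pre_hilb +
  assumes complete: "(\<And>n. x n \<in> vecs H) \<Longrightarrow>
      summable (\<lambda>n. nrm H (vdiff H (x (Suc n)) (x n))) \<Longrightarrow>
      \<exists>y\<in>vecs H. (\<lambda>n. nrm H (vdiff H (x n) y)) \<longlonglongrightarrow> 0"

locale hilbert_basis = hilbert +
  fixes I :: "'i set" and e :: "'i \<Rightarrow> 'a"
  assumes e_in: "i \<in> I \<Longrightarrow> e i \<in> vecs H"
    and orthonormal: "i \<in> I \<Longrightarrow> j \<in> I \<Longrightarrow> ip H (e i) (e j) = (if i = j then 1 else 0)"
    and total: "x \<in> vecs H \<Longrightarrow> (\<And>i. i \<in> I \<Longrightarrow> ip H x (e i) = 0) \<Longrightarrow> nrm H x = 0"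
begin

lemma combination:
  assumes "finite A" "A \<subseteq> I"
  shows "\<exists>y. y \<in> vecs H \<and> (\<forall>z\<in>vecs H. ip H y z = (\<Sum>i\<in>A. c i * ip H (e i) z))
    \<and> (\<forall>j\<in>I. ip H y (e j) = (if j \<in> A then c j else 0))
    \<and> Re (ip H y y) = (\<Sum>i\<in>A. (cmod (c i))\<^sup>2)"
proof -
  obtain y where y: "y \<in> vecs H" "\<forall>z\<in>vecs H. ip H y z = (\<Sum>i\<in>A. c i * ip H (e i) z)"
    using finite_combination[OF assms(1), of e c] assms(2) e_in by blast
  have coef: "ip H y (e j) = (if j \<in> A then c j else 0)" if j: "j \<in> I" for j
  proof -
    have "ip H y (e j) = (\<Sum>i\<in>A. if i = j then c i else 0)"
      using y e_in[OF j] by simp (intro sum.cong; use assms(2) j in \<open>auto simp: orthonormal subset_iff\<close>)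
    then show ?thesis using assms(1) by simp
  qed
  have "ip H y y = (\<Sum>i\<in>A. c i * cnj (ip H y (e i)))"
    using y(2)[rule_format, OF y(1)] ip_commute[OF y(1) e_in] assms(2)
    by (auto intro!: sum.cong)
  also have "\<dots> = (\<Sum>i\<in>A. of_real ((cmod (c i))\<^sup>2))"
    using assms(2) by (intro sum.cong) (auto simp: coef subset_iff complex_norm_square[symmetric] simp del: complex_mult_cnj)
  finally have "Re (ip H y y) = (\<Sum>i\<in>A. (cmod (c i))\<^sup>2)"
    by (simp del: of_real_power)
  then show ?thesis using y coef by blast
qed

lemma Bessel:
  assumes x: "x \<in> vecs H" and A: "finite A" "A \<subseteq> I"
  shows "(\<Sum>i\<in>A. (cmod (ip H x (e i)))\<^sup>2) \<le> Re (ip H x x)"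
proof -
  obtain y where y: "y \<in> vecs H"
    "\<forall>z\<in>vecs H. ip H y z = (\<Sum>i\<in>A. ip H x (e i) * ip H (e i) z)"
    "Re (ip H y y) = (\<Sum>i\<in>A. (cmod (ip H x (e i)))\<^sup>2)"
    using combination[OF A, of "\<lambda>i. ip H x (e i)"] by blast
  have "ip H y x = (\<Sum>i\<in>A. ip H x (e i) * cnj (ip H x (e i)))"
    using y(2)[rule_format, OF x] ip_commute[OF x e_in] A(2) by (auto intro!: sum.cong)
  then have yx: "ip H y x = of_real (\<Sum>i\<in>A. (cmod (ip H x (e i)))\<^sup>2)"
    by (simp add: complex_norm_square[symmetric] del: complex_mult_cnj)
  have "Re (ip H (vdiff H x y) (vdiff H x y)) = Re (ip H x x) - (\<Sum>i\<in>A. (cmod (ip H x (e i)))\<^sup>2)"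
    using x y(1,3) yx ip_commute[OF y(1) x] by (simp add: diff_in ip_diff ip_diff_right)
  then show ?thesis using ip_nonneg[OF diff_in[OF x y(1)]] by simp
qed

lemma coefficients_summable:
  assumes "x \<in> vecs H"
  shows "(\<lambda>i. (cmod (ip H x (e i)))\<^sup>2) summable_on I"
  by (rule nonneg_bounded_partial_sums_imp_summable_on[where C = "Re (ip H x x)"])
     (auto simp: eventually_finite_subsets_at_top intro!: exI[of _ "{}"] Bessel[OF assms])

text \<open>
Finite partial sums over index sets \<open>A n\<close> outside which every finite sum of squares is at most
\<open>(1/4)^n\<close> have summable steps: a step involves only the two differences of
consecutive sets, and each of these avoids one of the two sets, so both contribute little.
\<close>

lemma Riesz_Fischer:
  assumes c: "(\<lambda>i. (cmod (c i))\<^sup>2) summable_on I"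
  obtains y where "y \<in> vecs H" "\<And>i. i \<in> I \<Longrightarrow> ip H y (e i) = c i"
    "Re (ip H y y) \<le> (\<Sum>\<^sub>\<infinity>i\<in>I. (cmod (c i))\<^sup>2)"
proof -
  let ?f = "\<lambda>i. (cmod (c i))\<^sup>2"
  let ?s = "\<Sum>\<^sub>\<infinity>i\<in>I. ?f i"
  have small: "\<exists>A. finite A \<and> A \<subseteq> I \<and> (\<forall>B. finite B \<longrightarrow> B \<subseteq> I \<longrightarrow> B \<inter> A = {} \<longrightarrow> sum ?f B \<le> \<epsilon>)"
    if "\<epsilon> > 0" for \<epsilon> :: real
  proof -
    have "eventually (\<lambda>A. dist (sum ?f A) ?s < \<epsilon>) (finite_subsets_at_top I)"
      using has_sum_infsum[OF c] that unfolding has_sum_def by (rule tendstoD)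
    then obtain A where A: "finite A" "A \<subseteq> I" "dist (sum ?f A) ?s < \<epsilon>"
      unfolding eventually_finite_subsets_at_top by blast
    have "sum ?f B \<le> \<epsilon>" if B: "finite B" "B \<subseteq> I" "B \<inter> A = {}" for B
    proof -
      have "sum ?f A + sum ?f B = sum ?f (A \<union> B)"
        using A B by (subst sum.union_disjoint) auto
      also have "\<dots> \<le> ?s" using A B c by (intro finite_sum_le_infsum) auto
      finally show ?thesis using A(3) by (simp add: dist_real_def)
    qed
    then show ?thesis using A by blast
  qed
  have "\<forall>n. \<exists>A. finite A \<and> A \<subseteq> I \<and> (\<forall>B. finite B \<longrightarrow> B \<subseteq> I \<longrightarrow> B \<inter> A = {} \<longrightarrow> sum ?f B \<le> (1/4)^n)"
    by (intro allI small) simp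
  then obtain A where A: "\<And>n. finite (A n)" "\<And>n. A n \<subseteq> I"
    and tail: "\<And>n B. finite B \<Longrightarrow> B \<subseteq> I \<Longrightarrow> B \<inter> A n = {} \<Longrightarrow> sum ?f B \<le> (1/4)^n"
    by metis
  have "\<forall>n. \<exists>y. y \<in> vecs H \<and> (\<forall>z\<in>vecs H. ip H y z = (\<Sum>i\<in>A n. c i * ip H (e i) z))
      \<and> (\<forall>j\<in>I. ip H y (e j) = (if j \<in> A n then c j else 0)) \<and> Re (ip H y y) = sum ?f (A n)"
    by (intro allI combination A)
  from choice[OF this] obtain y where Y: "\<forall>n. y n \<in> vecs H
      \<and> (\<forall>z\<in>vecs H. ip H (y n) z = (\<Sum>i\<in>A n. c i * ip H (e i) z))
      \<and> (\<forall>j\<in>I. ip H (y n) (e j) = (if j \<in> A n then c j else 0))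
      \<and> Re (ip H (y n) (y n)) = sum ?f (A n)" ..
  then have y: "\<And>n. y n \<in> vecs H"
    "\<And>n z. z \<in> vecs H \<Longrightarrow> ip H (y n) z = (\<Sum>i\<in>A n. c i * ip H (e i) z)"
    "\<And>n j. j \<in> I \<Longrightarrow> ip H (y n) (e j) = (if j \<in> A n then c j else 0)"
    "\<And>n. Re (ip H (y n) (y n)) = sum ?f (A n)"
    by blast+
  have step: "nrm H (vdiff H (y (Suc n)) (y n)) \<le> 2 * (1/2)^n" for n
  proof -
    let ?B = "A (Suc n)" and ?A = "A n"
    obtain w where w: "w \<in> vecs H" "\<forall>z\<in>vecs H. ip H w z = (\<Sum>i\<in>?B - ?A. c i * ip H (e i) z)"
      "Re (ip H w w) = sum ?f (?B - ?A)"
      using combination[OF finite_Diff[OF A(1)[of "Suc n"]] subset_trans[OF Diff_subset A(2)], of c "?A"] by blast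
    obtain v where v: "v \<in> vecs H" "\<forall>z\<in>vecs H. ip H v z = (\<Sum>i\<in>?A - ?B. c i * ip H (e i) z)"
      "Re (ip H v v) = sum ?f (?A - ?B)"
      using combination[OF finite_Diff[OF A(1)[of n]] subset_trans[OF Diff_subset A(2)], of c "?B"] by blast
    have split: "sum g ?B - sum g ?A = sum g (?B - ?A) - sum g (?A - ?B)" for g :: "'i \<Rightarrow> complex"
      using sum.Int_Diff[OF A(1), of g "Suc n" ?A] sum.Int_Diff[OF A(1), of g n ?B]
      by (simp add: Int_commute)
    have "nrm H (vdiff H (y (Suc n)) (y n)) = nrm H (vdiff H w v)"
      using y v w split by (intro nrm_cong) (simp_all add: diff_in ip_diff)
    also have "\<dots> \<le> nrm H w + nrm H v"
    proof -
      have "nrm H (vscale H (-1) v) = nrm H v"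
        using v by (simp add: nrm_def ip_scale ip_scale_right scale_in)
      then show ?thesis using nrm_add_le[OF w(1) scale_in[OF v(1), of "-1"]] by (simp add: vdiff_def)
    qed
    also have "\<dots> \<le> sqrt ((1/4)^n) + sqrt ((1/4)^n)"
    proof (rule add_mono)
      show "nrm H w \<le> sqrt ((1/4)^n)"
        unfolding nrm_def w(3) using A tail[of "?B - ?A" n] by (auto intro!: real_sqrt_le_mono)
      have "sum ?f (?A - ?B) \<le> (1/4)^Suc n" using A tail[of "?A - ?B" "Suc n"] by auto
      also have "\<dots> \<le> (1/4)^n" by simp
      finally show "nrm H v \<le> sqrt ((1/4)^n)"
        unfolding nrm_def v(3) by (rule real_sqrt_le_mono)
    qed
    also have "sqrt ((1/4)^n) = (1/2)^n"
      by (simp add: real_sqrt_power real_sqrt_divide)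
    finally show ?thesis by simp
  qed
  have "summable (\<lambda>n. nrm H (vdiff H (y (Suc n)) (y n)))"
  proof (rule summable_comparison_test)
    show "\<exists>N. \<forall>n\<ge>N. norm (nrm H (vdiff H (y (Suc n)) (y n))) \<le> 2 * (1/2)^n"
      using step y(1) by (auto simp: nrm_nonneg diff_in)
    show "summable (\<lambda>n. 2 * (1/2::real)^n)" by (intro summable_mult summable_geometric) simp
  qed
  from complete[OF y(1) this] obtain x where x: "x \<in> vecs H"
    and lim: "(\<lambda>n. nrm H (vdiff H (y n) x)) \<longlonglongrightarrow> 0" by blast
  show ?thesis
  proof
    show "x \<in> vecs H" by (rule x)
    fix i assume i: "i \<in> I"
    have "(\<lambda>n. ip H (y n) (e i) - ip H x (e i)) \<longlonglongrightarrow> 0"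
    proof (rule Lim_null_comparison)
      show "\<forall>\<^sub>F n in sequentially. norm (ip H (y n) (e i) - ip H x (e i)) \<le> nrm H (vdiff H (y n) x) * nrm H (e i)"
        using Cauchy_Schwarz[OF diff_in[OF y(1) x] e_in[OF i]] x y(1) e_in[OF i] by (simp add: ip_diff)
      show "(\<lambda>n. nrm H (vdiff H (y n) x) * nrm H (e i)) \<longlonglongrightarrow> 0"
        using tendsto_mult_left_zero[OF lim] .
    qed
    then have 1: "(\<lambda>n. ip H (y n) (e i)) \<longlonglongrightarrow> ip H x (e i)" by (simp add: LIM_zero_iff)
    have "(\<lambda>n. ip H (y n) (e i) - c i) \<longlonglongrightarrow> 0"
    proof (rule Lim_null_comparison)
      have "cmod (ip H (y n) (e i) - c i) \<le> (1/2)^n" for n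
      proof (cases "i \<in> A n")
        case False
        then have "(cmod (c i))\<^sup>2 \<le> (1/4)^n" using tail[of "{i}" n] i by simp
        then have "cmod (c i) \<le> sqrt ((1/4)^n)" by (rule real_le_rsqrt)
        then show ?thesis using y(3)[OF i] False by (simp add: real_sqrt_power real_sqrt_divide)
      qed (simp add: y(3)[OF i])
      then show "\<forall>\<^sub>F n in sequentially. norm (ip H (y n) (e i) - c i) \<le> (1/2)^n" by simp
      show "(\<lambda>n. (1/2::real)^n) \<longlonglongrightarrow> 0" by (simp add: LIMSEQ_power_zero)
    qed
    then have "(\<lambda>n. ip H (y n) (e i)) \<longlonglongrightarrow> c i" by (simp add: LIM_zero_iff)
    then show "ip H x (e i) = c i" using 1 LIMSEQ_unique by blast
  next
    have "nrm H x \<le> sqrt ?s"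
    proof (rule LIMSEQ_le_const)
      have "(\<lambda>n. sqrt ?s + nrm H (vdiff H (y n) x)) \<longlonglongrightarrow> sqrt ?s + 0"
        by (intro tendsto_add tendsto_const lim)
      then show "(\<lambda>n. sqrt ?s + nrm H (vdiff H (y n) x)) \<longlonglongrightarrow> sqrt ?s" by simp
      have "nrm H x \<le> sqrt ?s + nrm H (vdiff H (y n) x)" for n
      proof -
        have "nrm H (y n) \<le> sqrt ?s"
          unfolding nrm_def y(4) using A c by (intro real_sqrt_le_mono finite_sum_le_infsum) auto
        then show ?thesis using nrm_le_add_diff[OF x y(1)[of n]] nrm_diff_commute[OF x y(1)[of n]] by simp
      qed
      then show "\<exists>N. \<forall>n\<ge>N. nrm H x \<le> sqrt ?s + nrm H (vdiff H (y n) x)" by blast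
    qed
    then show "Re (ip H x x) \<le> ?s" by (simp add: nrm_def)
  qed
qed

lemma same_coefficients:
  assumes "x \<in> vecs H" "y \<in> vecs H" "\<And>i. i \<in> I \<Longrightarrow> ip H x (e i) = ip H y (e i)"
  shows "hilb_eq H x y"
  using assms by (intro hilb_eqI total) (simp_all add: diff_in ip_diff e_in)

text \<open>
The vector that the coefficients of \<open>x\<close> produce has, by totality, the norm of \<open>x\<close>, and it has norm at
most the sum of the squared coefficients. The other inequality is Bessel's.
\<close>

lemma Parseval:
  assumes x: "x \<in> vecs H"
  shows "((\<lambda>i. (cmod (ip H x (e i)))\<^sup>2) has_sum Re (ip H x x)) I"
proof -
  note c = coefficients_summable[OF x]
  obtain y where y: "y \<in> vecs H" "\<And>i. i \<in> I \<Longrightarrow> ip H y (e i) = ip H x (e i)"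
    "Re (ip H y y) \<le> (\<Sum>\<^sub>\<infinity>i\<in>I. (cmod (ip H x (e i)))\<^sup>2)"
    using Riesz_Fischer[OF c] by blast
  have "nrm H x = nrm H y"
    using same_coefficients[OF x y(1)] y(2) x y(1) by (intro nrm_cong hilb_eq_ip) simp_all
  then have "Re (ip H x x) \<le> (\<Sum>\<^sub>\<infinity>i\<in>I. (cmod (ip H x (e i)))\<^sup>2)"
    using y(3) by (simp add: nrm_def)
  moreover have "(\<Sum>\<^sub>\<infinity>i\<in>I. (cmod (ip H x (e i)))\<^sup>2) \<le> Re (ip H x x)"
    using Bessel[OF x] c by (intro infsum_le_finite_sums) auto
  ultimately show ?thesis using has_sum_infsum[OF c] by simp
qed

end

section \<open>Direct integrals of Hilbert spaces\<close>

lemmas lebesgue_integral_cong = Bochner_Integration.integral_cong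

text \<open>
The last condition is the only one that involves measurability, and weak measurability alone does
not imply it. With it, polarization makes the scalar product of any two sections measurable, and that
is all the theory of direct integrals needs.
\<close>

locale hilb_field =
  fixes M :: "'x measure" and S :: "('x \<Rightarrow> 'v) set" and H :: "'x \<Rightarrow> 'v hilb"
  assumes fibre: "x \<in> space M \<Longrightarrow> hilbert (H x)"
    and section_in: "s \<in> S \<Longrightarrow> x \<in> space M \<Longrightarrow> s x \<in> vecs (H x)"
    and norm_measurable: "(\<And>x. x \<in> space M \<Longrightarrow> F x \<in> vecs (H x)) \<Longrightarrow>
      (\<And>s. s \<in> S \<Longrightarrow> (\<lambda>x. ip (H x) (F x) (s x)) \<in> borel_measurable M) \<Longrightarrow>
      (\<lambda>x. Re (ip (H x) (F x) (F x))) \<in> borel_measurable M"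
begin

abbreviation DI where "DI \<equiv> direct_integral M S H"

text \<open>
A measurable section; the members of the direct integral are those with integrable squared norm.
\<close>

definition msec :: "('x \<Rightarrow> 'v) \<Rightarrow> bool" where
  "msec F \<longleftrightarrow> (\<forall>x\<in>space M. F x \<in> vecs (H x)) \<and> (\<forall>s\<in>S. (\<lambda>x. ip (H x) (F x) (s x)) \<in> borel_measurable M)"

lemma fibre_pre: "x \<in> space M \<Longrightarrow> pre_hilb (H x)"
  using fibre hilbert.axioms(1) by blast

lemma msecD: "msec F \<Longrightarrow> x \<in> space M \<Longrightarrow> F x \<in> vecs (H x)"
  by (simp add: msec_def)

lemma msec_measurable: "msec F \<Longrightarrow> s \<in> S \<Longrightarrow> (\<lambda>x. ip (H x) (F x) (s x)) \<in> borel_measurable M"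
  by (simp add: msec_def)

lemma msec_add:
  assumes F: "msec F" and G: "msec G"
  shows "msec (\<lambda>x. vadd (H x) (F x) (G x))"
  unfolding msec_def
proof (intro conjI ballI)
  fix s assume s: "s \<in> S"
  have "(\<lambda>x. ip (H x) (F x) (s x) + ip (H x) (G x) (s x)) \<in> borel_measurable M"
    using msec_measurable[OF F s] msec_measurable[OF G s] by measurable
  then show "(\<lambda>x. ip (H x) (vadd (H x) (F x) (G x)) (s x)) \<in> borel_measurable M"
    by (rule measurable_cong[THEN iffD1, rotated])
       (simp add: pre_hilb.ip_add[OF fibre_pre] msecD F G section_in s)
qed (simp add: pre_hilb.add_in[OF fibre_pre] msecD F G)

lemma msec_scale:
  assumes F: "msec F" and c: "c \<in> borel_measurable M"
  shows "msec (\<lambda>x. vscale (H x) (c x) (F x))"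
  unfolding msec_def
proof (intro conjI ballI)
  fix s assume s: "s \<in> S"
  have "(\<lambda>x. c x * ip (H x) (F x) (s x)) \<in> borel_measurable M"
    using msec_measurable[OF F s] c by measurable
  then show "(\<lambda>x. ip (H x) (vscale (H x) (c x) (F x)) (s x)) \<in> borel_measurable M"
    by (rule measurable_cong[THEN iffD1, rotated])
       (simp add: pre_hilb.ip_scale[OF fibre_pre] msecD F section_in s)
qed (simp add: pre_hilb.scale_in[OF fibre_pre] msecD F)

lemma msec_diff:
  assumes F: "msec F" and G: "msec G"
  shows "msec (\<lambda>x. vdiff (H x) (F x) (G x))"
  unfolding vdiff_def by (intro msec_add F msec_scale[OF G, of "\<lambda>_. -1"]) simp

lemma msec_norm_measurable:
  assumes "msec F" shows "(\<lambda>x. Re (ip (H x) (F x) (F x))) \<in> borel_measurable M"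
  using assms by (intro norm_measurable) (simp_all add: msec_def)

lemma ip_measurable:
  assumes F: "msec F" and G: "msec G"
  shows "(\<lambda>x. ip (H x) (F x) (G x)) \<in> borel_measurable M"
proof -
  let ?N = "\<lambda>c x. Re (ip (H x) (vadd (H x) (F x) (vscale (H x) c (G x))) (vadd (H x) (F x) (vscale (H x) c (G x))))"
  have N: "?N c \<in> borel_measurable M" for c
    by (intro msec_norm_measurable msec_add F msec_scale[OF G, of "\<lambda>_. c"]) simp
  have N0: "(\<lambda>x. Re (ip (H x) (vadd (H x) (F x) (G x)) (vadd (H x) (F x) (G x)))) \<in> borel_measurable M"
    by (intro msec_norm_measurable msec_add F G)
  have "(\<lambda>x. (of_real (Re (ip (H x) (vadd (H x) (F x) (G x)) (vadd (H x) (F x) (G x)))) - of_real (?N (-1) x)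
      + \<i> * of_real (?N \<i> x) - \<i> * of_real (?N (-\<i>) x)) / 4) \<in> borel_measurable M"
    using N0 N[of "-1"] N[of \<i>] N[of "-\<i>"] by measurable
  then show ?thesis
    by (rule measurable_cong[THEN iffD1, rotated])
       (simp add: pre_hilb.ip_polarization[OF fibre_pre, symmetric] msecD F G)
qed

lemma vecs_DI: "F \<in> vecs DI \<longleftrightarrow> msec F \<and> integrable M (\<lambda>x. Re (ip (H x) (F x) (F x)))"
  by (simp add: direct_integral_def msec_def)

lemma DI_simps:
  "vadd DI F G = (\<lambda>x. vadd (H x) (F x) (G x))" "vscale DI c F = (\<lambda>x. vscale (H x) c (F x))"
  "vdiff DI F G = (\<lambda>x. vdiff (H x) (F x) (G x))" "ip DI F G = (LINT x|M. ip (H x) (F x) (G x))"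
  by (simp_all add: direct_integral_def vdiff_def)

lemma integrable_ip:
  assumes F: "F \<in> vecs DI" and G: "G \<in> vecs DI"
  shows "integrable M (\<lambda>x. ip (H x) (F x) (G x))"
proof (rule Bochner_Integration.integrable_bound)
  show "integrable M (\<lambda>x. Re (ip (H x) (F x) (F x)) + Re (ip (H x) (G x) (G x)))"
    using F G by (simp add: vecs_DI)
  show "(\<lambda>x. ip (H x) (F x) (G x)) \<in> borel_measurable M"
    using F G by (simp add: vecs_DI ip_measurable)
  show "AE x in M. cmod (ip (H x) (F x) (G x)) \<le> norm (Re (ip (H x) (F x) (F x)) + Re (ip (H x) (G x) (G x)))"
  proof (rule AE_I2)
    fix x assume x: "x \<in> space M"
    interpret pre_hilb "H x" using x by (rule fibre_pre)
    have FG: "F x \<in> vecs (H x)" "G x \<in> vecs (H x)" using F G x by (simp_all add: vecs_DI msecD)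
    have "nrm (H x) (F x) * nrm (H x) (G x) \<le> (nrm (H x) (F x))\<^sup>2 + (nrm (H x) (G x))\<^sup>2"
      using sum_squares_bound[of "nrm (H x) (F x)" "nrm (H x) (G x)"]
        mult_nonneg_nonneg[OF nrm_nonneg[OF FG(1)] nrm_nonneg[OF FG(2)]] by simp
    then show "cmod (ip (H x) (F x) (G x)) \<le> norm (Re (ip (H x) (F x) (F x)) + Re (ip (H x) (G x) (G x)))"
      using Cauchy_Schwarz[OF FG] FG by (simp add: nrm_power2)
  qed
qed

text \<open>
Fibres have no distinguished zero vector, only null vectors; they are chosen here all at once.
\<close>

lemma zero_section:
  "\<exists>Z\<in>vecs DI. \<forall>x\<in>space M. \<forall>z\<in>vecs (H x). ip (H x) (Z x) z = 0"
proof -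
  define Z where "Z x = vscale (H x) 0 (SOME v. v \<in> vecs (H x))" for x
  have some: "(SOME v. v \<in> vecs (H x)) \<in> vecs (H x)" if "x \<in> space M" for x
    using pre_hilb.nonempty[OF fibre_pre[OF that]] some_in_eq by blast
  have Z: "Z x \<in> vecs (H x)" if "x \<in> space M" for x
    using pre_hilb.scale_in[OF fibre_pre[OF that] some[OF that]] by (simp add: Z_def)
  have 0: "ip (H x) (Z x) z = 0" if "x \<in> space M" "z \<in> vecs (H x)" for x z
    using pre_hilb.ip_scale[OF fibre_pre[OF that(1)] some[OF that(1)] that(2), of 0] by (simp add: Z_def)
  have "msec Z"
    unfolding msec_def
  proof (intro conjI ballI)
    fix s assume s: "s \<in> S"
    show "(\<lambda>x. ip (H x) (Z x) (s x)) \<in> borel_measurable M"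
      by (rule measurable_cong[THEN iffD1, OF _ borel_measurable_const[of 0]]) (simp add: 0 section_in s)
  qed (rule Z)
  moreover have "integrable M (\<lambda>x. Re (ip (H x) (Z x) (Z x)))"
    by (rule Bochner_Integration.integrable_cong[THEN iffD1, OF refl _ integrable_zero]) (simp add: 0 Z)
  ultimately show ?thesis using 0 by (intro bexI[of _ Z]) (simp_all add: vecs_DI)
qed

lemma pre_hilb_DI: "pre_hilb DI"
proof
  show "vecs DI \<noteq> {}" using zero_section by blast
next
  fix F G assume F: "F \<in> vecs DI" and G: "G \<in> vecs DI"
  show "vadd DI F G \<in> vecs DI"
  proof -
    have "integrable M (\<lambda>x. Re (ip (H x) (F x) (F x)) + 2 * Re (ip (H x) (F x) (G x)) + Re (ip (H x) (G x) (G x)))"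
      using F G integrable_ip[OF F G] by (simp add: vecs_DI)
    then have "integrable M (\<lambda>x. Re (ip (H x) (vadd (H x) (F x) (G x)) (vadd (H x) (F x) (G x))))"
    proof (rule Bochner_Integration.integrable_cong[THEN iffD1, OF refl, rotated])
      fix x assume x: "x \<in> space M"
      interpret pre_hilb "H x" using x by (rule fibre_pre)
      have FG: "F x \<in> vecs (H x)" "G x \<in> vecs (H x)" using F G x by (simp_all add: vecs_DI msecD)
      show "Re (ip (H x) (F x) (F x)) + 2 * Re (ip (H x) (F x) (G x)) + Re (ip (H x) (G x) (G x))
        = Re (ip (H x) (vadd (H x) (F x) (G x)) (vadd (H x) (F x) (G x)))"
        using FG by (simp add: ip_add ip_add_right add_in ip_commute[OF FG])
    qed
    then show ?thesis using F G by (simp add: vecs_DI DI_simps msec_add)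
  qed
  show "ip DI G F = cnj (ip DI F G)"
  proof -
    have "ip DI G F = (LINT x|M. cnj (ip (H x) (F x) (G x)))"
      unfolding DI_simps
      using F G by (intro lebesgue_integral_cong refl pre_hilb.ip_commute[OF fibre_pre])
        (simp_all add: vecs_DI msecD)
    then show ?thesis by (simp add: DI_simps)
  qed
  show "0 \<le> Re (ip DI F F)"
  proof -
    have "Re (ip DI F F) = (LINT x|M. Re (ip (H x) (F x) (F x)))"
      using integrable_ip[OF F F] by (simp add: DI_simps)
    moreover have "0 \<le> (LINT x|M. Re (ip (H x) (F x) (F x)))"
      using F by (intro integral_nonneg_AE AE_I2) (simp add: pre_hilb.ip_nonneg[OF fibre_pre] vecs_DI msecD)
    ultimately show ?thesis by simp
  qed
  fix c
  show "vscale DI c F \<in> vecs DI"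
  proof -
    have "integrable M (\<lambda>x. (cmod c)\<^sup>2 * Re (ip (H x) (F x) (F x)))"
      using F by (simp add: vecs_DI)
    then have "integrable M (\<lambda>x. Re (ip (H x) (vscale (H x) c (F x)) (vscale (H x) c (F x))))"
    proof (rule Bochner_Integration.integrable_cong[THEN iffD1, OF refl, rotated])
      fix x assume x: "x \<in> space M"
      interpret pre_hilb "H x" using x by (rule fibre_pre)
      have Fx: "F x \<in> vecs (H x)" using F x by (simp add: vecs_DI msecD)
      have "ip (H x) (vscale (H x) c (F x)) (vscale (H x) c (F x)) = c * cnj c * ip (H x) (F x) (F x)"
        using Fx by (simp add: ip_scale ip_scale_right scale_in)
      also have "\<dots> = of_real ((cmod c)\<^sup>2) * ip (H x) (F x) (F x)"
        by (simp only: complex_norm_square)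
      finally show "(cmod c)\<^sup>2 * Re (ip (H x) (F x) (F x)) = Re (ip (H x) (vscale (H x) c (F x)) (vscale (H x) c (F x)))"
        by (simp del: of_real_power)
    qed
    then show ?thesis using F by (simp add: vecs_DI DI_simps msec_scale)
  qed
  show "ip DI (vscale DI c F) G = c * ip DI F G"
  proof -
    have "ip DI (vscale DI c F) G = (LINT x|M. c * ip (H x) (F x) (G x))"
      unfolding DI_simps
      using F G by (intro lebesgue_integral_cong refl pre_hilb.ip_scale[OF fibre_pre])
        (simp_all add: vecs_DI msecD)
    then show ?thesis by (simp add: DI_simps)
  qed
  fix G' assume G': "G' \<in> vecs DI"
  show "ip DI (vadd DI F G) G' = ip DI F G' + ip DI G G'"
  proof -
    have "ip DI (vadd DI F G) G' = (LINT x|M. ip (H x) (F x) (G' x) + ip (H x) (G x) (G' x))"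
      unfolding DI_simps
      using F G G' by (intro lebesgue_integral_cong refl pre_hilb.ip_add[OF fibre_pre])
        (simp_all add: vecs_DI msecD)
    then show ?thesis using integrable_ip[OF F G'] integrable_ip[OF G G'] by (simp add: DI_simps)
  qed
qed

lemma nrm_DI:
  assumes "F \<in> vecs DI"
  shows "ennreal ((nrm DI F)\<^sup>2) = (\<integral>\<^sup>+x. ennreal (Re (ip (H x) (F x) (F x))) \<partial>M)"
proof -
  have "(nrm DI F)\<^sup>2 = Re (ip DI F F)"
    using pre_hilb.nrm_power2[OF pre_hilb_DI assms] .
  also have "\<dots> = (LINT x|M. Re (ip (H x) (F x) (F x)))"
    using integrable_ip[OF assms assms] by (simp add: DI_simps)
  also have "ennreal \<dots> = (\<integral>\<^sup>+x. ennreal (Re (ip (H x) (F x) (F x))) \<partial>M)"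
    using assms by (intro nn_integral_eq_integral[symmetric] AE_I2)
      (simp_all add: vecs_DI pre_hilb.ip_nonneg[OF fibre_pre] msecD)
  finally show ?thesis .
qed

text \<open>
Let \<open>b n x\<close> be the norm of the \<open>n\<close>-th step in the fibre over \<open>x\<close> and \<open>a n > 0\<close> a summable bound of its
\<open>L2\<close> norm. The function \<open>T x = (\<Sum>n. (b n x)\<^sup>2 / a n)\<close> has a finite integral, hence is finite almost
everywhere. Where it is finite, \<open>b n x \<le> a n + (b n x)\<^sup>2 / a n\<close> shows that the sequence converges in the
fibre, and Cauchy-Schwarz bounds the squared distance to the limit by \<open>T x\<close> times a tail of
the series of the \<open>a n\<close>. Integrating this bound gives convergence in the direct integral.
\<close>

theorem hilbert_DI: "hilbert DI"
proof (intro hilbert.intro pre_hilb_DI hilbert_axioms.intro)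
  interpret DI: pre_hilb DI by (rule pre_hilb_DI)
  fix X assume X: "\<And>n. X n \<in> vecs DI"
    and summ: "summable (\<lambda>n. nrm DI (vdiff DI (X (Suc n)) (X n)))"
  define a where "a n = nrm DI (vdiff DI (X (Suc n)) (X n)) + (1/2)^n" for n
  define b where "b n x = nrm (H x) (vdiff (H x) (X (Suc n) x) (X n x))" for n x
  have Xx: "X n x \<in> vecs (H x)" if "x \<in> space M" for n x
    using X that by (simp add: vecs_DI msecD)
  have msX: "msec (X n)" for n using X by (simp add: vecs_DI)
  have a_pos: "0 < a n" for n
    unfolding a_def using DI.nrm_nonneg[OF DI.diff_in[OF X X], of "Suc n" n] by (simp add: add_nonneg_pos)
  have a_summable: "summable a"
    unfolding a_def by (intro summable_add summ summable_geometric) simp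
  have b2: "(b n x)\<^sup>2 = Re (ip (H x) (vdiff (H x) (X (Suc n) x) (X n x)) (vdiff (H x) (X (Suc n) x) (X n x)))"
    if "x \<in> space M" for n x
    unfolding b_def using that by (intro pre_hilb.nrm_power2[OF fibre_pre] pre_hilb.diff_in[OF fibre_pre] Xx)
  have b_nonneg: "0 \<le> b n x" if "x \<in> space M" for n x
    unfolding b_def using that by (intro pre_hilb.nrm_nonneg[OF fibre_pre] pre_hilb.diff_in[OF fibre_pre] Xx)
  have b_meas: "(\<lambda>x. (b n x)\<^sup>2) \<in> borel_measurable M" for n
    by (rule measurable_cong[THEN iffD2, OF b2 msec_norm_measurable[OF msec_diff[OF msX msX]]])
  have b_int: "(\<integral>\<^sup>+x. ennreal ((b n x)\<^sup>2) \<partial>M) \<le> ennreal ((a n)\<^sup>2)" for n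
  proof -
    have "(\<integral>\<^sup>+x. ennreal ((b n x)\<^sup>2) \<partial>M) = ennreal ((nrm DI (vdiff DI (X (Suc n)) (X n)))\<^sup>2)"
      by (subst nrm_DI[OF DI.diff_in[OF X X]]) (simp add: DI_simps b2 cong: nn_integral_cong)
    also have "\<dots> \<le> ennreal ((a n)\<^sup>2)"
      unfolding a_def by (intro ennreal_leI power_mono DI.nrm_nonneg DI.diff_in X) simp
    finally show ?thesis .
  qed
  define T where "T x = (\<Sum>n. ennreal ((b n x)\<^sup>2 / a n))" for x
  have b_meas': "(\<lambda>x. ennreal ((b n x)\<^sup>2 / a n)) \<in> borel_measurable M" for n
    by (rule measurable_compose[OF b_meas, of "\<lambda>y. ennreal (y / a n)"]) simp
  have T_meas [measurable]: "T \<in> borel_measurable M"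
    unfolding T_def by (intro borel_measurable_suminf_order b_meas')
  have "(\<integral>\<^sup>+x. T x \<partial>M) = (\<Sum>n. \<integral>\<^sup>+x. ennreal ((b n x)\<^sup>2 / a n) \<partial>M)"
    unfolding T_def by (rule nn_integral_suminf[OF b_meas'])
  also have "\<dots> \<le> (\<Sum>n. ennreal (a n))"
  proof (intro suminf_le allI)
    fix n
    have "(\<integral>\<^sup>+x. ennreal ((b n x)\<^sup>2 / a n) \<partial>M) = (\<integral>\<^sup>+x. ennreal (1 / a n) * ennreal ((b n x)\<^sup>2) \<partial>M)"
      using a_pos[of n] by (intro nn_integral_cong) (simp add: ennreal_mult'[symmetric])
    also have "\<dots> = ennreal (1 / a n) * (\<integral>\<^sup>+x. ennreal ((b n x)\<^sup>2) \<partial>M)"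
      by (rule nn_integral_cmult) (rule measurable_compose[OF b_meas measurable_ennreal])
    also have "\<dots> \<le> ennreal (1 / a n) * ennreal ((a n)\<^sup>2)"
      by (intro mult_left_mono b_int) simp
    also have "\<dots> = ennreal (a n)"
      using a_pos[of n] by (simp add: ennreal_mult'[symmetric] power2_eq_square)
    finally show "(\<integral>\<^sup>+x. ennreal ((b n x)\<^sup>2 / a n) \<partial>M) \<le> ennreal (a n)" .
  qed auto
  also have "\<dots> = ennreal (suminf a)"
    using a_pos a_summable by (intro suminf_ennreal2) (auto intro: less_imp_le)
  finally have T_int: "(\<integral>\<^sup>+x. T x \<partial>M) < \<infinity>"
    by (rule le_less_trans) simp
  then have T_fin: "AE x in M. T x \<noteq> \<infinity>"
    by (intro nn_integral_PInf_AE) auto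
  have good: "summable (\<lambda>n. (b n x)\<^sup>2 / a n)" "ennreal (\<Sum>n. (b n x)\<^sup>2 / a n) = T x"
    if "T x \<noteq> \<infinity>" for x
  proof -
    have nn: "\<And>n. 0 \<le> (b n x)\<^sup>2 / a n" using a_pos by (simp add: less_imp_le)
    show 1: "summable (\<lambda>n. (b n x)\<^sup>2 / a n)"
      using that unfolding T_def by (intro summable_suminf_not_top nn) simp
    show "ennreal (\<Sum>n. (b n x)\<^sup>2 / a n) = T x"
      unfolding T_def by (rule suminf_ennreal2[OF nn 1, symmetric])
  qed
  obtain Z where Z: "Z \<in> vecs DI" "\<And>x z. x \<in> space M \<Longrightarrow> z \<in> vecs (H x) \<Longrightarrow> ip (H x) (Z x) z = 0"
    using zero_section by metis
  have "\<forall>x\<in>space M. \<exists>y. y \<in> vecs (H x) \<and> (T x \<noteq> \<infinity> \<longrightarrow> (\<lambda>n. nrm (H x) (vdiff (H x) (X n x) y)) \<longlonglongrightarrow> 0)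
      \<and> (T x = \<infinity> \<longrightarrow> y = Z x)"
  proof
    fix x assume x: "x \<in> space M"
    interpret hilbert "H x" using x by (rule fibre)
    show "\<exists>y. y \<in> vecs (H x) \<and> (T x \<noteq> \<infinity> \<longrightarrow> (\<lambda>n. nrm (H x) (vdiff (H x) (X n x) y)) \<longlonglongrightarrow> 0)
      \<and> (T x = \<infinity> \<longrightarrow> y = Z x)"
    proof (cases "T x = \<infinity>")
      case True
      then show ?thesis using Z(1) x by (auto simp: vecs_DI msecD)
    next
      case False
      have "summable (\<lambda>n. b n x)"
      proof (rule summable_comparison_test)
        have "b n x \<le> a n + (b n x)\<^sup>2 / a n" for n
        proof -
          have "a n * b n x \<le> (a n)\<^sup>2 + (b n x)\<^sup>2"
            using sum_squares_bound[of "a n" "b n x"]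
              mult_nonneg_nonneg[OF less_imp_le[OF a_pos[of n]] b_nonneg[OF x, of n]] by simp
          then show ?thesis using a_pos[of n] by (simp add: field_simps power2_eq_square)
        qed
        then show "\<exists>N. \<forall>n\<ge>N. norm (b n x) \<le> a n + (b n x)\<^sup>2 / a n" using b_nonneg[OF x] by simp
        show "summable (\<lambda>n. a n + (b n x)\<^sup>2 / a n)" using a_summable good(1)[OF False] by (rule summable_add)
      qed
      then have "\<exists>y\<in>vecs (H x). (\<lambda>n. nrm (H x) (vdiff (H x) (X n x) y)) \<longlonglongrightarrow> 0"
        unfolding b_def using Xx[OF x] by (intro complete)
      then show ?thesis using False by blast
    qed
  qed
  from bchoice[OF this] obtain F where F: "\<forall>x\<in>space M. F x \<in> vecs (H x)
      \<and> (T x \<noteq> \<infinity> \<longrightarrow> (\<lambda>n. nrm (H x) (vdiff (H x) (X n x) (F x))) \<longlonglongrightarrow> 0) \<and> (T x = \<infinity> \<longrightarrow> F x = Z x)" ..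
  have Fx: "F x \<in> vecs (H x)" if "x \<in> space M" for x using F that by blast
  have lim: "(\<lambda>n. nrm (H x) (vdiff (H x) (X n x) (F x))) \<longlonglongrightarrow> 0" if "x \<in> space M" "T x \<noteq> \<infinity>" for x
    using F that by blast
  have msF: "msec F"
    unfolding msec_def
  proof (intro conjI ballI)
    fix s assume s: "s \<in> S"
    show "(\<lambda>x. ip (H x) (F x) (s x)) \<in> borel_measurable M"
    proof (rule borel_measurable_LIMSEQ_metric)
      show "(\<lambda>x. if T x = \<infinity> then 0 else ip (H x) (X n x) (s x)) \<in> borel_measurable M" for n
        using msec_measurable[OF msX s] by measurable
      fix x assume x: "x \<in> space M"
      interpret pre_hilb "H x" using x by (rule fibre_pre)
      show "(\<lambda>n. if T x = \<infinity> then 0 else ip (H x) (X n x) (s x)) \<longlonglongrightarrow> ip (H x) (F x) (s x)"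
      proof (cases "T x = \<infinity>")
        case True
        then show ?thesis using F x Z(2)[OF x section_in[OF s x]] by simp
      next
        case False
        have "(\<lambda>n. ip (H x) (X n x) (s x) - ip (H x) (F x) (s x)) \<longlonglongrightarrow> 0"
        proof (rule Lim_null_comparison)
          show "\<forall>\<^sub>F n in sequentially. norm (ip (H x) (X n x) (s x) - ip (H x) (F x) (s x))
              \<le> nrm (H x) (vdiff (H x) (X n x) (F x)) * nrm (H x) (s x)"
            using Cauchy_Schwarz[OF diff_in[OF Xx[OF x] Fx[OF x]] section_in[OF s x]]
            by (simp add: ip_diff Xx[OF x] Fx[OF x] section_in[OF s x])
          show "(\<lambda>n. nrm (H x) (vdiff (H x) (X n x) (F x)) * nrm (H x) (s x)) \<longlonglongrightarrow> 0"
            by (rule tendsto_mult_left_zero[OF lim[OF x False]])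
        qed
        then show ?thesis using False by (simp add: LIM_zero_iff)
      qed
    qed
  qed (rule Fx)
  let ?E = "\<lambda>n x. vdiff (H x) (X n x) (F x)" and ?N = "\<lambda>n x. Re (ip (H x) (vdiff (H x) (X n x) (F x)) (vdiff (H x) (X n x) (F x)))"
  define R where "R n = (\<Sum>k. a (k + n))" for n
  have R_nonneg: "0 \<le> R n" for n
    unfolding R_def using a_pos a_summable
    by (intro suminf_nonneg) (simp_all add: less_imp_le summable_ignore_initial_segment)
  have bound: "ennreal ((nrm (H x) (?E n x))\<^sup>2) \<le> ennreal (R n) * T x"
    if x: "x \<in> space M" and fin: "T x \<noteq> \<infinity>" for x n
  proof -
    interpret pre_hilb "H x" using x by (rule fibre_pre)
    define t where "t = (\<Sum>n. (b n x)\<^sup>2 / a n)"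
    have t: "ennreal t = T x" unfolding t_def using good(2)[OF fin] .
    have t_nonneg: "0 \<le> t"
      unfolding t_def using a_pos good(1)[OF fin] by (intro suminf_nonneg) (simp_all add: less_imp_le)
    have partial: "(\<Sum>i<j. b (n + i) x) \<le> sqrt (R n * t)" for j
    proof (rule real_le_rsqrt)
      have "(\<Sum>i<j. b (n + i) x) = (\<Sum>i<j. sqrt (a (n + i)) * (b (n + i) x / sqrt (a (n + i))))"
        using a_pos by (intro sum.cong) (simp_all add: less_imp_neq[symmetric])
      then have "(\<Sum>i<j. b (n + i) x)\<^sup>2 \<le> (\<Sum>i<j. (sqrt (a (n + i)))\<^sup>2) * (\<Sum>i<j. (b (n + i) x / sqrt (a (n + i)))\<^sup>2)"
        using Cauchy_Schwarz_ineq_sum[of "\<lambda>i. sqrt (a (n + i))" "\<lambda>i. b (n + i) x / sqrt (a (n + i))" "{..<j}"]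
        by simp
      also have "\<dots> = (\<Sum>i<j. a (i + n)) * (\<Sum>i<j. (b (i + n) x)\<^sup>2 / a (i + n))"
        using a_pos by (simp add: power_divide less_imp_le add.commute)
      also have "\<dots> \<le> R n * t"
      proof (rule mult_mono)
        show "(\<Sum>i<j. a (i + n)) \<le> R n"
          unfolding R_def using a_pos a_summable
          by (intro sum_le_suminf summable_ignore_initial_segment) (simp_all add: less_imp_le)
        have "(\<Sum>i<j. (b (i + n) x)\<^sup>2 / a (i + n)) = (\<Sum>i\<in>{n..<n+j}. (b i x)\<^sup>2 / a i)"
          using sum.shift_bounds_nat_ivl[of "\<lambda>i. (b i x)\<^sup>2 / a i" 0 n j] by (simp add: atLeast0LessThan add.commute)
        also have "\<dots> \<le> t"
          unfolding t_def using a_pos good(1)[OF fin] by (intro sum_le_suminf) (simp_all add: less_imp_le)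
        finally show "(\<Sum>i<j. (b (i + n) x)\<^sup>2 / a (i + n)) \<le> t" .
      qed (use a_pos R_nonneg in \<open>auto intro!: sum_nonneg simp: less_imp_le\<close>)
      finally show "(\<Sum>i<j. b (n + i) x)\<^sup>2 \<le> R n * t" .
    qed
    have "nrm (H x) (?E n x) \<le> sqrt (R n * t)"
    proof (rule LIMSEQ_le_const)
      have "(\<lambda>j. sqrt (R n * t) + nrm (H x) (vdiff (H x) (X (j + n) x) (F x))) \<longlonglongrightarrow> sqrt (R n * t) + 0"
        by (intro tendsto_add tendsto_const LIMSEQ_ignore_initial_segment lim x fin)
      then show "(\<lambda>j. sqrt (R n * t) + nrm (H x) (vdiff (H x) (X (j + n) x) (F x))) \<longlonglongrightarrow> sqrt (R n * t)" by simp
      have "nrm (H x) (?E n x) \<le> sqrt (R n * t) + nrm (H x) (vdiff (H x) (X (j + n) x) (F x))" for j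
        using nrm_diff_triangle[OF Xx[OF x, of n] Xx[OF x, of "n + j"] Fx[OF x]]
          telescope_le[of "\<lambda>n. X n x" n j] partial[of j] nrm_diff_commute[OF Xx[OF x, of n] Xx[OF x, of "n + j"]] Xx[OF x]
        by (simp add: b_def add.commute)
      then show "\<exists>N. \<forall>j\<ge>N. nrm (H x) (?E n x) \<le> sqrt (R n * t) + nrm (H x) (vdiff (H x) (X (j + n) x) (F x))"
        by blast
    qed
    then have "(nrm (H x) (?E n x))\<^sup>2 \<le> (sqrt (R n * t))\<^sup>2"
      by (intro power_mono nrm_nonneg diff_in Xx Fx x)
    then have "(nrm (H x) (?E n x))\<^sup>2 \<le> R n * t"
      using R_nonneg t_nonneg by simp
    then have "ennreal ((nrm (H x) (?E n x))\<^sup>2) \<le> ennreal (R n * t)" by (rule ennreal_leI)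
    then show ?thesis using R_nonneg t_nonneg t by (simp add: ennreal_mult')
  qed
  have dist: "(\<integral>\<^sup>+x. ennreal (?N n x) \<partial>M)
      \<le> ennreal (R n) * (\<integral>\<^sup>+x. T x \<partial>M)" for n
  proof -
    have "(\<integral>\<^sup>+x. ennreal (?N n x) \<partial>M)
        \<le> (\<integral>\<^sup>+x. ennreal (R n) * T x \<partial>M)"
      using T_fin
    proof (intro nn_integral_mono_AE, elim AE_mp, intro AE_I2 impI)
      fix x assume "x \<in> space M" "T x \<noteq> \<infinity>"
      then show "ennreal (?N n x) \<le> ennreal (R n) * T x"
        using bound[of x n] pre_hilb.nrm_power2[OF fibre_pre pre_hilb.diff_in[OF fibre_pre Xx Fx]] by simp
    qed
    then show ?thesis by (simp add: nn_integral_cmult)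
  qed
  have D: "(?E n) \<in> vecs DI" for n
    unfolding vecs_DI
  proof
    show m: "msec (?E n)" by (intro msec_diff msX msF)
    show "integrable M (\<lambda>x. ?N n x)"
    proof (intro integrableI_nonneg msec_norm_measurable AE_I2 m)
      show "0 \<le> ?N n x" if "x \<in> space M" for x
        using pre_hilb.ip_nonneg[OF fibre_pre msecD[OF m]] that by simp
      have "ennreal (R n) * (\<integral>\<^sup>+x. T x \<partial>M) < \<infinity>"
        using T_int by (simp add: ennreal_mult_less_top)
      then show "(\<integral>\<^sup>+x. ennreal (?N n x) \<partial>M) < \<infinity>"
        by (rule le_less_trans[OF dist])
    qed
  qed
  have F_in: "F \<in> vecs DI"
    unfolding vecs_DI
  proof (intro conjI msF)
    \<comment> \<open>The double difference is a member of the direct integral with the same products as F.\<close>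
    let ?G = "\<lambda>x. vdiff (H x) (X 0 x) (vdiff (H x) (X 0 x) (F x))"
    have "vdiff DI (X 0) (\<lambda>x. vdiff (H x) (X 0 x) (F x)) \<in> vecs DI" by (intro DI.diff_in X D)
    then have "integrable M (\<lambda>x. Re (ip (H x) (?G x) (?G x)))" by (simp add: vecs_DI DI_simps)
    then show "integrable M (\<lambda>x. Re (ip (H x) (F x) (F x)))"
    proof (rule Bochner_Integration.integrable_cong[THEN iffD1, OF refl, rotated])
      fix x assume x: "x \<in> space M"
      interpret pre_hilb "H x" using x by (rule fibre_pre)
      show "Re (ip (H x) (?G x) (?G x)) = Re (ip (H x) (F x) (F x))"
        using Xx[OF x] Fx[OF x] by (simp add: ip_diff ip_diff_right diff_in)
    qed
  qed
  show "\<exists>y\<in>vecs DI. (\<lambda>n. nrm DI (vdiff DI (X n) y)) \<longlonglongrightarrow> 0"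
  proof (intro bexI[of _ F] F_in)
    define C where "C = enn2real (\<integral>\<^sup>+x. T x \<partial>M)"
    have C: "ennreal C = (\<integral>\<^sup>+x. T x \<partial>M)" "0 \<le> C" using T_int by (simp_all add: C_def)
    have le: "nrm DI (vdiff DI (X n) F) \<le> sqrt (R n * C)" for n
    proof (rule real_le_rsqrt)
      have "ennreal ((nrm DI (vdiff DI (X n) F))\<^sup>2) \<le> ennreal (R n * C)"
        using nrm_DI[OF D[of n]] dist[of n] R_nonneg C by (simp add: DI_simps ennreal_mult')
      then show "(nrm DI (vdiff DI (X n) F))\<^sup>2 \<le> R n * C"
        using R_nonneg C by (simp add: ennreal_le_iff)
    qed
    have "R \<longlonglongrightarrow> 0" unfolding R_def using suminf_exist_split2[OF a_summable] .
    then have "(\<lambda>n. sqrt (R n * C)) \<longlonglongrightarrow> sqrt (0 * C)" by (intro tendsto_intros)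
    then have lim: "(\<lambda>n. sqrt (R n * C)) \<longlonglongrightarrow> 0" by simp
    have "norm (nrm DI (vdiff DI (X n) F)) \<le> sqrt (R n * C)" for n
      using le[of n] DI.nrm_nonneg[OF DI.diff_in[OF X F_in]] by simp
    then show "(\<lambda>n. nrm DI (vdiff DI (X n) F)) \<longlonglongrightarrow> 0"
      by (intro Lim_null_comparison[OF always_eventually lim] allI)
  qed
qed

end

text \<open>
The one-dimensional Hilbert space: a space \<open>L2 M\<close> is the direct integral of copies of it, so that
its completeness is a special case.
\<close>

definition complex_line :: "complex hilb" where
  "complex_line = \<lparr>vecs = UNIV, vadd = (+), vscale = (*), ip = (\<lambda>a b. a * cnj b)\<rparr>"

lemma hilbert_complex_line: "hilbert complex_line"
proof
  fix x :: "nat \<Rightarrow> complex"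
  have "nrm complex_line a = cmod a" for a
    by (simp add: nrm_def complex_line_def cmod_def power2_eq_square)
  moreover have "vdiff complex_line a b = a - b" for a b
    by (simp add: vdiff_def complex_line_def)
  ultimately have nrm: "nrm complex_line (vdiff complex_line a b) = cmod (a - b)" for a b
    by (simp only:)
  assume "summable (\<lambda>n. nrm complex_line (vdiff complex_line (x (Suc n)) (x n)))"
  then have "summable (\<lambda>n. cmod (x (Suc n) - x n))" by (simp only: nrm)
  then have "summable (\<lambda>n. x (Suc n) - x n)" by (rule summable_norm_cancel)
  then have "convergent (\<lambda>n. x n - x 0)"
    by (simp add: summable_iff_convergent sum_lessThan_telescope)
  then obtain L where "(\<lambda>n. x n - x 0) \<longlonglongrightarrow> L" by (auto simp: convergent_def)
  then have "(\<lambda>n. (x n - x 0) - L) \<longlonglongrightarrow> 0" by (simp add: LIM_zero_iff)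
  then have "(\<lambda>n. cmod (x n - (x 0 + L))) \<longlonglongrightarrow> 0"
    by (simp only: tendsto_norm_zero_iff diff_diff_eq)
  then have "(\<lambda>n. nrm complex_line (vdiff complex_line (x n) (x 0 + L))) \<longlonglongrightarrow> 0"
    by (simp only: nrm)
  then show "\<exists>y\<in>vecs complex_line. (\<lambda>n. nrm complex_line (vdiff complex_line (x n) y)) \<longlonglongrightarrow> 0"
    by (intro bexI[of _ "x 0 + L"]) (simp_all add: complex_line_def)
qed (simp_all add: complex_line_def distrib_right)

lemma L2_eq_direct_integral: "L2 M = direct_integral M {\<lambda>_. 1} (\<lambda>_. complex_line)"
  by (simp add: L2_def direct_integral_def complex_line_def cmod_power2) (simp add: power2_eq_square)

lemma hilbert_L2: "hilbert (L2 M)"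
proof -
  interpret hilb_field M "{\<lambda>_. 1}" "\<lambda>_. complex_line"
    by (intro hilb_field.intro hilbert_complex_line) (auto simp: complex_line_def)
  show ?thesis using hilbert_DI by (simp add: L2_eq_direct_integral)
qed

section \<open>Representations with a basis permuted by the group\<close>

text \<open>
The condition on coefficients says, for a unitary action, that \<open>g\<close> takes \<open>e h\<close> to \<open>e (g h)\<close>. It is
put in this form because coefficients determine a vector up to null vectors, while the
representative \<open>act \<rho> g (e h)\<close> may differ from \<open>e (g h)\<close>.
\<close>

locale based_rep = group G + hilbert_basis "rspace \<rho>" "carrier G" e
  for G :: "('g, 'b) monoid_scheme" and \<rho> :: "('g, 'v) rep" and e :: "'g \<Rightarrow> 'v" +
  assumes act_in: "g \<in> carrier G \<Longrightarrow> x \<in> vecs (rspace \<rho>) \<Longrightarrow> act \<rho> g x \<in> vecs (rspace \<rho>)"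
    and act_coefficient: "g \<in> carrier G \<Longrightarrow> h \<in> carrier G \<Longrightarrow> x \<in> vecs (rspace \<rho>) \<Longrightarrow>
      ip (rspace \<rho>) (act \<rho> g x) (e h) = ip (rspace \<rho>) x (e (inv\<^bsub>G\<^esub> g \<otimes>\<^bsub>G\<^esub> h))"

text \<open>
The unitary map sends \<open>x\<close> to a vector with the same coefficients, which exists by Bessel's inequality and
the Riesz-Fischer theorem. Norms agree by Parseval, scalar products then by polarization, and linearity,
surjectivity and equivariance can be read off the coefficients.
\<close>

theorem based_reps_equivalent:
  assumes "based_rep G \<pi> e" and "based_rep G \<rho> f"
  shows "unitarily_equivalent G \<pi> \<rho>"
proof -
  interpret \<pi>: based_rep G \<pi> e by (rule assms(1))
  interpret \<rho>: based_rep G \<rho> f by (rule assms(2))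
  let ?V = "rspace \<pi>" and ?W = "rspace \<rho>"
  define same where "same x y \<longleftrightarrow> (\<forall>g\<in>carrier G. ip ?W y (f g) = ip ?V x (e g))" for x y
  have norm: "Re (ip ?W y y) = Re (ip ?V x x)"
    if "x \<in> vecs ?V" "y \<in> vecs ?W" "same x y" for x y
  proof -
    have "((\<lambda>g. (cmod (ip ?W y (f g)))\<^sup>2) has_sum Re (ip ?W y y)) (carrier G)
        \<longleftrightarrow> ((\<lambda>g. (cmod (ip ?V x (e g)))\<^sup>2) has_sum Re (ip ?W y y)) (carrier G)"
      using that(3) by (intro has_sum_cong) (simp add: same_def)
    then have "((\<lambda>g. (cmod (ip ?V x (e g)))\<^sup>2) has_sum Re (ip ?W y y)) (carrier G)"
      using \<rho>.Parseval[OF that(2)] by simp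
    then show ?thesis using \<pi>.Parseval[OF that(1)] by (rule has_sum_unique)
  qed
  have same_comb: "same (vadd ?V x (vscale ?V c x')) (vadd ?W y (vscale ?W c y'))"
    if "x \<in> vecs ?V" "x' \<in> vecs ?V" "y \<in> vecs ?W" "y' \<in> vecs ?W" "same x y" "same x' y'" for x x' y y' c
    using that unfolding same_def
    by (simp add: \<pi>.ip_add \<rho>.ip_add \<pi>.ip_scale \<rho>.ip_scale \<pi>.scale_in \<rho>.scale_in \<pi>.e_in \<rho>.e_in)
  have same_add: "same (vadd ?V x x') (vadd ?W y y')"
    if "x \<in> vecs ?V" "x' \<in> vecs ?V" "y \<in> vecs ?W" "y' \<in> vecs ?W" "same x y" "same x' y'" for x x' y y'
    using that unfolding same_def
    by (simp add: \<pi>.ip_add \<rho>.ip_add \<pi>.e_in \<rho>.e_in)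
  have unique: "hilb_eq ?W y y'"
    if "y \<in> vecs ?W" "y' \<in> vecs ?W" "same x y" "same x y'" for x y y'
    using that by (intro \<rho>.same_coefficients) (simp_all add: same_def)
  have "\<exists>y. y \<in> vecs ?W \<and> same x y" if x: "x \<in> vecs ?V" for x
    using \<rho>.Riesz_Fischer[OF \<pi>.coefficients_summable[OF x]] unfolding same_def by metis
  then obtain U where U: "\<And>x. x \<in> vecs ?V \<Longrightarrow> U x \<in> vecs ?W" "\<And>x. x \<in> vecs ?V \<Longrightarrow> same x (U x)"
    by metis
  show ?thesis
    unfolding unitarily_equivalent_def Let_def
  proof (intro exI[of _ U] conjI ballI allI)
    fix x assume x: "x \<in> vecs ?V"
    show "U x \<in> vecs ?W" by (rule U(1)[OF x])
    show "hilb_eq ?W (U (vscale ?V c x)) (vscale ?W c (U x))" for c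
    proof (rule unique)
      show "same (vscale ?V c x) (vscale ?W c (U x))"
        using U x unfolding same_def by (simp add: \<pi>.ip_scale \<rho>.ip_scale \<pi>.e_in \<rho>.e_in)
    qed (simp_all add: U x \<pi>.scale_in \<rho>.scale_in)
    fix y assume y: "y \<in> vecs ?V"
    show "hilb_eq ?W (U (vadd ?V x y)) (vadd ?W (U x) (U y))"
      by (rule unique[OF _ _ U(2)]) (simp_all add: U x y \<pi>.add_in \<rho>.add_in same_add)
    have "4 * ip ?W (U x) (U y) = 4 * ip ?V x y"
      unfolding \<pi>.ip_polarization[OF x y] \<rho>.ip_polarization[OF U(1)[OF x] U(1)[OF y]]
      using norm[OF \<pi>.add_in \<rho>.add_in same_add, OF x y U(1) U(1) x y U(1) U(1) U(2) U(2)]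
        norm[OF \<pi>.add_in \<rho>.add_in same_comb, OF x \<pi>.scale_in U(1) \<rho>.scale_in x y U(1) U(1) U(2) U(2)]
      by (simp add: x y U)
    then show "ip ?W (U x) (U y) = ip ?V x y" by simp
  next
    fix y assume y: "y \<in> vecs ?W"
    obtain x where x: "x \<in> vecs ?V" "same x y"
      using \<pi>.Riesz_Fischer[OF \<rho>.coefficients_summable[OF y]] unfolding same_def by metis
    then show "\<exists>x\<in>vecs ?V. hilb_eq ?W (U x) y"
      using unique[OF U(1) y U(2)] by blast
  next
    fix g x assume g: "g \<in> carrier G" and x: "x \<in> vecs ?V"
    show "hilb_eq ?W (U (act \<pi> g x)) (act \<rho> g (U x))"
    proof (rule unique)
      show "same (act \<pi> g x) (act \<rho> g (U x))"
        using U(2)[OF x] g x unfolding same_def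
        by (simp add: \<pi>.act_coefficient \<rho>.act_coefficient U)
    qed (simp_all add: U g x \<pi>.act_in \<rho>.act_in)
  qed
qed

definition unit_vec :: "'i \<Rightarrow> 'i \<Rightarrow> complex" where
  "unit_vec i = (\<lambda>j. if j = i then 1 else 0)"

lemma unit_vec_in: 
  assumes "i \<in> A" shows "unit_vec i \<in> vecs (l2 A)"
proof -
  have "integrable (count_space A) (indicator {i} :: 'a \<Rightarrow> real)"
    using assms by (intro integrable_real_indicator) auto
  moreover have "(cmod (unit_vec i j))\<^sup>2 = indicator {i} j" for j
    by (simp add: unit_vec_def)
  ultimately show ?thesis by (simp add: L2_def)
qed

lemma ip_unit_vec:
  assumes i: "i \<in> A" shows "ip (l2 A) f (unit_vec i) = f i"
proof -
  have "ip (l2 A) f (unit_vec i) = (LINT j|count_space A. (if j = i then f i else 0))"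
    by (auto simp: L2_def unit_vec_def intro!: lebesgue_integral_cong)
  also have "\<dots> = (\<Sum>j | j \<in> A \<and> (if j = i then f i else 0) \<noteq> 0. (if j = i then f i else 0))"
    by (rule lebesgue_integral_count_space_finite_support) (rule finite_subset[of _ "{i}"], auto)
  also have "\<dots> = f i"
    using i by (subst sum.mono_neutral_left[of "{i}"]) auto
  finally show ?thesis .
qed

lemma hilbert_basis_l2: "hilbert_basis (l2 A) A unit_vec"
proof (intro hilbert_basis.intro hilbert_L2 hilbert_basis_axioms.intro unit_vec_in)
  fix i j assume "i \<in> A" "j \<in> A"
  then show "ip (l2 A) (unit_vec i) (unit_vec j) = (if i = j then 1 else 0)"
    by (auto simp: ip_unit_vec) (auto simp: unit_vec_def)
next
  fix f assume "f \<in> vecs (l2 A)" and zero: "\<And>i. i \<in> A \<Longrightarrow> ip (l2 A) f (unit_vec i) = 0"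
  then have "f i = 0" if "i \<in> A" for i
    using that by (simp add: ip_unit_vec)
  then have "(LINT i|count_space A. f i * cnj (f i)) = integral\<^sup>L (count_space A) (\<lambda>_. 0)"
    by (intro lebesgue_integral_cong) simp_all
  then show "nrm (l2 A) f = 0" by (simp add: nrm_def L2_def)
qed

lemma left_regular_based:
  assumes "group G"
  shows "based_rep G (left_regular_rep G) unit_vec"
proof -
  interpret group G by (rule assms)
  have bij: "bij_betw (\<lambda>x. inv\<^bsub>G\<^esub> g \<otimes>\<^bsub>G\<^esub> x) (carrier G) (carrier G)" if "g \<in> carrier G" for g
    using that by (intro bij_betwI[where g = "\<lambda>x. g \<otimes>\<^bsub>G\<^esub> x"]) (auto simp: m_assoc[symmetric])
  have rs: "rspace (left_regular_rep G) = l2 (carrier G)"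
    "act (left_regular_rep G) g f = (\<lambda>x. f (inv\<^bsub>G\<^esub> g \<otimes>\<^bsub>G\<^esub> x))" for g and f :: "'a \<Rightarrow> complex"
    by (simp_all add: left_regular_rep_def)
  show ?thesis
    unfolding based_rep_def rs based_rep_axioms_def
  proof (intro conjI allI impI assms hilbert_basis_l2)
    fix g f assume g: "g \<in> carrier G" and f: "f \<in> vecs (l2 (carrier G))"
    then show "(\<lambda>x. f (inv\<^bsub>G\<^esub> g \<otimes>\<^bsub>G\<^esub> x)) \<in> vecs (l2 (carrier G))"
      using integrable_bij_count_space[OF bij[OF g], of "\<lambda>x. (cmod (f x))\<^sup>2"] by (simp add: L2_def)
  next
    fix g h f assume "g \<in> carrier G" "h \<in> carrier G"
    then show "ip (l2 (carrier G)) (\<lambda>x. f (inv\<^bsub>G\<^esub> g \<otimes>\<^bsub>G\<^esub> x)) (unit_vec h)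
      = ip (l2 (carrier G)) f (unit_vec (inv\<^bsub>G\<^esub> g \<otimes>\<^bsub>G\<^esub> h))"
      by (simp add: ip_unit_vec)
  qed
qed

text \<open>
As vectors are representatives, the laws of an action are required only inside the scalar product.
\<close>

locale unitary_rep = group G + pre_hilb "rspace \<rho>"
  for G :: "('g, 'b) monoid_scheme" and \<rho> :: "('g, 'v) rep" +
  assumes act_in: "g \<in> carrier G \<Longrightarrow> x \<in> vecs (rspace \<rho>) \<Longrightarrow> act \<rho> g x \<in> vecs (rspace \<rho>)"
    and act_adjoint: "g \<in> carrier G \<Longrightarrow> x \<in> vecs (rspace \<rho>) \<Longrightarrow> y \<in> vecs (rspace \<rho>) \<Longrightarrow>
      ip (rspace \<rho>) (act \<rho> g x) y = ip (rspace \<rho>) x (act \<rho> (inv\<^bsub>G\<^esub> g) y)"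
    and act_mult: "g \<in> carrier G \<Longrightarrow> h \<in> carrier G \<Longrightarrow> x \<in> vecs (rspace \<rho>) \<Longrightarrow> y \<in> vecs (rspace \<rho>) \<Longrightarrow>
      ip (rspace \<rho>) x (act \<rho> g (act \<rho> h y)) = ip (rspace \<rho>) x (act \<rho> (g \<otimes>\<^bsub>G\<^esub> h) y)"
    and act_one: "x \<in> vecs (rspace \<rho>) \<Longrightarrow> y \<in> vecs (rspace \<rho>) \<Longrightarrow>
      ip (rspace \<rho>) x (act \<rho> \<one>\<^bsub>G\<^esub> y) = ip (rspace \<rho>) x y"
begin

lemma act_isometric:
  assumes "g \<in> carrier G" "x \<in> vecs (rspace \<rho>)" "y \<in> vecs (rspace \<rho>)"
  shows "ip (rspace \<rho>) (act \<rho> g x) (act \<rho> g y) = ip (rspace \<rho>) x y"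
  using assms by (simp add: act_adjoint act_in act_mult act_one)

lemma act_orbit:
  assumes "g \<in> carrier G" "h \<in> carrier G" "x \<in> vecs (rspace \<rho>)" "y \<in> vecs (rspace \<rho>)"
  shows "ip (rspace \<rho>) (act \<rho> g x) (act \<rho> h y) = ip (rspace \<rho>) x (act \<rho> (inv\<^bsub>G\<^esub> g \<otimes>\<^bsub>G\<^esub> h) y)"
  using assms by (simp add: act_adjoint act_in act_mult)

end

text \<open>
It suffices to know the action on constant sections to be measurable: the adjoint moves the
action from an arbitrary section to a constant one.
\<close>

locale unitary_rep_field = group G +
    hilb_field M "const_sections M (\<lambda>x. rspace (\<pi> x))" "\<lambda>x. rspace (\<pi> x)"
  for G :: "('g, 'b) monoid_scheme" and M :: "'x measure" and \<pi> :: "'x \<Rightarrow> ('g, 'v) rep" +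
  assumes fibre_unitary: "x \<in> space M \<Longrightarrow> unitary_rep G (\<pi> x)"
    and act_measurable: "g \<in> carrier G \<Longrightarrow> (\<And>x. x \<in> space M \<Longrightarrow> v \<in> vecs (rspace (\<pi> x))) \<Longrightarrow>
      (\<And>x. x \<in> space M \<Longrightarrow> w \<in> vecs (rspace (\<pi> x))) \<Longrightarrow>
      (\<lambda>x. ip (rspace (\<pi> x)) (act (\<pi> x) g v) w) \<in> borel_measurable M"
begin

lemma direct_integral_rep_simps:
  "rspace (direct_integral_rep M \<pi>) = DI"
  "act (direct_integral_rep M \<pi>) g F = (\<lambda>x. act (\<pi> x) g (F x))"
  by (simp_all add: direct_integral_rep_def)

lemma msec_act_section:
  assumes "g \<in> carrier G" "w \<in> const_sections M (\<lambda>x. rspace (\<pi> x))"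
  shows "msec (\<lambda>x. act (\<pi> x) g (w x))"
proof -
  obtain v where v: "w = (\<lambda>_. v)" "\<And>x. x \<in> space M \<Longrightarrow> v \<in> vecs (rspace (\<pi> x))"
    using assms(2) unfolding const_sections_def by blast
  show ?thesis
    unfolding msec_def
  proof (intro conjI ballI)
    fix s assume "s \<in> const_sections M (\<lambda>x. rspace (\<pi> x))"
    then obtain u where "s = (\<lambda>_. u)" "\<And>x. x \<in> space M \<Longrightarrow> u \<in> vecs (rspace (\<pi> x))"
      unfolding const_sections_def by blast
    then show "(\<lambda>x. ip (rspace (\<pi> x)) (act (\<pi> x) g (w x)) (s x)) \<in> borel_measurable M"
      using act_measurable[OF assms(1) v(2)] v(1) by simp
  qed (use v assms(1) unitary_rep.act_in[OF fibre_unitary] in auto)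
qed

lemma msec_act:
  assumes g: "g \<in> carrier G" and F: "msec F"
  shows "msec (\<lambda>x. act (\<pi> x) g (F x))"
  unfolding msec_def
proof (intro conjI ballI)
  fix s assume s: "s \<in> const_sections M (\<lambda>x. rspace (\<pi> x))"
  have "(\<lambda>x. ip (rspace (\<pi> x)) (F x) (act (\<pi> x) (inv\<^bsub>G\<^esub> g) (s x))) \<in> borel_measurable M"
    by (intro ip_measurable F msec_act_section inv_closed g s)
  then show "(\<lambda>x. ip (rspace (\<pi> x)) (act (\<pi> x) g (F x)) (s x)) \<in> borel_measurable M"
    by (rule measurable_cong[THEN iffD1, rotated])
       (simp add: unitary_rep.act_adjoint[OF fibre_unitary] g msecD F section_in s)
qed (use g F unitary_rep.act_in[OF fibre_unitary] msecD in auto)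

theorem unitary_rep_direct_integral: "unitary_rep G (direct_integral_rep M \<pi>)"
  unfolding unitary_rep_def unitary_rep_axioms_def direct_integral_rep_simps
proof (intro conjI allI impI pre_hilb_DI group_axioms)
  have in_fibre: "F x \<in> vecs (rspace (\<pi> x))" if "F \<in> vecs DI" "x \<in> space M" for F x
    using that by (simp add: vecs_DI msecD)
  note fu = unitary_rep.act_in[OF fibre_unitary] unitary_rep.act_adjoint[OF fibre_unitary]
    unitary_rep.act_mult[OF fibre_unitary] unitary_rep.act_one[OF fibre_unitary]
    unitary_rep.act_isometric[OF fibre_unitary] in_fibre
  fix F assume F: "F \<in> vecs DI"
  {
    fix g assume g: "g \<in> carrier G"
    have "integrable M (\<lambda>x. Re (ip (rspace (\<pi> x)) (act (\<pi> x) g (F x)) (act (\<pi> x) g (F x))))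
        \<longleftrightarrow> integrable M (\<lambda>x. Re (ip (rspace (\<pi> x)) (F x) (F x)))"
      by (intro Bochner_Integration.integrable_cong refl) (simp add: fu F g)
    then show "(\<lambda>x. act (\<pi> x) g (F x)) \<in> vecs DI"
      using F g by (simp add: vecs_DI msec_act)
    fix E assume E: "E \<in> vecs DI"
    show "ip DI (\<lambda>x. act (\<pi> x) g (F x)) E = ip DI F (\<lambda>x. act (\<pi> x) (inv\<^bsub>G\<^esub> g) (E x))"
      unfolding DI_simps by (intro lebesgue_integral_cong refl) (simp add: fu F E g)
    fix h assume h: "h \<in> carrier G"
    show "ip DI F (\<lambda>x. act (\<pi> x) g (act (\<pi> x) h (E x))) = ip DI F (\<lambda>x. act (\<pi> x) (g \<otimes>\<^bsub>G\<^esub> h) (E x))"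
      unfolding DI_simps by (intro lebesgue_integral_cong refl) (simp add: fu F E g h)
  }
  fix E assume E: "E \<in> vecs DI"
  show "ip DI F (\<lambda>x. act (\<pi> x) \<one>\<^bsub>G\<^esub> (E x)) = ip DI F E"
    unfolding DI_simps by (intro lebesgue_integral_cong refl) (simp add: fu F E)
qed

end

section \<open>Fourier series on an interval of length one\<close>

definition wave :: "real \<Rightarrow> complex" where "wave x = cis (2 * pi * x)"

lemma wave_add: "wave (x + y) = wave x * wave y"
  by (simp add: wave_def cis_mult distrib_left)

lemma wave_0 [simp]: "wave 0 = 1" by (simp add: wave_def)

lemma cnj_wave: "cnj (wave x) = wave (- x)" by (simp add: wave_def cis_cnj)

lemma cmod_wave [simp]: "cmod (wave x) = 1" by (simp add: wave_def)

lemma wave_of_int [simp]: "wave (of_int k) = 1"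
  unfolding wave_def by (rule cis_multiple_2pi) simp

lemma wave_eq_exp: "exp (2 * pi * \<i> * x) = wave x"
  by (simp add: wave_def cis_conv_exp mult_ac)

lemma wave_eq_iff: "wave x = wave y \<longleftrightarrow> x - y \<in> \<int>"
proof
  assume "wave x = wave y"
  then have "wave (x - y) = 1"
    using wave_add[of "x - y" y] by (metis add_diff_cancel_right' cmod_wave diff_add_cancel mult_cancel_right1 norm_zero zero_neq_one)
  then have "cos (2 * pi * (x - y)) = 1" by (simp add: wave_def complex_eq_iff)
  then obtain n :: int where "2 * pi * (x - y) = of_int n * 2 * pi" by (auto simp: cos_one_2pi_int)
  then have "x - y = of_int n" by simp
  then show "x - y \<in> \<int>" by simp
next
  assume "x - y \<in> \<int>"
  then obtain n where "x - y = of_int n" by (auto elim: Ints_cases)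
  then have "wave x = wave (of_int n) * wave y" using wave_add[of "of_int n" y] by (metis diff_add_cancel)
  then show "wave x = wave y" by simp
qed

lemma continuous_on_wave [continuous_intros]: "continuous_on A f \<Longrightarrow> continuous_on A (\<lambda>x. wave (f x))"
  unfolding wave_def by (intro continuous_intros)

lemma wave_measurable [measurable]: "wave \<in> borel_measurable borel"
  by (intro borel_measurable_continuous_onI continuous_intros)

lemma wave_integral_interval:
  assumes "c \<noteq> 0" "a \<le> b"
  shows "(LINT x|lborel. indicator {a..b} x *\<^sub>R wave (c * x)) = (wave (c * b) - wave (c * a)) / (2 * pi * \<i> * c)"
proof -
  have "(LINT x|lborel. indicator {a..b} x *\<^sub>R wave (c * x)) = wave (c * b) / (2 * pi * \<i> * c) - wave (c * a) / (2 * pi * \<i> * c)"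
  proof (rule integral_FTC_atLeastAtMost[OF assms(2)])
    fix x
    have "((\<lambda>x. exp (2 * pi * \<i> * c * of_real x) / (2 * pi * \<i> * c)) has_vector_derivative exp (2 * pi * \<i> * c * of_real x)) (at x within {a..b})"
      using assms(1) by (auto intro!: derivative_eq_intros has_vector_derivative_real_field simp: field_simps)
    then show "((\<lambda>x. wave (c * x) / (2 * pi * \<i> * c)) has_vector_derivative wave (c * x)) (at x within {a..b})"
      by (simp add: wave_eq_exp[symmetric] mult_ac)
  qed (intro continuous_intros)
  then show ?thesis by (simp add: diff_divide_distrib)
qed

lemma AE_not_point: "AE x in lborel. x \<noteq> (a::real)"
  by (rule AE_lborel_singleton)

lemma wave_integral_period:
  "(LINT x|lborel. indicator {a..<a+1} x *\<^sub>R wave (of_int k * x)) = (if k = 0 then 1 else 0)"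
proof -
  have "(LINT x|lborel. indicator {a..<a+1} x *\<^sub>R wave (of_int k * x)) = (LINT x|lborel. indicator {a..a+1} x *\<^sub>R wave (of_int k * x))"
    using AE_not_point[of "a + 1"] by (intro integral_cong_AE) (auto simp: indicator_def)
  also have "\<dots> = (if k = 0 then 1 else 0)"
  proof (cases "k = 0")
    case False
    have "wave (of_int k * (a + 1)) = wave (of_int k * a)" by (simp add: distrib_left wave_add)
    then show ?thesis using False by (simp add: wave_integral_interval)
  qed simp
  finally show ?thesis .
qed

text \<open>
Given by generators, so that closure under products and the vanishing of integrals are inductions.
\<close>

inductive trig_polynomial :: "(real \<Rightarrow> complex) \<Rightarrow> bool" where
  monomial: "trig_polynomial (\<lambda>x. c * wave (of_int k * x))"
| sum: "trig_polynomial p \<Longrightarrow> trig_polynomial q \<Longrightarrow> trig_polynomial (\<lambda>x. p x + q x)"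

lemma trig_polynomial_mult:
  assumes "trig_polynomial p" "trig_polynomial q"
  shows "trig_polynomial (\<lambda>x. p x * q x)"
  using assms(1)
proof induction
  case (monomial c k)
  show ?case using assms(2)
  proof induction
    case (monomial d j)
    have "wave (of_int (k + j) * x) = wave (of_int k * x) * wave (of_int j * x)" for x
      by (simp add: distrib_right wave_add)
    then have "(\<lambda>x. c * wave (of_int k * x) * (d * wave (of_int j * x))) = (\<lambda>x. (c * d) * wave (of_int (k + j) * x))"
      by (simp add: mult_ac del: of_int_add)
    then show ?case using trig_polynomial.monomial[of "c * d" "k + j"] by simp
  qed (simp add: distrib_left trig_polynomial.sum)
qed (simp add: distrib_right trig_polynomial.sum)

lemma trig_polynomial_of_real_polynomial:
  assumes "real_polynomial_function p"
  shows "trig_polynomial (\<lambda>x. of_real (p (wave x)))"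
  using assms
proof induction
  case (linear f)
  interpret bounded_linear f by (rule linear)
  have "of_real (f (wave x)) = ((f 1 - \<i> * f \<i>) / 2) * wave (of_int 1 * x) + ((f 1 + \<i> * f \<i>) / 2) * wave (of_int (-1) * x)" for x
  proof -
    have "f (wave x) = f (cos (2 * pi * x) *\<^sub>R 1 + sin (2 * pi * x) *\<^sub>R \<i>)"
      by (rule arg_cong[of _ _ f]) (simp add: wave_def complex_eq_iff)
    also have "\<dots> = cos (2 * pi * x) * f 1 + sin (2 * pi * x) * f \<i>"
      by (simp only: add scaleR real_scaleR_def)
    finally show ?thesis by (simp add: wave_def complex_eq_iff field_simps)
  qed
  then have "(\<lambda>x. of_real (f (wave x))) = (\<lambda>x. ((f 1 - \<i> * f \<i>) / 2) * wave (of_int 1 * x)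
      + ((f 1 + \<i> * f \<i>) / 2) * wave (of_int (-1) * x))" by (rule ext)
  then show ?case by (simp only: trig_polynomial.intros)
next
  case (const c)
  then show ?case using trig_polynomial.monomial[of "of_real c" 0] by simp
qed (simp_all add: trig_polynomial.sum trig_polynomial_mult)

lemma trig_polynomial_bounded_measurable:
  assumes "trig_polynomial p"
  shows "p \<in> borel_measurable borel" "\<exists>B. \<forall>x. cmod (p x) \<le> B"
proof -
  have "p \<in> borel_measurable borel \<and> (\<exists>B. \<forall>x. cmod (p x) \<le> B)"
    using assms
  proof induction
    case (monomial c k)
    then show ?case by (auto simp: norm_mult)
  next
    case (sum p q)
    then obtain B C where B: "\<And>x. cmod (p x) \<le> B" and C: "\<And>x. cmod (q x) \<le> C" by auto
    have "cmod (p x + q x) \<le> B + C" for x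
      using norm_triangle_ineq[of "p x" "q x"] B[of x] C[of x] by linarith
    then show ?case using sum by auto
  qed
  then show "p \<in> borel_measurable borel" "\<exists>B. \<forall>x. cmod (p x) \<le> B" by auto
qed

lemma integrable_mult_bounded:
  fixes h p :: "real \<Rightarrow> complex"
  assumes h: "integrable lborel h" and p: "p \<in> borel_measurable borel" "\<And>x. cmod (p x) \<le> B"
  shows "integrable lborel (\<lambda>x. h x * p x)"
proof (rule Bochner_Integration.integrable_bound)
  show "integrable lborel (\<lambda>x. B * cmod (h x))" using h by simp
  show "(\<lambda>x. h x * p x) \<in> borel_measurable lborel" using h p(1) by auto
  have "cmod (h x * p x) \<le> B * cmod (h x)" for x
    using mult_right_mono[OF p(2) norm_ge_zero] by (simp add: norm_mult mult.commute)
  then show "AE x in lborel. cmod (h x * p x) \<le> norm (B * cmod (h x))"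
    by (intro AE_I2) (metis abs_ge_self order_trans real_norm_def)
qed

text \<open>
By Stone-Weierstrass on the unit circle, a continuous function of \<open>exp (2 pi i x)\<close> is a uniform limit
of real polynomials in it, and these are trigonometric polynomials in \<open>x\<close>.
\<close>

lemma fourier_zero_continuous:
  fixes h :: "real \<Rightarrow> complex" and f :: "complex \<Rightarrow> real"
  assumes h: "integrable lborel h"
    and zero: "\<And>k. (LINT x|lborel. h x * wave (of_int k * x)) = 0"
    and f: "continuous_on (sphere 0 1) f"
  shows "(LINT x|lborel. h x * of_real (f (wave x))) = 0"
proof -
  have trig: "(LINT x|lborel. h x * p x) = 0" if "trig_polynomial p" for p
    using that
  proof induction
    case (monomial c k)
    have "(LINT x|lborel. h x * (c * wave (of_int k * x))) = c * (LINT x|lborel. h x * wave (of_int k * x))"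
      by (simp add: mult.left_commute)
    then show ?case by (simp add: zero)
  next
    case (sum p q)
    have "integrable lborel (\<lambda>x. h x * p x)" "integrable lborel (\<lambda>x. h x * q x)"
      using integrable_mult_bounded[OF h] trig_polynomial_bounded_measurable sum.hyps by metis+
    then show ?case using sum.IH by (simp add: distrib_left)
  qed
  have fm: "(\<lambda>x. f (wave x)) \<in> borel_measurable borel"
    by (intro borel_measurable_continuous_onI continuous_on_compose2[OF f] continuous_intros) auto
  obtain B where B: "\<And>z. z \<in> sphere 0 1 \<Longrightarrow> \<bar>f z\<bar> \<le> B"
    using compact_imp_bounded[OF compact_continuous_image[OF f compact_sphere]]
    unfolding bounded_iff real_norm_def by blast
  have int_f: "integrable lborel (\<lambda>x. h x * of_real (f (wave x)))"
    using fm B by (intro integrable_mult_bounded[OF h, of _ B]) auto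
  have "cmod (LINT x|lborel. h x * of_real (f (wave x))) \<le> \<epsilon> * (LINT x|lborel. cmod (h x))" if "\<epsilon> > 0" for \<epsilon>
  proof -
    obtain g where g: "real_polynomial_function g" "\<And>z. z \<in> sphere 0 1 \<Longrightarrow> \<bar>f z - g z\<bar> < \<epsilon>"
      using Stone_Weierstrass_real_polynomial_function[OF compact_sphere f \<open>\<epsilon> > 0\<close>] by blast
    note tg = trig_polynomial_of_real_polynomial[OF g(1)]
    have int_g: "integrable lborel (\<lambda>x. h x * of_real (g (wave x)))"
      using integrable_mult_bounded[OF h] trig_polynomial_bounded_measurable[OF tg] by blast
    have "(LINT x|lborel. h x * of_real (f (wave x))) = (LINT x|lborel. h x * of_real (f (wave x)) - h x * of_real (g (wave x)))"
      using int_f int_g trig[OF tg] by simp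
    also have "cmod \<dots> \<le> (LINT x|lborel. \<epsilon> * cmod (h x))"
    proof (rule order_trans[OF integral_norm_bound integral_mono])
      show "integrable lborel (\<lambda>x. norm (h x * of_real (f (wave x)) - h x * of_real (g (wave x))))"
        using int_f int_g by simp
      show "integrable lborel (\<lambda>x. \<epsilon> * cmod (h x))" using h by simp
      fix x
      have "cmod (h x * of_real (f (wave x)) - h x * of_real (g (wave x))) = cmod (h x) * \<bar>f (wave x) - g (wave x)\<bar>"
        by (metis norm_mult norm_of_real of_real_diff right_diff_distrib)
      also have "\<dots> \<le> cmod (h x) * \<epsilon>"
        using g(2)[of "wave x"] by (intro mult_left_mono) auto
      finally show "norm (h x * of_real (f (wave x)) - h x * of_real (g (wave x))) \<le> \<epsilon> * cmod (h x)" by (simp add: mult.commute)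
    qed
    finally show ?thesis by simp
  qed
  note small = this
  define I where "I = (LINT x|lborel. cmod (h x))"
  have I: "0 \<le> I" by (simp add: I_def)
  have "cmod (LINT x|lborel. h x * of_real (f (wave x))) \<le> 0 + \<epsilon>" if "\<epsilon> > 0" for \<epsilon>
  proof -
    have "\<epsilon> / (I + 1) * I \<le> \<epsilon>" using I that by (simp add: field_simps)
    then show ?thesis using small[of "\<epsilon> / (I + 1)"] I that by (simp add: I_def[symmetric])
  qed
  then have "cmod (LINT x|lborel. h x * of_real (f (wave x))) \<le> 0" by (rule field_le_epsilon)
  then show ?thesis by simp
qed

text \<open>
The positive and the negative part of \<open>g\<close> are densities of two finite measures which agree on half
lines, hence are equal.
\<close>

lemma AE_zero_if_half_lines:
  fixes g :: "real \<Rightarrow> real"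
  assumes g: "integrable lborel g" and zero: "\<And>p. (LINT x|lborel. indicator {p<..} x *\<^sub>R g x) = 0"
  shows "AE x in lborel. g x = 0"
proof -
  define P where "P = density lborel (\<lambda>x. ennreal (g x))"
  define N where "N = density lborel (\<lambda>x. ennreal (- g x))"
  have [measurable]: "g \<in> borel_measurable borel" using g by auto
  have half: "emeasure P {p<..} = ennreal (LINT x|lborel. indicator {p<..} x * max 0 (g x))"
    "emeasure N {p<..} = ennreal (LINT x|lborel. indicator {p<..} x * max 0 (- g x))" for p
  proof -
    have *: "emeasure (density lborel (\<lambda>x. ennreal (f x))) {p<..} = ennreal (LINT x|lborel. indicator {p<..} x * max 0 (f x))"
      if f: "integrable lborel f" for f :: "real \<Rightarrow> real"
    proof -
      have [measurable]: "f \<in> borel_measurable borel" using f by auto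
      have "emeasure (density lborel (\<lambda>x. ennreal (f x))) {p<..} = (\<integral>\<^sup>+x. ennreal (indicator {p<..} x * max 0 (f x)) \<partial>lborel)"
        by (subst emeasure_density) (auto intro!: nn_integral_cong simp: indicator_def max_def ennreal_neg)
      also have "\<dots> = ennreal (LINT x|lborel. indicator {p<..} x * max 0 (f x))"
      proof (rule nn_integral_eq_integral)
        show "integrable lborel (\<lambda>x. indicator {p<..} x * max 0 (f x))"
          by (rule Bochner_Integration.integrable_bound[OF f]) (auto simp: indicator_def)
      qed (auto simp: indicator_def)
      finally show ?thesis .
    qed
    show "emeasure P {p<..} = ennreal (LINT x|lborel. indicator {p<..} x * max 0 (g x))"
      unfolding P_def using *[OF g] .
    show "emeasure N {p<..} = ennreal (LINT x|lborel. indicator {p<..} x * max 0 (- g x))"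
      unfolding N_def using *[of "\<lambda>x. - g x"] g by simp
  qed
  have eq: "(LINT x|lborel. indicator {p<..} x * max 0 (g x)) = (LINT x|lborel. indicator {p<..} x * max 0 (- g x))" for p
  proof -
    have "integrable lborel (\<lambda>x. indicator {p<..} x * max 0 (g x))" "integrable lborel (\<lambda>x. indicator {p<..} x * max 0 (- g x))"
      by (rule Bochner_Integration.integrable_bound[OF g]; auto simp: indicator_def)+
    then have "(LINT x|lborel. indicator {p<..} x * max 0 (g x)) - (LINT x|lborel. indicator {p<..} x * max 0 (- g x))
       = (LINT x|lborel. indicator {p<..} x * max 0 (g x) - indicator {p<..} x * max 0 (- g x))"
      by simp
    also have "\<dots> = (LINT x|lborel. indicator {p<..} x *\<^sub>R g x)"
      by (intro lebesgue_integral_cong) (auto simp: indicator_def max_def)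
    finally show ?thesis using zero by simp
  qed
  have "P = N"
  proof (rule measure_eqI_lessThan)
    show "emeasure P {x<..} = emeasure N {x<..}" "emeasure P {x<..} < \<infinity>" for x
      using half[of x] eq[of x] by simp_all
  qed (simp_all add: P_def N_def)
  then have "AE x in lborel. ennreal (g x) = ennreal (- g x)"
    unfolding P_def N_def by (intro sigma_finite_measure.density_unique[OF lborel.sigma_finite_measure_axioms]) auto
  then show ?thesis
  proof eventually_elim
    case (elim x)
    show ?case
    proof (cases "g x \<ge> 0")
      case True
      then show ?thesis using elim by (simp add: ennreal_neg)
    next
      case False
      then show ?thesis using elim by (simp add: ennreal_neg)
    qed
  qed
qed

text \<open>
The indicator of \<open>(p,a+1)\<close>, as a function on the circle, is the limit of the continuous functions
\<open>min 1 (n * infdist z C)\<close>, where \<open>C\<close> is the arc that corresponds to \<open>[a,p]\<close> together with the point of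
\<open>a + 1\<close>, which is also the point of \<open>a\<close>. So \<open>h\<close> integrates to zero over all half lines.
\<close>

theorem fourier_unique:
  fixes h :: "real \<Rightarrow> complex"
  assumes h: "integrable lborel h" and supp: "\<And>x. x \<notin> {a..<a+1} \<Longrightarrow> h x = 0"
    and zero: "\<And>k. (LINT x|lborel. h x * wave (of_int k * x)) = 0"
  shows "AE x in lborel. h x = 0"
proof -
  have half: "(LINT x|lborel. indicator {p<..} x *\<^sub>R h x) = 0" if p: "a \<le> p" "p \<le> a + 1" for p
  proof -
    define C where "C = wave ` ({a..p} \<union> {a+1})"
    define \<phi> where "\<phi> n z = min 1 (real n * infdist z C)" for n z
    have "compact C" unfolding C_def by (intro compact_continuous_image continuous_intros) auto
    then have C: "closed C" "C \<noteq> {}" by (auto simp: compact_imp_closed C_def)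
    have mem: "wave x \<in> C \<longleftrightarrow> x \<le> p" if x: "x \<in> {a..<a+1}" for x
    proof
      assume "wave x \<in> C"
      then obtain y where y: "y \<in> {a..p} \<union> {a+1}" "wave x = wave y" unfolding C_def by blast
      then obtain k where k: "x - y = of_int k" by (auto simp: wave_eq_iff elim: Ints_cases)
      have "y = x \<or> y = x + 1"
      proof -
        \<comment> \<open>Integer translates of x in [a,a+1] are x and, for the left end point only, x + 1.\<close>
        have "-2 < real_of_int k" "real_of_int k < 1" using k x y p by auto
        then have "k = 0 \<or> k = -1" by linarith
        then show ?thesis using k by auto
      qed
      then show "x \<le> p" using x y p by auto
    qed (use x in \<open>auto simp: C_def\<close>)
    have cont: "continuous_on (sphere 0 1) (\<phi> n)" for n
      unfolding \<phi>_def by (intro continuous_intros)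
    have meas: "(\<lambda>x. \<phi> n (wave x)) \<in> borel_measurable borel" for n
      by (intro borel_measurable_continuous_onI continuous_on_compose2[OF cont] continuous_intros) auto
    have "(\<lambda>n. LINT x|lborel. h x * of_real (\<phi> n (wave x))) \<longlonglongrightarrow> (LINT x|lborel. indicator {p<..} x *\<^sub>R h x)"
    proof (rule integral_dominated_convergence[where w = "\<lambda>x. cmod (h x)"])
      show "(\<lambda>x. h x * of_real (\<phi> n (wave x))) \<in> borel_measurable lborel" for n
        using h meas[of n] by auto
      show "AE x in lborel. cmod (h x * of_real (\<phi> n (wave x))) \<le> cmod (h x)" for n
        by (intro AE_I2) (auto simp: norm_mult \<phi>_def infdist_nonneg intro!: mult_left_le)
      show "AE x in lborel. (\<lambda>n. h x * of_real (\<phi> n (wave x))) \<longlonglongrightarrow> indicator {p<..} x *\<^sub>R h x"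
      proof (rule AE_I2)
        fix x
        show "(\<lambda>n. h x * of_real (\<phi> n (wave x))) \<longlonglongrightarrow> indicator {p<..} x *\<^sub>R h x"
        proof (cases "x \<in> {a..<a+1}")
          case False
          then show ?thesis by (simp add: supp)
        next
          case x: True
          show ?thesis
          proof (cases "x \<le> p")
            case True
            then have "infdist (wave x) C = 0" using mem[OF x] by simp
            then show ?thesis using True by (simp add: \<phi>_def)
          next
            case False
            then have "wave x \<notin> C" using mem[OF x] by simp
            then have d: "0 < infdist (wave x) C" using C in_closed_iff_infdist_zero[of C "wave x"] infdist_nonneg[of "wave x" C] by linarith
            \<comment> \<open>From this index on the truncated distance is exactly 1.\<close>
            obtain N where N: "1 < real N * infdist (wave x) C"
              using reals_Archimedean3[OF d] by blast
            have "\<phi> n (wave x) = 1" if "n \<ge> N" for n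
            proof -
              have "real N * infdist (wave x) C \<le> real n * infdist (wave x) C"
                using that d by (intro mult_right_mono) auto
              then show ?thesis using N by (simp add: \<phi>_def)
            qed
            then have "\<forall>\<^sub>F n in sequentially. h x * of_real (\<phi> n (wave x)) = h x"
              by (auto simp: eventually_sequentially)
            then have "(\<lambda>n. h x * of_real (\<phi> n (wave x))) \<longlonglongrightarrow> h x" by (rule tendsto_eventually)
            then show ?thesis using False by simp
          qed
        qed
      qed
    qed (use h in auto)
    then show ?thesis using fourier_zero_continuous[OF h zero cont] by (simp add: LIMSEQ_const_iff)
  qed
  have all: "(LINT x|lborel. indicator {p<..} x *\<^sub>R h x) = 0" for p
  proof (cases "a \<le> p")
    case True
    show ?thesis
    proof (cases "p \<le> a + 1")
      case False
      have "(LINT x|lborel. indicator {p<..} x *\<^sub>R h x) = integral\<^sup>L lborel (\<lambda>_ :: real. 0)"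
        by (rule lebesgue_integral_cong) (use False supp in \<open>auto simp: indicator_def\<close>)
      then show ?thesis by simp
    qed (use True half in simp)
  next
    case False
    have "(LINT x|lborel. indicator {p<..} x *\<^sub>R h x) = (LINT x|lborel. indicator {a<..} x *\<^sub>R h x)"
    proof (rule integral_cong_AE)
      show "AE x in lborel. indicator {p<..} x *\<^sub>R h x = indicator {a<..} x *\<^sub>R h x"
        using AE_not_point[of a]
      proof eventually_elim
        case (elim x)
        then show ?case using False supp[of x] by (cases "x \<in> {a..<a+1}") (auto simp: indicator_def)
      qed
    qed (use h in auto)
    then show ?thesis using half[of a] by simp
  qed
  have int: "integrable lborel (\<lambda>x. indicator {p<..} x *\<^sub>R h x)" for p
    using integrable_mult_indicator[of "{p<..}" lborel h] h by simp
  have "(LINT x|lborel. indicator {p<..} x *\<^sub>R Re (h x)) = Re (LINT x|lborel. indicator {p<..} x *\<^sub>R h x)"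
    "(LINT x|lborel. indicator {p<..} x *\<^sub>R Im (h x)) = Im (LINT x|lborel. indicator {p<..} x *\<^sub>R h x)" for p
    using integral_Re[OF int[of p]] integral_Im[OF int[of p]] by simp_all
  then have "AE x in lborel. Re (h x) = 0" "AE x in lborel. Im (h x) = 0"
    using h all by (auto intro!: AE_zero_if_half_lines)
  then show ?thesis by eventually_elim (simp add: complex_eq_iff)
qed

section \<open>Measurable fields of square integrable functions\<close>

lemma has_sum_nn_integral_count_space:
  fixes f :: "'i \<Rightarrow> real"
  assumes f: "(f has_sum s) I" and nonneg: "\<And>i. i \<in> I \<Longrightarrow> 0 \<le> f i"
  shows "(\<integral>\<^sup>+i. ennreal (f i) \<partial>count_space I) = ennreal s"
proof -
  have "f summable_on I" using f by (rule has_sum_imp_summable)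
  then have "Infinite_Sum.abs_summable_on f I" using nonneg by (simp cong: summable_on_cong)
  then have abs: "Infinite_Set_Sum.abs_summable_on f I" by (rule abs_summable_equivalent[THEN iffD1])
  then have "(\<integral>\<^sup>+i. ennreal (f i) \<partial>count_space I) = ennreal (LINT i|count_space I. f i)"
    using nonneg by (intro nn_integral_eq_integral) (auto simp: Infinite_Set_Sum.abs_summable_on_def AE_count_space)
  also have "(LINT i|count_space I. f i) = infsum f I"
    using infsetsum_infsum[OF abs] by (simp add: infsetsum_def)
  finally show ?thesis using infsumI[OF f] by simp
qed

lemma (in hilbert_basis) Parseval_nn_integral:
  assumes "x \<in> vecs H"
  shows "ennreal (Re (ip H x x)) = (\<integral>\<^sup>+i. ennreal ((cmod (ip H x (e i)))\<^sup>2) \<partial>count_space I)"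
  using has_sum_nn_integral_count_space[OF Parseval[OF assms]] by simp

lemma measurable_pair_countable:
  fixes g :: "'i::countable \<Rightarrow> 'x \<Rightarrow> 'b"
  assumes "\<And>i. g i \<in> measurable M N"
  shows "(\<lambda>(x, i). g i x) \<in> measurable (M \<Otimes>\<^sub>M count_space UNIV) N"
  unfolding case_prod_beta'
  by (rule measurable_compose_countable[where g = snd and f = "\<lambda>i p. g i (fst p)"])
     (auto intro: measurable_compose[OF measurable_fst assms])

lemma borel_measurable_nn_integral_countable:
  fixes g :: "'i::countable \<Rightarrow> 'x \<Rightarrow> ennreal"
  assumes "\<And>i. g i \<in> borel_measurable M"
  shows "(\<lambda>x. \<integral>\<^sup>+i. g i x \<partial>count_space UNIV) \<in> borel_measurable M"
  by (intro sigma_finite_measure.borel_measurable_nn_integral[OF sigma_finite_measure_count_space]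
      measurable_pair_countable assms)

lemma borel_measurable_integral_countable:
  fixes g :: "'i::countable \<Rightarrow> 'x \<Rightarrow> complex"
  assumes "\<And>i. g i \<in> borel_measurable M"
  shows "(\<lambda>x. LINT i|count_space UNIV. g i x) \<in> borel_measurable M"
  by (intro sigma_finite_measure.borel_measurable_lebesgue_integral[OF sigma_finite_measure_count_space]
      measurable_pair_countable assms)

text \<open>
Parseval against one family \<open>v\<close> in all fibres writes the squared norm of a section as a countable sum
of measurable functions.
\<close>

lemma hilb_field_constI:
  fixes v :: "'i::countable \<Rightarrow> 'v"
  assumes H: "\<And>x. x \<in> space M \<Longrightarrow> hilbert (H x)"
    and v: "\<And>x i. x \<in> space M \<Longrightarrow> v i \<in> vecs (H x)"
    and norm: "\<And>x f. x \<in> space M \<Longrightarrow> f \<in> vecs (H x) \<Longrightarrow>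
      ennreal (Re (ip (H x) f f)) = (\<integral>\<^sup>+i. ennreal ((cmod (ip (H x) f (v i)))\<^sup>2) \<partial>count_space UNIV)"
  shows "hilb_field M (const_sections M H) H"
proof (rule hilb_field.intro)
  fix F assume F: "\<And>x. x \<in> space M \<Longrightarrow> F x \<in> vecs (H x)"
    and meas: "\<And>s. s \<in> const_sections M H \<Longrightarrow> (\<lambda>x. ip (H x) (F x) (s x)) \<in> borel_measurable M"
  have "(\<lambda>x. ip (H x) (F x) (v i)) \<in> borel_measurable M" for i
    using meas[of "\<lambda>_. v i"] v unfolding const_sections_def by blast
  then have "(\<lambda>x. enn2real (\<integral>\<^sup>+i. ennreal ((cmod (ip (H x) (F x) (v i)))\<^sup>2) \<partial>count_space UNIV)) \<in> borel_measurable M"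
    by (intro measurable_compose[OF borel_measurable_nn_integral_countable] borel_measurable_enn2real) auto
  then show "(\<lambda>x. Re (ip (H x) (F x) (F x))) \<in> borel_measurable M"
  proof (rule measurable_cong[THEN iffD1, rotated])
    fix x assume x: "x \<in> space M"
    interpret hilbert "H x" by (rule H[OF x])
    show "enn2real (\<integral>\<^sup>+i. ennreal ((cmod (ip (H x) (F x) (v i)))\<^sup>2) \<partial>count_space UNIV) = Re (ip (H x) (F x) (F x))"
      using norm[OF x F[OF x], symmetric] ip_nonneg[OF F[OF x]] by simp
  qed
qed (use H in \<open>auto simp: const_sections_def\<close>)

lemma hilb_field_l2: "hilb_field M (const_sections M (\<lambda>_. l2 (UNIV :: 'i::countable set))) (\<lambda>_. l2 UNIV)"
  by (rule hilb_field_constI[where v = unit_vec])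
     (simp_all add: hilbert_L2 unit_vec_in hilbert_basis.Parseval_nn_integral[OF hilbert_basis_l2])

lemma borel_integrable_L2_interval:
  fixes h :: "real \<Rightarrow> complex"
  assumes [measurable]: "h \<in> borel_measurable borel"
    and sq: "integrable lborel (\<lambda>x. (cmod (h x))\<^sup>2)" and supp: "\<And>x. x \<notin> {a..<a+1} \<Longrightarrow> h x = 0"
  shows "integrable lborel h"
proof (rule Bochner_Integration.integrable_bound)
  show "integrable lborel (\<lambda>x. indicator {a..<a+1} x + (cmod (h x))\<^sup>2)"
    by (intro Bochner_Integration.integrable_add sq integrable_real_indicator) auto
  have "cmod (h x) \<le> indicator {a..<a+1} x + (cmod (h x))\<^sup>2" for x
  proof (cases "x \<in> {a..<a+1}")
    case True
    have "2 * 1 * cmod (h x) \<le> 1\<^sup>2 + (cmod (h x))\<^sup>2" by (rule sum_squares_bound)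
    then show ?thesis using True by (simp add: add_increasing2) (smt (verit) norm_ge_zero)
  qed (simp add: supp)
  then show "AE x in lborel. cmod (h x) \<le> norm (indicator {a..<a+1} x + (cmod (h x))\<^sup>2 :: real)"
    by (intro AE_I2) (metis abs_ge_self order_trans real_norm_def)
qed simp

lemma exponential_basis:
  fixes a :: real
  shows "hilbert_basis (L2 (restrict_space lborel {a..<a+1})) UNIV (\<lambda>(k::int) x. wave (of_int k * x))"
proof (intro hilbert_basis.intro hilbert_L2 hilbert_basis_axioms.intro)
  let ?R = "restrict_space lborel {a..<a+1}"
  show "(\<lambda>x. wave (of_int k * x)) \<in> vecs (L2 ?R)" for k :: int
    by (simp add: L2_def integrable_restrict_space measurable_restrict_space1)
  show "ip (L2 ?R) (\<lambda>x. wave (of_int i * x)) (\<lambda>x. wave (of_int j * x)) = (if i = j then 1 else 0)" for i j :: int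
  proof -
    have "wave (of_int i * x) * cnj (wave (of_int j * x)) = wave (of_int (i - j) * x)" for x
      by (simp add: cnj_wave wave_add[symmetric] left_diff_distrib)
    then show ?thesis
      by (simp add: L2_def integral_restrict_space wave_integral_period del: of_int_diff)
  qed
  fix f assume f: "f \<in> vecs (L2 ?R)" and zero: "\<And>k :: int. k \<in> UNIV \<Longrightarrow> ip (L2 ?R) f (\<lambda>x. wave (of_int k * x)) = 0"
  define h where "h x = indicator {a..<a+1} x *\<^sub>R f x" for x
  have [measurable]: "h \<in> borel_measurable borel"
    using f unfolding h_def by (simp add: L2_def borel_measurable_restrict_space_iff)
  have "integrable lborel (\<lambda>x. (cmod (h x))\<^sup>2)"
  proof -
    have "(cmod (h x))\<^sup>2 = indicator {a..<a+1} x * (cmod (f x))\<^sup>2" for x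
      by (simp add: h_def indicator_def)
    then show ?thesis using f by (simp add: L2_def integrable_restrict_space)
  qed
  then have h: "integrable lborel h" by (rule borel_integrable_L2_interval[OF \<open>h \<in> borel_measurable borel\<close>, of a]) (simp add: h_def)
  have "(LINT x|lborel. h x * wave (of_int k * x)) = 0" for k
    using zero[of "- k"] by (simp add: L2_def integral_restrict_space h_def cnj_wave)
  then have "AE x in lborel. h x = 0"
    by (intro fourier_unique[OF h, of a]) (auto simp: h_def)
  then have "(LINT x|lborel. indicator {a..<a+1} x *\<^sub>R (f x * cnj (f x))) = 0"
    by (intro integral_eq_zero_AE) (auto simp: h_def)
  then show "nrm (L2 ?R) f = 0" by (simp add: nrm_def L2_def integral_restrict_space)
qed

lemma fourier_Parseval:
  fixes h :: "real \<Rightarrow> complex"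
  assumes [measurable]: "h \<in> borel_measurable borel"
    and sq: "integrable lborel (\<lambda>x. (cmod (h x))\<^sup>2)" and supp: "\<And>x. x \<notin> {a..<a+1} \<Longrightarrow> h x = 0"
  shows "(\<integral>\<^sup>+x. ennreal ((cmod (h x))\<^sup>2) \<partial>lborel)
    = (\<integral>\<^sup>+k. ennreal ((cmod (LINT x|lborel. h x * cnj (wave (of_int k * x))))\<^sup>2) \<partial>count_space (UNIV :: int set))"
proof -
  let ?R = "restrict_space lborel {a..<a+1}"
  have ind: "indicator {a..<a+1} x *\<^sub>R (h x * z) = h x * z" for x z
    using supp[of x] by (cases "x \<in> {a..<a+1}") auto
  have ind2: "indicator {a..<a+1} x * (cmod (h x))\<^sup>2 = (cmod (h x))\<^sup>2" for x
    using supp[of x] by (cases "x \<in> {a..<a+1}") auto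
  have h: "h \<in> vecs (L2 ?R)"
    using sq by (simp add: L2_def integrable_restrict_space measurable_restrict_space1 ind2)
  have "ip (L2 ?R) h h = (LINT x|lborel. of_real ((cmod (h x))\<^sup>2))"
    by (simp add: L2_def integral_restrict_space ind complex_norm_square del: of_real_power)
  then have "Re (ip (L2 ?R) h h) = (LINT x|lborel. (cmod (h x))\<^sup>2)"
    by (simp del: of_real_power)
  then have "(\<integral>\<^sup>+x. ennreal ((cmod (h x))\<^sup>2) \<partial>lborel) = ennreal (Re (ip (L2 ?R) h h))"
    using sq by (simp add: nn_integral_eq_integral)
  also have "\<dots> = (\<integral>\<^sup>+k. ennreal ((cmod (ip (L2 ?R) h (\<lambda>x. wave (of_int k * x))))\<^sup>2) \<partial>count_space (UNIV :: int set))"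
    by (rule hilbert_basis.Parseval_nn_integral[OF exponential_basis h])
  finally show ?thesis by (simp add: L2_def integral_restrict_space ind)
qed

lemma nrm2_L2:
  assumes "f \<in> vecs (L2 M)"
  shows "ennreal (Re (ip (L2 M) f f)) = (\<integral>\<^sup>+x. ennreal ((cmod (f x))\<^sup>2) \<partial>M)"
proof -
  have "ip (L2 M) f f = (LINT x|M. of_real ((cmod (f x))\<^sup>2))"
    by (simp add: L2_def complex_norm_square del: of_real_power)
  then have "Re (ip (L2 M) f f) = (LINT x|M. (cmod (f x))\<^sup>2)"
    by (simp del: of_real_power)
  then show ?thesis using assms by (simp add: L2_def nn_integral_eq_integral)
qed

text \<open>
An orthonormal basis of \<open>L2\<close> of the line: exponentials with integer frequencies on each of the
intervals \<open>[m,m+1)\<close>.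
\<close>

definition gabor :: "int \<times> int \<Rightarrow> real \<Rightarrow> complex" where
  "gabor = (\<lambda>(m, k) x. indicator {of_int m..<of_int m + 1} x * wave (of_int k * x))"

lemma nn_integral_unit_intervals:
  fixes f :: "real \<Rightarrow> ennreal"
  assumes [measurable]: "f \<in> borel_measurable borel"
  shows "(\<integral>\<^sup>+x. f x \<partial>lborel) = (\<integral>\<^sup>+m. (\<integral>\<^sup>+x. f x * indicator {of_int m..<of_int m + 1} x \<partial>lborel) \<partial>count_space (UNIV :: int set))"
proof -
  have "(\<integral>\<^sup>+m. indicator {of_int m..<of_int m + 1} x \<partial>count_space (UNIV :: int set)) = (1 :: ennreal)" for x :: real
  proof -
    have "(\<integral>\<^sup>+m. indicator {of_int m..<of_int m + 1} x \<partial>count_space (UNIV :: int set)) = (\<integral>\<^sup>+m. indicator {\<lfloor>x\<rfloor>} m \<partial>count_space (UNIV :: int set))"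
      by (intro nn_integral_cong) (auto simp: indicator_def, linarith+)
    then show ?thesis by simp
  qed
  then have "(\<integral>\<^sup>+x. f x \<partial>lborel) = (\<integral>\<^sup>+x. (\<integral>\<^sup>+m. f x * indicator {of_int m..<of_int m + 1} x \<partial>count_space (UNIV :: int set)) \<partial>lborel)"
    by (simp add: nn_integral_cmult)
  also have "\<dots> = (\<integral>\<^sup>+m. (\<integral>\<^sup>+x. f x * indicator {of_int m..<of_int m + 1} x \<partial>lborel) \<partial>count_space (UNIV :: int set))"
    by (intro nn_integral_count_space_nn_integral) auto
  finally show ?thesis .
qed

lemma hilb_field_L2_real: "hilb_field M (const_sections M (\<lambda>_. L2 (lborel :: real measure))) (\<lambda>_. L2 lborel)"
proof (rule hilb_field_constI[where v = gabor])
  show "gabor i \<in> vecs (L2 lborel)" for i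
  proof -
    obtain m k where i: "i = (m, k)" by (cases i)
    have "(cmod (gabor i x))\<^sup>2 = indicator {of_int m..<of_int m + 1} x" for x
      by (simp add: gabor_def i norm_mult power_mult_distrib indicator_def)
    moreover have "gabor i \<in> borel_measurable borel" unfolding gabor_def i prod.case by measurable
    ultimately show ?thesis by (simp add: L2_def integrable_real_indicator)
  qed
  fix f :: "real \<Rightarrow> complex" assume f: "f \<in> vecs (L2 lborel)"
  then have [measurable]: "f \<in> borel_measurable borel" by (simp add: L2_def)
  have "(\<integral>\<^sup>+x. ennreal ((cmod (f x))\<^sup>2) * indicator {of_int m..<of_int m + 1} x \<partial>lborel)
      = (\<integral>\<^sup>+k. ennreal ((cmod (ip (L2 lborel) f (gabor (m, k))))\<^sup>2) \<partial>count_space (UNIV :: int set))" for m :: int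
  proof -
    let ?h = "\<lambda>x. indicator {of_int m..<of_int m + 1} x * f x"
    have "(\<integral>\<^sup>+x. ennreal ((cmod (f x))\<^sup>2) * indicator {of_int m..<of_int m + 1} x \<partial>lborel) = (\<integral>\<^sup>+x. ennreal ((cmod (?h x))\<^sup>2) \<partial>lborel)"
      by (intro nn_integral_cong) (simp add: indicator_def)
    also have "\<dots> = (\<integral>\<^sup>+k. ennreal ((cmod (LINT x|lborel. ?h x * cnj (wave (of_int k * x))))\<^sup>2) \<partial>count_space (UNIV :: int set))"
    proof (rule fourier_Parseval)
      have "integrable lborel (\<lambda>x. (cmod (f x))\<^sup>2)" using f by (simp add: L2_def)
      then show "integrable lborel (\<lambda>x. (cmod (?h x))\<^sup>2)"
        by (rule Bochner_Integration.integrable_bound) (auto simp: indicator_def)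
    qed (auto simp: indicator_def)
    moreover have "cnj (indicator A x) = indicator A x" for A and x :: real
      by (simp add: indicator_def)
    ultimately show ?thesis by (simp add: L2_def gabor_def mult_ac)
  qed
  then have "ennreal (Re (ip (L2 lborel) f f)) = (\<integral>\<^sup>+m. (\<integral>\<^sup>+k. ennreal ((cmod (ip (L2 lborel) f (gabor (m, k))))\<^sup>2)
      \<partial>count_space (UNIV :: int set)) \<partial>count_space (UNIV :: int set))"
    using nn_integral_unit_intervals[of "\<lambda>x. ennreal ((cmod (f x))\<^sup>2)"] by (simp add: nrm2_L2[OF f])
  also have "\<dots> = (\<integral>\<^sup>+i. ennreal ((cmod (ip (L2 lborel) f (gabor i)))\<^sup>2) \<partial>count_space UNIV)"
    by (rule nn_integral_fst_count_space)
  finally show "ennreal (Re (ip (L2 lborel) f f)) = (\<integral>\<^sup>+i. ennreal ((cmod (ip (L2 lborel) f (gabor i)))\<^sup>2) \<partial>count_space UNIV)" .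
qed (rule hilbert_L2)

abbreviation fibre_space :: "real \<Rightarrow> (real \<Rightarrow> int \<Rightarrow> complex) hilb" where
  "fibre_space s \<equiv> direct_integral_const (fibre_measure s) (\<lambda>_. l2 UNIV)"

lemma space_fibre_measure [simp]: "space (fibre_measure s) = {0..<\<bar>s\<bar>}"
  by (simp add: fibre_measure_def)

lemma fibre_measure_integrals:
  fixes f :: "real \<Rightarrow> complex" and g :: "real \<Rightarrow> ennreal" and r :: "real \<Rightarrow> real"
  shows "(LINT t|fibre_measure s. f t) = (LINT t|lborel. indicator {0..<\<bar>s\<bar>} t *\<^sub>R f t)"
    "(\<integral>\<^sup>+t. g t \<partial>fibre_measure s) = (\<integral>\<^sup>+t. g t * indicator {0..<\<bar>s\<bar>} t \<partial>lborel)"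
    "integrable (fibre_measure s) r \<longleftrightarrow> integrable lborel (\<lambda>t. indicator {0..<\<bar>s\<bar>} t * r t)"
    "f \<in> borel_measurable (fibre_measure s) \<longleftrightarrow> (\<lambda>t. indicator {0..<\<bar>s\<bar>} t *\<^sub>R f t) \<in> borel_measurable borel"
  by (simp_all add: fibre_measure_def integral_restrict_space nn_integral_restrict_space
      integrable_restrict_space borel_measurable_restrict_space_iff)

interpretation fibre: hilb_field "fibre_measure s" "const_sections (fibre_measure s) (\<lambda>_. l2 (UNIV :: int set))"
  "\<lambda>_. l2 UNIV" for s
  by (rule hilb_field_l2)

lemma ip_fibre_space: "ip (fibre_space s) F G = (LINT t|fibre_measure s. ip (l2 UNIV) (F t) (G t))"
  by (simp add: direct_integral_def)

lemma fibre_msec_coordinate: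
  assumes "fibre.msec s F"
  shows "(\<lambda>t. F t n) \<in> borel_measurable (fibre_measure s)"
proof -
  have "(\<lambda>_. unit_vec n) \<in> const_sections (fibre_measure s) (\<lambda>_. l2 (UNIV :: int set))"
    using unit_vec_in[of n UNIV] unfolding const_sections_def by blast
  from fibre.msec_measurable[OF assms this] show ?thesis by (simp add: ip_unit_vec)
qed

lemma fibre_msecI:
  assumes F: "\<And>t. t \<in> {0..<\<bar>s\<bar>} \<Longrightarrow> F t \<in> vecs (l2 (UNIV :: int set))"
    and meas: "\<And>n. (\<lambda>t. F t n) \<in> borel_measurable (fibre_measure s)"
  shows "fibre.msec s F"
  unfolding fibre.msec_def
proof (intro conjI ballI)
  fix v assume "v \<in> const_sections (fibre_measure s) (\<lambda>_. l2 (UNIV :: int set))"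
  then obtain w where w: "v = (\<lambda>_. w)" unfolding const_sections_def by blast
  have "(\<lambda>t. LINT n|count_space UNIV. F t n * cnj (w n)) \<in> borel_measurable (fibre_measure s)"
    by (intro borel_measurable_integral_countable borel_measurable_times meas) simp
  then show "(\<lambda>t. ip (l2 UNIV) (F t) (v t)) \<in> borel_measurable (fibre_measure s)"
    by (simp add: w L2_def)
qed (use F in simp)

lemma fibre_coordinate_L2:
  assumes f: "f \<in> vecs (fibre_space s)"
  shows "(\<lambda>t. indicator {0..<\<bar>s\<bar>} t *\<^sub>R f t n) \<in> borel_measurable borel"
    and "integrable lborel (\<lambda>t. (cmod (indicator {0..<\<bar>s\<bar>} t *\<^sub>R f t n))\<^sup>2)"
proof -
  have ms: "fibre.msec s f" and int: "integrable (fibre_measure s) (\<lambda>t. Re (ip (l2 UNIV) (f t) (f t)))"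
    using f by (simp_all add: fibre.vecs_DI)
  show meas: "(\<lambda>t. indicator {0..<\<bar>s\<bar>} t *\<^sub>R f t n) \<in> borel_measurable borel"
    using fibre_msec_coordinate[OF ms] by (simp add: fibre_measure_integrals)
  show "integrable lborel (\<lambda>t. (cmod (indicator {0..<\<bar>s\<bar>} t *\<^sub>R f t n))\<^sup>2)"
  proof (rule Bochner_Integration.integrable_bound)
    show "integrable lborel (\<lambda>t. indicator {0..<\<bar>s\<bar>} t * Re (ip (l2 UNIV) (f t) (f t)))"
      using int by (simp add: fibre_measure_integrals)
    show "(\<lambda>t. (cmod (indicator {0..<\<bar>s\<bar>} t *\<^sub>R f t n))\<^sup>2) \<in> borel_measurable lborel"
      using meas by measurable
    have "(cmod (f t n))\<^sup>2 \<le> Re (ip (l2 UNIV) (f t) (f t))" if "t \<in> {0..<\<bar>s\<bar>}" for t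
      using hilbert_basis.Bessel[OF hilbert_basis_l2, of "f t" UNIV "{n}"] fibre.msecD[OF ms, of t] that
      by (simp add: ip_unit_vec)
    then show "AE t in lborel. norm ((cmod (indicator {0..<\<bar>s\<bar>} t *\<^sub>R f t n))\<^sup>2) \<le> norm (indicator {0..<\<bar>s\<bar>} t * Re (ip (l2 UNIV) (f t) (f t)))"
      by (intro AE_I2) (auto simp: indicator_def intro: order_trans[OF _ abs_ge_self])
  qed
qed

text \<open>
An orthonormal basis for \<open>[0,1)\<close> in place of \<open>[0,\<bar>s\<bar>)\<close>. Restricted to the fibre over \<open>s\<close>, where
\<open>\<bar>s\<bar> \<le> 1\<close>, it is only a Parseval frame, but it does not depend on \<open>s\<close>.
\<close>

definition fibre_basis :: "int \<times> int \<Rightarrow> real \<Rightarrow> int \<Rightarrow> complex" where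
  "fibre_basis = (\<lambda>(n, k) t j. wave (of_int k * t) * unit_vec n j)"

lemma hilb_field_fibre_space:
  assumes sp: "space M \<subseteq> {-1..1}"
  shows "hilb_field M (const_sections M fibre_space) fibre_space"
proof (rule hilb_field_constI[where v = fibre_basis])
  fix s assume "s \<in> space M"
  then have s: "\<bar>s\<bar> \<le> 1" using subsetD[OF sp] by (simp add: abs_le_iff)
  show "hilbert (fibre_space s)" by (rule fibre.hilbert_DI)
  show "fibre_basis i \<in> vecs (fibre_space s)" for i
  proof -
    obtain n k where i: "i = (n, k)" by (cases i)
    have in_l2: "(\<lambda>j. wave (of_int k * t) * unit_vec n j) \<in> vecs (l2 UNIV)" for t
      using unit_vec_in[of n UNIV] by (simp add: L2_def norm_mult)
    have "ip (l2 UNIV) (\<lambda>j. wave (of_int k * t) * unit_vec n j) (\<lambda>j. wave (of_int k * t) * unit_vec n j) = 1" for t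
    proof -
      have "ip (l2 UNIV) (\<lambda>j. wave (of_int k * t) * unit_vec n j) (\<lambda>j. wave (of_int k * t) * unit_vec n j)
          = ip (l2 UNIV) (unit_vec n) (unit_vec n)"
        by (auto simp: L2_def unit_vec_def cnj_wave wave_add[symmetric] intro!: lebesgue_integral_cong)
      then show ?thesis by (simp add: ip_unit_vec) (simp add: unit_vec_def)
    qed
    moreover have "fibre.msec s (fibre_basis i)"
      unfolding i fibre_basis_def prod.case
      by (intro fibre_msecI in_l2) (simp add: fibre_measure_def measurable_restrict_space1)
    ultimately show ?thesis
      unfolding fibre.vecs_DI by (simp add: i fibre_basis_def fibre_measure_integrals)
  qed
  fix f assume f: "f \<in> vecs (fibre_space s)"
  then have ms: "fibre.msec s f" by (simp add: fibre.vecs_DI)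
  have f_l2: "f t \<in> vecs (l2 UNIV)" if "t \<in> {0..<\<bar>s\<bar>}" for t using fibre.msecD[OF ms] that by simp
  define h where "h n t = indicator {0..<\<bar>s\<bar>} t *\<^sub>R f t n" for n t
  have h_meas [measurable]: "h n \<in> borel_measurable borel" for n
    using fibre_coordinate_L2(1)[OF f] by (simp only: h_def[abs_def])
  have norm: "ennreal (Re (ip (fibre_space s) f f)) = (\<integral>\<^sup>+n. (\<integral>\<^sup>+t. ennreal ((cmod (h n t))\<^sup>2) \<partial>lborel) \<partial>count_space UNIV)"
  proof -
    have "ennreal (Re (ip (fibre_space s) f f)) = (\<integral>\<^sup>+t. ennreal (Re (ip (l2 UNIV) (f t) (f t))) \<partial>fibre_measure s)"
      using fibre.nrm_DI[OF f] pre_hilb.nrm_power2[OF fibre.pre_hilb_DI f] by simp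
    also have "\<dots> = (\<integral>\<^sup>+t. (\<integral>\<^sup>+n. ennreal ((cmod (f t n))\<^sup>2) \<partial>count_space UNIV) \<partial>fibre_measure s)"
      by (intro nn_integral_cong nrm2_L2 f_l2) simp
    also have "\<dots> = (\<integral>\<^sup>+t. (\<integral>\<^sup>+n. ennreal ((cmod (h n t))\<^sup>2) \<partial>count_space UNIV) \<partial>lborel)"
      unfolding fibre_measure_integrals h_def by (intro nn_integral_cong) (simp add: indicator_def)
    also have "\<dots> = (\<integral>\<^sup>+n. (\<integral>\<^sup>+t. ennreal ((cmod (h n t))\<^sup>2) \<partial>lborel) \<partial>count_space UNIV)"
      by (intro nn_integral_count_space_nn_integral) auto
    finally show ?thesis .
  qed
  have sq: "integrable lborel (\<lambda>t. (cmod (h n t))\<^sup>2)" for n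
    using fibre_coordinate_L2(2)[OF f] by (simp only: h_def)
  have coef: "ip (fibre_space s) f (fibre_basis (n, k)) = (LINT t|lborel. h n t * cnj (wave (of_int k * t)))" for n k
  proof -
    have "ip (l2 UNIV) (f t) (fibre_basis (n, k) t) = f t n * cnj (wave (of_int k * t))" for t
    proof -
      have "ip (l2 UNIV) (f t) (fibre_basis (n, k) t) = (LINT j|count_space UNIV. cnj (wave (of_int k * t)) * (f t j * cnj (unit_vec n j)))"
        by (simp add: L2_def fibre_basis_def mult_ac)
      also have "\<dots> = cnj (wave (of_int k * t)) * ip (l2 UNIV) (f t) (unit_vec n)"
        by (simp only: integral_mult_right_zero) (simp add: L2_def)
      finally show ?thesis by (simp add: ip_unit_vec)
    qed
    then show ?thesis by (simp add: ip_fibre_space fibre_measure_integrals h_def)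
  qed
  have "(\<integral>\<^sup>+t. ennreal ((cmod (h n t))\<^sup>2) \<partial>lborel)
      = (\<integral>\<^sup>+k. ennreal ((cmod (ip (fibre_space s) f (fibre_basis (n, k))))\<^sup>2) \<partial>count_space UNIV)" for n
    unfolding coef using s by (intro fourier_Parseval[of _ 0] sq h_meas) (auto simp: h_def)
  then have "ennreal (Re (ip (fibre_space s) f f)) = (\<integral>\<^sup>+n. (\<integral>\<^sup>+k. ennreal ((cmod (ip (fibre_space s) f (fibre_basis (n, k))))\<^sup>2)
      \<partial>count_space UNIV) \<partial>count_space UNIV)"
    by (simp add: norm)
  also have "\<dots> = (\<integral>\<^sup>+i. ennreal ((cmod (ip (fibre_space s) f (fibre_basis i)))\<^sup>2) \<partial>count_space UNIV)"
    by (rule nn_integral_fst_count_space)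
  finally show "ennreal (Re (ip (fibre_space s) f f)) = (\<integral>\<^sup>+i. ennreal ((cmod (ip (fibre_space s) f (fibre_basis i)))\<^sup>2) \<partial>count_space UNIV)" .
qed

section \<open>Cyclic sections over the base measure\<close>

lemma space_base_measure [simp]: "space base_measure = {-1..1}"
  by (simp add: base_measure_def)

lemma base_measure_integrals:
  fixes f :: "real \<Rightarrow> 'a :: {banach, second_countable_topology}"
  assumes f: "f \<in> borel_measurable base_measure"
  shows "(LINT s|base_measure. f s) = (LINT s|lborel. indicator {-1..1} s *\<^sub>R \<bar>s\<bar> *\<^sub>R f s)"
    "integrable base_measure f \<longleftrightarrow> integrable lborel (\<lambda>s. indicator {-1..1} s *\<^sub>R \<bar>s\<bar> *\<^sub>R f s)"
proof -
  have m: "f \<in> borel_measurable (restrict_space lborel {-1..1})"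
    using f by (simp add: base_measure_def)
  show "(LINT s|base_measure. f s) = (LINT s|lborel. indicator {-1..1} s *\<^sub>R \<bar>s\<bar> *\<^sub>R f s)"
    unfolding base_measure_def using m
    by (subst integral_density) (auto simp: integral_restrict_space measurable_restrict_space1)
  show "integrable base_measure f \<longleftrightarrow> integrable lborel (\<lambda>s. indicator {-1..1} s *\<^sub>R \<bar>s\<bar> *\<^sub>R f s)"
    unfolding base_measure_def using m
    by (subst integrable_density) (auto simp: integrable_restrict_space measurable_restrict_space1)
qed

text \<open>
The points \<open>s\<close> and \<open>s - 1\<close> are combined with the weights that the density \<open>\<bar>s\<bar>\<close> gives them.
\<close>

definition fold_unit :: "(real \<Rightarrow> 'a::real_vector) \<Rightarrow> real \<Rightarrow> 'a" where
  "fold_unit f s = s *\<^sub>R f s + (1 - s) *\<^sub>R f (s - 1)"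

lemma integral_fold_unit:
  fixes f :: "real \<Rightarrow> 'a :: {banach, second_countable_topology}"
  assumes f: "integrable base_measure f"
  shows "integrable lborel (\<lambda>s. indicator {0..<1} s *\<^sub>R fold_unit f s)"
    "(LINT s|base_measure. f s) = (LINT s|lborel. indicator {0..<1} s *\<^sub>R fold_unit f s)"
proof -
  define g where "g s = indicator {-1..1} s *\<^sub>R \<bar>s\<bar> *\<^sub>R f s" for s
  have m: "f \<in> borel_measurable base_measure" using f by auto
  have g: "integrable lborel g"
    using f base_measure_integrals(2)[OF m] by (simp add: g_def[abs_def])
  have int: "integrable lborel (\<lambda>s. indicator A s *\<^sub>R g s)" if "A \<in> sets borel" for A
    using integrable_mult_indicator[of A lborel g] g that by simp
  have shift: "integrable lborel (\<lambda>s. indicator {-1..<0} (-1 + 1 * s) *\<^sub>R g (-1 + 1 * s))"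
    by (rule lborel_integrable_real_affine[OF int]) auto
  have eq: "indicator {0..<1} s *\<^sub>R fold_unit f s
      = indicator {0..<1} s *\<^sub>R g s + indicator {-1..<0} (-1 + 1 * s) *\<^sub>R g (-1 + 1 * s)" for s
    by (auto simp: indicator_def g_def fold_unit_def)
  show "integrable lborel (\<lambda>s. indicator {0..<1} s *\<^sub>R fold_unit f s)"
    unfolding eq by (intro Bochner_Integration.integrable_add int shift) auto
  have "(LINT s|base_measure. f s) = (LINT s|lborel. g s)"
    using base_measure_integrals(1)[OF m] by (simp add: g_def)
  also have "\<dots> = (LINT s|lborel. indicator {0..<1} s *\<^sub>R g s + indicator {-1..<0} s *\<^sub>R g s)"
  proof (rule integral_cong_AE)
    show "AE s in lborel. g s = indicator {0..<1} s *\<^sub>R g s + indicator {-1..<0} s *\<^sub>R g s"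
      using AE_not_point[of 1] by eventually_elim (auto simp: g_def indicator_def)
  qed (use g in auto)
  also have "\<dots> = (LINT s|lborel. indicator {0..<1} s *\<^sub>R g s) + (LINT s|lborel. indicator {-1..<0} s *\<^sub>R g s)"
    by (intro Bochner_Integration.integral_add int) auto
  also have "(LINT s|lborel. indicator {-1..<0} s *\<^sub>R g s) = (LINT s|lborel. indicator {-1..<0} (-1 + 1 * s) *\<^sub>R g (-1 + 1 * s))"
    using lborel_integral_real_affine[of 1 "\<lambda>s. indicator {-1..<0} s *\<^sub>R g s" "-1"] by simp
  also have "(LINT s|lborel. indicator {0..<1} s *\<^sub>R g s) + \<dots> = (LINT s|lborel. indicator {0..<1} s *\<^sub>R fold_unit f s)"
    unfolding eq by (intro Bochner_Integration.integral_add[symmetric] int shift) auto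
  finally show "(LINT s|base_measure. f s) = (LINT s|lborel. indicator {0..<1} s *\<^sub>R fold_unit f s)" .
qed

lemma Gam_int_cases:
  assumes "a \<in> carrier Gam"
  obtains l m k :: int where "a = P (of_int l) (of_int m) (of_int k)"
  using assms by (auto simp: Gam_simps(1))

text \<open>
The assumption \<open>central\<close> is the scalar action of the centre. The two assumptions on pairs say that,
for \<open>0 < s < 1\<close>, the translates of \<open>\<xi>\<close> by the elements \<open>P 0 m k\<close> form an orthonormal basis of the sum
of the fibres over \<open>s\<close> and \<open>s - 1\<close> with the weights \<open>s\<close> and \<open>1 - s\<close>.
\<close>

locale cyclic_field = unitary_rep_field Gam base_measure \<pi>
  for \<pi> :: "real \<Rightarrow> (real^3^3, 'v) rep" +
  fixes \<xi> :: "real \<Rightarrow> 'v"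
  assumes cyclic_in: "\<xi> \<in> vecs DI"
    and central: "s \<in> {-1..1} \<Longrightarrow> x \<in> vecs (rspace (\<pi> s)) \<Longrightarrow> y \<in> vecs (rspace (\<pi> s)) \<Longrightarrow>
      ip (rspace (\<pi> s)) x (act (\<pi> s) (P (of_int l) (of_int m) (of_int k)) y)
      = wave (- (of_int l * s)) * ip (rspace (\<pi> s)) x (act (\<pi> s) (P 0 (of_int m) (of_int k)) y)"
    and pair_orthonormal: "0 < s \<Longrightarrow> s < 1 \<Longrightarrow>
      fold_unit (\<lambda>r. ip (rspace (\<pi> r)) (act (\<pi> r) (P 0 (of_int m) (of_int k)) (\<xi> r))
                                 (act (\<pi> r) (P 0 (of_int m') (of_int k')) (\<xi> r))) s
      = (if m = m' \<and> k = k' then 1 else 0)"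
    and pair_total: "0 < s \<Longrightarrow> s < 1 \<Longrightarrow>
      F s \<in> vecs (rspace (\<pi> s)) \<Longrightarrow> F (s - 1) \<in> vecs (rspace (\<pi> (s - 1))) \<Longrightarrow>
      (\<And>m k. fold_unit (\<lambda>r. ip (rspace (\<pi> r)) (F r) (act (\<pi> r) (P 0 (of_int m) (of_int k)) (\<xi> r))) s = 0) \<Longrightarrow>
      nrm (rspace (\<pi> s)) (F s) = 0 \<and> nrm (rspace (\<pi> (s - 1))) (F (s - 1)) = 0"
begin

definition orbit :: "real^3^3 \<Rightarrow> real \<Rightarrow> 'v" where
  "orbit g = (\<lambda>s. act (\<pi> s) g (\<xi> s))"

sublocale rep: unitary_rep Gam "direct_integral_rep base_measure \<pi>"
  by (rule unitary_rep_direct_integral)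

lemma orbit_in: "g \<in> carrier Gam \<Longrightarrow> orbit g \<in> vecs DI"
  using rep.act_in[of g \<xi>] cyclic_in by (simp add: direct_integral_rep_simps orbit_def)

lemma in_fibre: "F \<in> vecs DI \<Longrightarrow> s \<in> {-1..1} \<Longrightarrow> F s \<in> vecs (rspace (\<pi> s))"
  using msecD[of F s] by (simp add: vecs_DI)

lemma P_int_in [simp]: "P (of_int l) (of_int m) (of_int k) \<in> carrier Gam"
  by (simp add: P_in_Gam)

lemma ip_orbit:
  assumes "F \<in> vecs DI" "s \<in> {-1..1}"
  shows "ip (rspace (\<pi> s)) (F s) (orbit (P (of_int l) (of_int m) (of_int k)) s)
    = wave (- (of_int l * s)) * ip (rspace (\<pi> s)) (F s) (orbit (P 0 (of_int m) (of_int k)) s)"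
  using assms cyclic_in by (simp add: orbit_def central in_fibre)

text \<open>
A character with integer frequency takes the same value at \<open>s\<close> and at \<open>s - 1\<close> and so comes out of the
folding.
\<close>

lemma fold_unit_modulated:
  assumes "\<And>r. r \<in> {-1..1} \<Longrightarrow> f r = wave (of_int l * r) * g r" "0 \<le> s" "s \<le> 1"
  shows "fold_unit f s = wave (of_int l * s) * fold_unit g s"
proof -
  have "wave (of_int l * (s - 1)) = wave (of_int l * s) * wave (of_int (- l))"
    by (simp only: wave_add[symmetric]) (simp add: algebra_simps)
  then show ?thesis using assms
    by (simp add: fold_unit_def algebra_simps del: of_int_minus)
qed

lemma orbit_orthonormal:
  assumes g: "g \<in> carrier Gam" and h: "h \<in> carrier Gam"
  shows "ip DI (orbit g) (orbit h) = (if g = h then 1 else 0)"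
proof -
  obtain l m k :: int where g': "g = P (of_int l) (of_int m) (of_int k)" using g by (rule Gam_int_cases)
  obtain l' m' k' :: int where h': "h = P (of_int l') (of_int m') (of_int k')" using h by (rule Gam_int_cases)
  let ?gz = "P (of_int 0) (of_int m) (of_int k)" and ?hz = "P (of_int 0) (of_int m') (of_int k')"
  let ?f = "\<lambda>s. ip (rspace (\<pi> s)) (orbit g s) (orbit h s)"
  let ?base = "\<lambda>s. ip (rspace (\<pi> s)) (orbit ?gz s) (orbit ?hz s)"
  have eq: "?f s = wave (of_int (l - l') * s) * ?base s" if s: "s \<in> {-1..1}" for s
  proof -
    interpret fib: pre_hilb "rspace (\<pi> s)" using s by (intro fibre_pre) simp
    have mem: "orbit g s \<in> vecs (rspace (\<pi> s))" "orbit ?hz s \<in> vecs (rspace (\<pi> s))" "orbit ?gz s \<in> vecs (rspace (\<pi> s))"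
      using orbit_in[OF g] orbit_in[of ?hz] orbit_in[of ?gz] s P_int_in by (simp_all add: in_fibre del: of_int_0)
    have "?f s = wave (- (of_int l' * s)) * ip (rspace (\<pi> s)) (orbit g s) (orbit ?hz s)"
      using ip_orbit[OF orbit_in[OF g] s, of l' m' k'] by (simp only: h' of_int_0)
    also have "ip (rspace (\<pi> s)) (orbit g s) (orbit ?hz s) = cnj (ip (rspace (\<pi> s)) (orbit ?hz s) (orbit g s))"
      by (rule fib.ip_commute[OF mem(2,1)])
    also have "ip (rspace (\<pi> s)) (orbit ?hz s) (orbit g s) = wave (- (of_int l * s)) * ip (rspace (\<pi> s)) (orbit ?hz s) (orbit ?gz s)"
      using ip_orbit[OF orbit_in[OF P_int_in[of 0 m' k']] s, of l m k] by (simp only: g' of_int_0)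
    also have "cnj \<dots> = wave (of_int l * s) * ?base s"
      using fib.ip_commute[OF mem(2,3)] by (simp add: cnj_wave)
    finally have "?f s = wave (- (of_int l' * s)) * (wave (of_int l * s) * ?base s)" .
    also have "wave (- (of_int l' * s)) * (wave (of_int l * s) * ?base s) = wave (- (of_int l' * s) + of_int l * s) * ?base s"
      by (simp only: wave_add mult.assoc)
    also have "- (of_int l' * s) + of_int l * s = of_int (l - l') * s" by (simp add: algebra_simps)
    finally show ?thesis .
  qed
  have fold: "fold_unit ?f s = wave (of_int (l - l') * s) * (if m = m' \<and> k = k' then 1 else 0)" if "0 < s" "s < 1" for s
    using fold_unit_modulated[of ?f "l - l'" ?base s, OF eq] pair_orthonormal[OF that, of m k m' k'] that
    by (simp add: orbit_def)
  have "ip DI (orbit g) (orbit h) = (LINT s|base_measure. ?f s)" by (simp add: DI_simps)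
  also have "\<dots> = (LINT s|lborel. indicator {0..<1} s *\<^sub>R fold_unit ?f s)"
    by (intro integral_fold_unit integrable_ip orbit_in g h)
  also have "\<dots> = (LINT s|lborel. indicator {0..<0+1} s *\<^sub>R wave (of_int (l - l') * s) * (if m = m' \<and> k = k' then 1 else 0))"
  proof (rule integral_cong_AE)
    show "(\<lambda>s. indicator {0..<1} s *\<^sub>R fold_unit ?f s) \<in> borel_measurable lborel"
      using integral_fold_unit(1)[OF integrable_ip[OF orbit_in[OF g] orbit_in[OF h]]] by auto
    show "AE s in lborel. indicator {0..<1} s *\<^sub>R fold_unit ?f s
        = indicator {0..<0+1} s *\<^sub>R wave (of_int (l - l') * s) * (if m = m' \<and> k = k' then 1 else 0)"
      using AE_not_point[of 0] by eventually_elim (auto simp: indicator_def fold)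
  qed simp
  also have "\<dots> = (if g = h then 1 else 0)"
    using wave_integral_period[of 0 "l - l'"] by (simp add: g' h')
  finally show ?thesis .
qed

text \<open>
If all coefficients of \<open>F\<close> vanish, uniqueness of Fourier series in \<open>s\<close> gives, for almost all \<open>s\<close>, the vanishing
of all folded coefficients at \<open>s\<close>, and the basis property of the pair of fibres applies.
\<close>

lemma orbit_total:
  assumes F: "F \<in> vecs DI" and zero: "\<And>g. g \<in> carrier Gam \<Longrightarrow> ip DI F (orbit g) = 0"
  shows "nrm DI F = 0"
proof -
  define f where "f m k s = ip (rspace (\<pi> s)) (F s) (orbit (P (of_int 0) (of_int m) (of_int k)) s)" for m k :: int and s
  have f_int: "integrable base_measure (f m k)" for m k
    unfolding f_def by (intro integrable_ip F orbit_in P_int_in)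
  have ae: "AE s in lborel. indicator {0..<1} s *\<^sub>R fold_unit (f m k) s = 0" for m k
  proof (rule fourier_unique[where a = 0])
    show "integrable lborel (\<lambda>s. indicator {0..<1} s *\<^sub>R fold_unit (f m k) s)"
      by (rule integral_fold_unit(1)[OF f_int])
    fix l :: int
    let ?g = "P (of_int (- l)) (of_int m) (of_int k)"
    let ?f = "\<lambda>s. ip (rspace (\<pi> s)) (F s) (orbit ?g s)"
    have "?f s = wave (of_int l * s) * f m k s" if "s \<in> {-1..1}" for s
      using ip_orbit[OF F that, of "- l" m k] by (simp add: f_def)
    then have fold: "fold_unit ?f s = wave (of_int l * s) * fold_unit (f m k) s" if "0 \<le> s" "s \<le> 1" for s
      using that by (intro fold_unit_modulated)
    have "0 = (LINT s|base_measure. ?f s)"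
      using zero[OF P_int_in[of "- l" m k]] by (simp add: DI_simps)
    also have "\<dots> = (LINT s|lborel. indicator {0..<1} s *\<^sub>R fold_unit ?f s)"
      by (intro integral_fold_unit integrable_ip F orbit_in P_int_in)
    also have "\<dots> = (LINT s|lborel. indicator {0..<1} s *\<^sub>R fold_unit (f m k) s * wave (of_int l * s))"
      by (intro lebesgue_integral_cong refl) (auto simp: indicator_def fold simp del: of_int_minus)
    finally show "(LINT s|lborel. indicator {0..<1} s *\<^sub>R fold_unit (f m k) s * wave (of_int l * s)) = 0" by simp
  qed auto
  have "AE s in lborel. \<forall>m k. indicator {0..<1} s *\<^sub>R fold_unit (f m k) s = 0"
    by (intro AE_all_countable[THEN iffD2] allI ae)
  then have null: "AE s in lborel. indicator {0..<1} s *\<^sub>R fold_unit (\<lambda>s. Re (ip (rspace (\<pi> s)) (F s) (F s))) s = 0"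
    using AE_not_point[of 0]
  proof eventually_elim
    case (elim s)
    show ?case
    proof (cases "s \<in> {0..<1}")
      case True
      then have s: "0 < s" "s < 1" using elim by auto
      have "fold_unit (f m k) s = 0" for m k using elim True by auto
      then have "nrm (rspace (\<pi> s)) (F s) = 0 \<and> nrm (rspace (\<pi> (s - 1))) (F (s - 1)) = 0"
        using s F by (intro pair_total) (simp_all add: in_fibre f_def[abs_def] orbit_def)
      then show ?thesis by (simp add: fold_unit_def nrm_def)
    qed simp
  qed
  have "integrable base_measure (\<lambda>s. Re (ip (rspace (\<pi> s)) (F s) (F s)))"
    using F by (simp add: vecs_DI)
  then have "(LINT s|base_measure. Re (ip (rspace (\<pi> s)) (F s) (F s))) = 0"
    using integral_eq_zero_AE[OF null] by (simp only: integral_fold_unit(2))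
  moreover have "Re (ip DI F F) = (LINT s|base_measure. Re (ip (rspace (\<pi> s)) (F s) (F s)))"
    using integrable_ip[OF F F] by (simp add: DI_simps)
  ultimately show ?thesis by (simp add: nrm_def)
qed

theorem direct_integral_based: "based_rep Gam (direct_integral_rep base_measure \<pi>) orbit"
proof (intro based_rep.intro group_Gam based_rep_axioms.intro)
  show "hilbert_basis (rspace (direct_integral_rep base_measure \<pi>)) (carrier Gam) orbit"
    unfolding direct_integral_rep_simps
    by (intro hilbert_basis.intro hilbert_DI hilbert_basis_axioms.intro orbit_in orbit_orthonormal orbit_total)
  fix g F assume g: "g \<in> carrier Gam" and F: "F \<in> vecs (rspace (direct_integral_rep base_measure \<pi>))"
  show "act (direct_integral_rep base_measure \<pi>) g F \<in> vecs (rspace (direct_integral_rep base_measure \<pi>))"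
    by (rule rep.act_in[OF g F])
  fix h assume h: "h \<in> carrier Gam"
  have orbit: "orbit h = act (direct_integral_rep base_measure \<pi>) h \<xi>" for h
    by (simp add: orbit_def direct_integral_rep_simps)
  show "ip (rspace (direct_integral_rep base_measure \<pi>)) (act (direct_integral_rep base_measure \<pi>) g F) (orbit h)
      = ip (rspace (direct_integral_rep base_measure \<pi>)) F (orbit (inv\<^bsub>Gam\<^esub> g \<otimes>\<^bsub>Gam\<^esub> h))"
    unfolding orbit using cyclic_in by (intro rep.act_orbit g h F) (simp add: direct_integral_rep_simps)
qed

end

section \<open>The Schroedinger representations\<close>

lemma schroedinger_act:
  "act (schroedinger_rep s) (P z x y) f = (\<lambda>t. wave (z * s - s * y * t) * f (t - x))"
proof
  fix t
  have "exp (2 * pi * \<i> * z * s) = wave (z * s)" "exp (- 2 * pi * \<i> * s * y * t) = wave (- (s * y * t))"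
    using wave_eq_exp[of "z * s"] wave_eq_exp[of "- (s * y * t)"] by (simp_all add: mult.assoc)
  then show "act (schroedinger_rep s) (P z x y) f t = wave (z * s - s * y * t) * f (t - x)"
    by (simp only: schroedinger_rep_P wave_add[symmetric] diff_conv_add_uminus)
qed

lemma rspace_schroedinger [simp]: "rspace (schroedinger_rep s) = L2 lborel"
  by (simp add: schroedinger_rep_def)

lemma L2_translate:
  fixes f :: "real \<Rightarrow> complex"
  assumes "f \<in> vecs (L2 lborel)"
  shows "(\<lambda>t. f (t - x)) \<in> vecs (L2 lborel)"
  using assms lborel_integrable_real_affine[of "\<lambda>t. (cmod (f t))\<^sup>2" 1 "- x"]
  by (auto simp: L2_def)

lemma unitary_rep_schroedinger: "unitary_rep Gam (schroedinger_rep s)"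
proof (intro unitary_rep.intro group_Gam unitary_rep_axioms.intro)
  show "pre_hilb (rspace (schroedinger_rep s))"
    using hilbert_L2 hilbert.axioms(1) by (simp, blast)
  fix g f assume g: "g \<in> carrier Gam" and f: "f \<in> vecs (rspace (schroedinger_rep s))"
  then obtain z x y where g': "g = P z x y" by (auto elim: Gam_cases)
  have [measurable]: "f \<in> borel_measurable borel" using f by (simp add: L2_def)
  show "act (schroedinger_rep s) g f \<in> vecs (rspace (schroedinger_rep s))"
    using L2_translate[of f x] f by (simp add: g' schroedinger_act L2_def norm_mult)
  fix f' assume f': "f' \<in> vecs (rspace (schroedinger_rep s))"
  have "(LINT t|lborel. wave (z * s - s * y * t) * f (t - x) * cnj (f' t))
      = (LINT t|lborel. wave (z * s - s * y * (x + t)) * f t * cnj (f' (x + t)))"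
    using lborel_integral_real_affine[of 1 "\<lambda>t. wave (z * s - s * y * t) * f (t - x) * cnj (f' t)" x] by simp
  also have "\<dots> = (LINT t|lborel. f t * cnj (wave ((- z + x * y) * s - s * (- y) * t) * f' (t - (- x))))"
    by (intro lebesgue_integral_cong refl) (simp add: cnj_wave algebra_simps)
  finally show "ip (rspace (schroedinger_rep s)) (act (schroedinger_rep s) g f) f'
      = ip (rspace (schroedinger_rep s)) f (act (schroedinger_rep s) (inv\<^bsub>Gam\<^esub> g) f')"
    using g by (simp add: g' inv_Gam schroedinger_act L2_def)
  fix h assume "h \<in> carrier Gam"
  then obtain z' x' y' where h': "h = P z' x' y'" by (auto elim: Gam_cases)
  have "act (schroedinger_rep s) g (act (schroedinger_rep s) h f') = act (schroedinger_rep s) (g \<otimes>\<^bsub>Gam\<^esub> h) f'"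
  proof
    fix t
    have "z * s - s * y * t + (z' * s - s * y' * (t - x)) = (z + z' + x * y') * s - s * (y + y') * t"
      by (simp add: algebra_simps)
    then show "act (schroedinger_rep s) g (act (schroedinger_rep s) h f') t = act (schroedinger_rep s) (g \<otimes>\<^bsub>Gam\<^esub> h) f' t"
      by (simp add: g' h' schroedinger_act P_mult mult.assoc[symmetric] wave_add[symmetric] diff_diff_eq)
  qed
  then show "ip (rspace (schroedinger_rep s)) f (act (schroedinger_rep s) g (act (schroedinger_rep s) h f'))
    = ip (rspace (schroedinger_rep s)) f (act (schroedinger_rep s) (g \<otimes>\<^bsub>Gam\<^esub> h) f')" by simp
next
  fix f f'
  have "act (schroedinger_rep s) \<one>\<^bsub>Gam\<^esub> f' = f'"
    by (simp add: P_one schroedinger_act)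
  then show "ip (rspace (schroedinger_rep s)) f (act (schroedinger_rep s) \<one>\<^bsub>Gam\<^esub> f') = ip (rspace (schroedinger_rep s)) f f'"
    by simp
qed

lemma measurable_base_measureI:
  "f \<in> borel_measurable borel \<Longrightarrow> f \<in> borel_measurable base_measure"
  by (simp add: base_measure_def measurable_restrict_space1)

lemma cnj_measurable [measurable]: "cnj \<in> borel_measurable borel"
  by (intro borel_measurable_continuous_onI continuous_intros)

lemma schroedinger_field: "unitary_rep_field Gam base_measure schroedinger_rep"
proof (intro unitary_rep_field.intro group_Gam unitary_rep_field_axioms.intro unitary_rep_schroedinger)
  show "hilb_field base_measure (const_sections base_measure (\<lambda>x. rspace (schroedinger_rep x))) (\<lambda>x. rspace (schroedinger_rep x))"
    using hilb_field_L2_real by simp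
  fix g and v w :: "real \<Rightarrow> complex"
  assume g: "g \<in> carrier Gam"
    and v: "\<And>x. x \<in> space base_measure \<Longrightarrow> v \<in> vecs (rspace (schroedinger_rep x))"
    and w: "\<And>x. x \<in> space base_measure \<Longrightarrow> w \<in> vecs (rspace (schroedinger_rep x))"
  obtain z x y where g': "g = P z x y" using g by (auto elim: Gam_cases)
  have [measurable]: "v \<in> borel_measurable borel" "w \<in> borel_measurable borel"
    using v[of 0] w[of 0] by (simp_all add: L2_def)
  have "(\<lambda>s. LINT t|lborel. wave (z * s - s * y * t) * v (t - x) * cnj (w t)) \<in> borel_measurable borel"
    by measurable
  then show "(\<lambda>s. ip (rspace (schroedinger_rep s)) (act (schroedinger_rep s) g v) w) \<in> borel_measurable base_measure"
    by (intro measurable_base_measureI) (simp add: g' schroedinger_act L2_def)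
qed

lemma integrable_base_measure_const: "integrable base_measure (\<lambda>_. c :: real)"
proof -
  have "integrable lborel (\<lambda>s. indicator {-1..1} s *\<^sub>R (\<bar>s\<bar> *\<^sub>R c))"
    using borel_integrable_atLeastAtMost'[of "-1" 1 "\<lambda>s. \<bar>s\<bar> *\<^sub>R c"]
    by (simp add: set_integrable_def continuous_intros)
  then show ?thesis by (subst base_measure_integrals) auto
qed

definition unit_box :: "real \<Rightarrow> complex" where "unit_box = indicator {0..<1}"

lemma unit_box_measurable [measurable]: "unit_box \<in> borel_measurable borel"
  by (simp add: unit_box_def)

lemma unit_box_in_L2: "unit_box \<in> vecs (L2 lborel)"
proof -
  have "(cmod (unit_box x))\<^sup>2 = indicator {0..<1} x" for x by (simp add: unit_box_def indicator_def)
  then show ?thesis by (simp add: L2_def integrable_real_indicator)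
qed

text \<open>
The vector \<open>P 0 m k \<xi> r\<close> of the orbit; together with the scalars from the centre these make up the
whole orbit.
\<close>

abbreviation box_orbit :: "int \<Rightarrow> int \<Rightarrow> real \<Rightarrow> real \<Rightarrow> complex" where
  "box_orbit m k r \<equiv> act (schroedinger_rep r) (P 0 (of_int m) (of_int k)) unit_box"

text \<open>
The restriction of \<open>f\<close> to \<open>[m,m+1)\<close> in the coordinate \<open>u = r (t - m)\<close>. It lives on the interval
from \<open>0\<close> to \<open>r\<close>, in either direction.
\<close>

definition strip :: "real \<Rightarrow> int \<Rightarrow> (real \<Rightarrow> complex) \<Rightarrow> real \<Rightarrow> complex" where
  "strip r m f u = f (of_int m + u / r) * unit_box (u / r)"

text \<open>
The Jacobian of \<open>t = m + u / r\<close> cancels the weight \<open>\<bar>r\<bar>\<close>, and the frequency \<open>r k\<close> becomes the integer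
\<open>k\<close>.
\<close>

lemma schroedinger_coefficient:
  assumes f: "f \<in> vecs (L2 lborel)" and r: "r \<noteq> 0"
  shows "integrable lborel (strip r m f)"
    and "\<bar>r\<bar> *\<^sub>R ip (L2 lborel) f (box_orbit m k r)
      = wave (r * of_int (m * k)) * (LINT u|lborel. strip r m f u * wave (of_int k * u))"
proof -
  have [measurable]: "f \<in> borel_measurable borel" using f by (simp add: L2_def)
  have "integrable lborel (\<lambda>t. f t * unit_box (t - of_int m))"
  proof (rule borel_integrable_L2_interval[where a = "of_int m"])
    have "integrable lborel (\<lambda>t. (cmod (f t))\<^sup>2)" using f by (simp add: L2_def)
    then show "integrable lborel (\<lambda>t. (cmod (f t * unit_box (t - of_int m)))\<^sup>2)"
      by (rule Bochner_Integration.integrable_bound) (auto simp: unit_box_def indicator_def)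
  qed (auto simp: unit_box_def indicator_def)
  from lborel_integrable_real_affine[OF this, of "1 / r" "of_int m"] r
  show "integrable lborel (strip r m f)" by (simp add: strip_def[abs_def])
  have "ip (L2 lborel) f (box_orbit m k r)
      = (LINT t|lborel. f t * wave (r * of_int k * t) * unit_box (t - of_int m))"
    by (auto simp: L2_def schroedinger_act cnj_wave unit_box_def indicator_def intro!: lebesgue_integral_cong)
  also have "\<dots> = \<bar>1 / r\<bar> *\<^sub>R (LINT u|lborel. f (of_int m + 1 / r * u) * wave (r * of_int k * (of_int m + 1 / r * u)) * unit_box (of_int m + 1 / r * u - of_int m))"
    using r by (intro lborel_integral_real_affine) simp
  also have "(LINT u|lborel. f (of_int m + 1 / r * u) * wave (r * of_int k * (of_int m + 1 / r * u)) * unit_box (of_int m + 1 / r * u - of_int m))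
      = (LINT u|lborel. wave (r * of_int (m * k)) * (strip r m f u * wave (of_int k * u)))"
  proof (intro lebesgue_integral_cong refl)
    fix u
    have "r * of_int k * (of_int m + 1 / r * u) = r * of_int (m * k) + of_int k * u"
      using r by (simp add: field_simps)
    then show "f (of_int m + 1 / r * u) * wave (r * of_int k * (of_int m + 1 / r * u)) * unit_box (of_int m + 1 / r * u - of_int m)
        = wave (r * of_int (m * k)) * (strip r m f u * wave (of_int k * u))"
      by (simp add: wave_add strip_def)
  qed
  finally show "\<bar>r\<bar> *\<^sub>R ip (L2 lborel) f (box_orbit m k r)
      = wave (r * of_int (m * k)) * (LINT u|lborel. strip r m f u * wave (of_int k * u))"
    using r by simp
qed

text \<open>
Used for the phases of the two members of a pair of fibres, which therefore agree.
\<close>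

lemma wave_shift_int: "wave ((s - 1) * of_int j) = wave (s * of_int j)"
proof -
  have "(s - 1) * of_int j = s * of_int j + of_int (- j)" by (simp add: algebra_simps)
  then show ?thesis by (simp only: wave_add wave_of_int mult_1_right)
qed

text \<open>
The folded coefficients are the Fourier coefficients of one function, glued from a function on
\<open>[0,s)\<close> and one on \<open>(s-1,0]\<close>.
\<close>

lemma schroedinger_fold:
  assumes s: "0 < s" "s < 1" and F: "F s \<in> vecs (L2 lborel)" "F (s - 1) \<in> vecs (L2 lborel)"
  shows "fold_unit (\<lambda>r. ip (L2 lborel) (F r) (box_orbit m k r)) s
    = wave (s * of_int (m * k)) * (LINT u|lborel. (strip s m (F s) u + strip (s - 1) m (F (s - 1)) u) * wave (of_int k * u))"
proof -
  have int: "integrable lborel (\<lambda>u. strip s m (F s) u * wave (of_int k * u))"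
    "integrable lborel (\<lambda>u. strip (s - 1) m (F (s - 1)) u * wave (of_int k * u))"
    using s by (auto intro!: integrable_mult_bounded[where B = 1] schroedinger_coefficient F)
  show ?thesis
    unfolding fold_unit_def
    using schroedinger_coefficient(2)[OF F(1), of s m k] schroedinger_coefficient(2)[OF F(2), of "s - 1" m k] s int
      wave_shift_int[of s "m * k"]
    by (simp add: distrib_left distrib_right del: of_int_mult)
qed

lemma strip_support:
  assumes "0 < s" "s < 1"
  shows "unit_box (u / s) = indicator {0..<s} u" "unit_box (u / (s - 1)) = indicator {s-1<..0} u"
  using assms by (auto simp: unit_box_def indicator_def field_simps zero_le_divide_iff)

text \<open>
For equal \<open>m\<close> the glued function is a multiple of one exponential on the whole interval of
length one; for different \<open>m\<close> it vanishes.
\<close>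

lemma schroedinger_pair_orthonormal:
  assumes s: "0 < s" "s < 1"
  shows "fold_unit (\<lambda>r. ip (L2 lborel) (box_orbit m k r)
      (box_orbit m' k' r)) s = (if m = m' \<and> k = k' then 1 else 0)"
proof -
  let ?F = "box_orbit m k"
  have F: "?F r \<in> vecs (L2 lborel)" for r
    using unitary_rep.act_in[OF unitary_rep_schroedinger, of "P 0 (of_int m) (of_int k)" unit_box r] unit_box_in_L2
    by (simp add: P_in_Gam)
  have strip: "strip r m' (?F r) u = (if m = m' then wave (- (r * of_int (m * k))) * wave (- (of_int k * u)) * unit_box (u / r) else 0)"
    if "r \<noteq> 0" for r u
  proof (cases "u / r \<in> {0..<1}")
    case True
    have "of_int m' + u / r - of_int m \<in> {0..<1} \<longleftrightarrow> m = m'"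
    proof -
      have "of_int m' + u / r - of_int m = of_int (m' - m) + u / r" by simp
      then show ?thesis using True by (auto; linarith)
    qed
    moreover have "- (r * of_int k * (of_int n + u / r)) = - (r * of_int (n * k)) + - (of_int k * u)" for n :: int
      using that by (simp add: field_simps)
    ultimately show ?thesis using True
      by (simp add: strip_def schroedinger_act unit_box_def wave_add[symmetric])
  qed (simp add: strip_def unit_box_def)
  have "(LINT u|lborel. (strip s m' (?F s) u + strip (s - 1) m' (?F (s - 1)) u) * wave (of_int k' * u))
      = (LINT u|lborel. (if m = m' then wave (- (s * of_int (m * k))) else 0) * (indicator {s-1..<s-1+1} u *\<^sub>R wave (of_int (k' - k) * u)))"
  proof (rule integral_cong_AE)
    show "(\<lambda>u. (strip s m' (?F s) u + strip (s - 1) m' (?F (s - 1)) u) * wave (of_int k' * u)) \<in> borel_measurable lborel"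
      using s schroedinger_coefficient(1)[OF F] by (auto intro!: borel_measurable_times borel_measurable_add)
    show "AE u in lborel. (strip s m' (?F s) u + strip (s - 1) m' (?F (s - 1)) u) * wave (of_int k' * u)
        = (if m = m' then wave (- (s * of_int (m * k))) else 0) * (indicator {s-1..<s-1+1} u *\<^sub>R wave (of_int (k' - k) * u))"
      using AE_not_point[of 0] AE_not_point[of "s - 1"]
    proof eventually_elim
      case (elim u)
      define c where "c = (if m = m' then wave (- (s * of_int (m * k))) else 0)"
      have "wave (- ((s - 1) * of_int (m * k))) = wave (- (s * of_int (m * k)))"
        using wave_shift_int[of s "- (m * k)"] by simp
      then have "strip (s - 1) m' (?F (s - 1)) u = c * wave (- (of_int k * u)) * unit_box (u / (s - 1))"
        using strip[of "s - 1" u] s by (cases "m = m'") (simp_all add: c_def del: of_int_mult)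
      moreover have "strip s m' (?F s) u = c * wave (- (of_int k * u)) * unit_box (u / s)"
        using strip[of s u] s by (simp add: c_def)
      ultimately have "(strip s m' (?F s) u + strip (s - 1) m' (?F (s - 1)) u) * wave (of_int k' * u)
          = c * ((unit_box (u / s) + unit_box (u / (s - 1))) * (wave (- (of_int k * u)) * wave (of_int k' * u)))"
        by (simp add: algebra_simps)
      also have "unit_box (u / s) + unit_box (u / (s - 1)) = indicator {s-1..<s-1+1} u"
        using elim s by (auto simp: strip_support indicator_def)
      also have "wave (- (of_int k * u)) * wave (of_int k' * u) = wave (of_int (k' - k) * u)"
        by (simp add: wave_add[symmetric] algebra_simps)
      finally show ?case
        unfolding c_def by (simp add: indicator_def)
    qed
  qed measurable
  also have "\<dots> = (if m = m' then wave (- (s * of_int (m * k))) else 0) * (if k' = k then 1 else 0)"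
    by (simp only: integral_mult_right_zero wave_integral_period) simp
  finally show ?thesis
    unfolding schroedinger_fold[OF s, of ?F, OF F F] by (auto simp: wave_add[symmetric])
qed

lemma schroedinger_pair_total:
  assumes s: "0 < s" "s < 1" and F: "F s \<in> vecs (L2 lborel)" "F (s - 1) \<in> vecs (L2 lborel)"
    and zero: "\<And>m k. fold_unit (\<lambda>r. ip (L2 lborel) (F r) (box_orbit m k r)) s = 0"
  shows "nrm (L2 lborel) (F s) = 0 \<and> nrm (L2 lborel) (F (s - 1)) = 0"
proof -
  have null: "AE u in lborel. strip s m (F s) u + strip (s - 1) m (F (s - 1)) u = 0" for m
  proof (rule fourier_unique[where a = "s - 1"])
    show "integrable lborel (\<lambda>u. strip s m (F s) u + strip (s - 1) m (F (s - 1)) u)"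
      using s F by (intro Bochner_Integration.integrable_add schroedinger_coefficient) auto
    show "strip s m (F s) u + strip (s - 1) m (F (s - 1)) u = 0" if "u \<notin> {s-1..<s-1+1}" for u
      using that s by (auto simp: strip_def strip_support indicator_def)
    show "(LINT u|lborel. (strip s m (F s) u + strip (s - 1) m (F (s - 1)) u) * wave (of_int k * u)) = 0" for k
      using zero[of m k] s F
      by (simp add: schroedinger_fold) (metis cmod_wave norm_zero zero_neq_one)
  qed
  have norm0: "nrm (L2 lborel) f = 0"
    if f: "f \<in> vecs (L2 lborel)" and r: "r \<noteq> 0" and strip0: "\<And>m. AE u in lborel. strip r m f u = 0" for f r
  proof -
    have [measurable]: "f \<in> borel_measurable borel" using f by (simp add: L2_def)
    have "(\<integral>\<^sup>+x. ennreal ((cmod (f x))\<^sup>2) * indicator {of_int m..<of_int m + 1} x \<partial>lborel) = 0" for m :: int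
    proof -
      have "(\<integral>\<^sup>+x. ennreal ((cmod (f x))\<^sup>2) * indicator {of_int m..<of_int m + 1} x \<partial>lborel)
          = ennreal \<bar>1 / r\<bar> * (\<integral>\<^sup>+u. ennreal ((cmod (f (of_int m + 1 / r * u)))\<^sup>2) * indicator {of_int m..<of_int m + 1} (of_int m + 1 / r * u) \<partial>lborel)"
        using r by (intro nn_integral_real_affine) auto
      also have "(\<integral>\<^sup>+u. ennreal ((cmod (f (of_int m + 1 / r * u)))\<^sup>2) * indicator {of_int m..<of_int m + 1} (of_int m + 1 / r * u) \<partial>lborel) = (\<integral>\<^sup>+u. 0 \<partial>(lborel :: real measure))"
        using strip0[of m] by (intro nn_integral_cong_AE) (auto simp: strip_def unit_box_def indicator_def elim!: AE_mp)
      finally show ?thesis by simp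
    qed
    then have "(\<integral>\<^sup>+x. ennreal ((cmod (f x))\<^sup>2) \<partial>lborel) = 0"
      by (subst nn_integral_unit_intervals) simp_all
    then have "Re (ip (L2 lborel) f f) \<le> 0"
      using nrm2_L2[OF f] by (simp add: ennreal_eq_0_iff)
    then show ?thesis
      using pre_hilb.ip_nonneg[OF hilbert.axioms(1)[OF hilbert_L2] f] by (simp add: nrm_def)
  qed
  have z1: "AE u in lborel. strip s m (F s) u = 0" for m
    using null[of m] AE_not_point[of 0]
    by eventually_elim (use s in \<open>auto simp: strip_def strip_support indicator_def split: if_splits\<close>)
  have z2: "AE u in lborel. strip (s - 1) m (F (s - 1)) u = 0" for m
    using null[of m] AE_not_point[of 0]
    by eventually_elim (use s in \<open>auto simp: strip_def strip_support indicator_def split: if_splits\<close>)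
  show ?thesis using norm0[OF F(1) _ z1] norm0[OF F(2) _ z2] s by simp
qed

interpretation schroedinger: cyclic_field schroedinger_rep "\<lambda>_. unit_box"
proof (intro cyclic_field.intro schroedinger_field cyclic_field_axioms.intro)
  interpret unitary_rep_field Gam base_measure schroedinger_rep by (rule schroedinger_field)
  have "msec (\<lambda>_. unit_box)"
    unfolding msec_def by (auto simp: unit_box_in_L2 const_sections_def)
  then show "(\<lambda>_. unit_box) \<in> vecs (direct_integral_const base_measure (\<lambda>x. rspace (schroedinger_rep x)))"
    unfolding vecs_DI using integrable_base_measure_const by simp
next
  fix s x y and l m k :: int
  assume x: "x \<in> vecs (rspace (schroedinger_rep s))" and y: "y \<in> vecs (rspace (schroedinger_rep s))"
  interpret unitary_rep Gam "schroedinger_rep s" by (rule unitary_rep_schroedinger)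
  have "act (schroedinger_rep s) (P (of_int l) (of_int m) (of_int k)) y
      = vscale (L2 lborel) (wave (of_int l * s)) (act (schroedinger_rep s) (P 0 (of_int m) (of_int k)) y)"
    by (simp add: schroedinger_act L2_def wave_add[symmetric] mult.assoc[symmetric])
  then show "ip (rspace (schroedinger_rep s)) x (act (schroedinger_rep s) (P (of_int l) (of_int m) (of_int k)) y)
      = wave (- (of_int l * s)) * ip (rspace (schroedinger_rep s)) x (act (schroedinger_rep s) (P 0 (of_int m) (of_int k)) y)"
    using ip_scale_right[OF act_in[OF _ y] x, of "P 0 (of_int m) (of_int k)"]
    by (simp add: P_in_Gam cnj_wave)
qed (simp_all add: schroedinger_pair_orthonormal schroedinger_pair_total)

section \<open>The induced representations\<close>

lemma rspace_Ind [simp]: "rspace (Ind_K_Gam \<omega> t) = l2 UNIV"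
  by (simp add: Ind_K_Gam_def transport_rep_def)

lemma Ind_act:
  assumes "f \<in> vecs (l2 UNIV)"
  shows "act (Ind_K_Gam \<omega> t) (P (of_int l) (of_int m) (of_int k)) f
    = (\<lambda>n. wave (\<omega> * of_int (l - n * k) + t * of_int k) * f (n - m))"
proof
  fix n
  have "exp (2 * pi * \<i> * (\<omega> * real_of_int (l - n * k) + t * real_of_int k)) = wave (\<omega> * of_int (l - n * k) + t * of_int k)"
    by (subst wave_eq_exp[symmetric]) simp
  then show "act (Ind_K_Gam \<omega> t) (P (of_int l) (of_int m) (of_int k)) f n
      = wave (\<omega> * of_int (l - n * k) + t * of_int k) * f (n - m)"
    using Ind_K_Gam_act[OF assms, of \<omega> t l m k n] by simp
qed

lemma bij_int_shift: "bij (\<lambda>n. n + m :: int)"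
  by (rule bij_betwI[where g = "\<lambda>n. n - m"]) auto

lemma l2_shift:
  fixes f :: "int \<Rightarrow> complex"
  assumes "f \<in> vecs (l2 UNIV)"
  shows "(\<lambda>n. f (n - m)) \<in> vecs (l2 UNIV)"
  using assms integrable_bij_count_space[OF bij_int_shift[of "- m"], of "\<lambda>n. (cmod (f n))\<^sup>2"]
  by (simp add: L2_def)

lemma unitary_rep_Ind: "unitary_rep Gam (Ind_K_Gam \<omega> t)"
proof (intro unitary_rep.intro group_Gam unitary_rep_axioms.intro)
  let ?\<pi> = "Ind_K_Gam \<omega> t"
  show "pre_hilb (rspace ?\<pi>)"
    using hilbert_L2 hilbert.axioms(1) by (simp, blast)
  have act_in: "act ?\<pi> g f \<in> vecs (l2 UNIV)" if g: "g \<in> carrier Gam" and f: "f \<in> vecs (l2 UNIV)" for g f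
  proof -
    obtain l m k :: int where g': "g = P (of_int l) (of_int m) (of_int k)" using g by (rule Gam_int_cases)
    show ?thesis using l2_shift[OF f, of m] f by (simp add: g' Ind_act L2_def norm_mult)
  qed
  fix g f assume g: "g \<in> carrier Gam" and f: "f \<in> vecs (rspace ?\<pi>)"
  then show "act ?\<pi> g f \<in> vecs (rspace ?\<pi>)" using act_in by simp
  obtain l m k :: int where g': "g = P (of_int l) (of_int m) (of_int k)" using g by (rule Gam_int_cases)
  fix f' assume f': "f' \<in> vecs (rspace ?\<pi>)"
  have fl: "f \<in> vecs (l2 UNIV)" "f' \<in> vecs (l2 UNIV)" using f f' by simp_all
  have inv: "inv\<^bsub>Gam\<^esub> g = P (of_int (- l + m * k)) (of_int (- m)) (of_int (- k))"
    using g by (simp add: g' inv_Gam)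
  have "(LINT n|count_space UNIV. wave (\<omega> * of_int (l - n * k) + t * of_int k) * f (n - m) * cnj (f' n))
      = (LINT n|count_space UNIV. wave (\<omega> * of_int (l - (n + m) * k) + t * of_int k) * f (n + m - m) * cnj (f' (n + m)))"
    using integral_bij_count_space[OF bij_int_shift[of m],
        of "\<lambda>n. wave (\<omega> * of_int (l - n * k) + t * of_int k) * f (n - m) * cnj (f' n)"] by simp
  also have "\<dots> = (LINT n|count_space UNIV. f n * cnj (wave (\<omega> * of_int ((- l + m * k) - n * (- k)) + t * of_int (- k)) * f' (n - (- m))))"
    by (intro lebesgue_integral_cong refl) (simp add: cnj_wave algebra_simps)
  finally show "ip (rspace ?\<pi>) (act ?\<pi> g f) f' = ip (rspace ?\<pi>) f (act ?\<pi> (inv\<^bsub>Gam\<^esub> g) f')"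
    unfolding inv unfolding g' rspace_Ind Ind_act[OF fl(1)] Ind_act[OF fl(2)] by (simp add: L2_def)
  fix h assume h: "h \<in> carrier Gam"
  then obtain l' m' k' :: int where h': "h = P (of_int l') (of_int m') (of_int k')" by (rule Gam_int_cases)
  have mult: "g \<otimes>\<^bsub>Gam\<^esub> h = P (of_int (l + l' + m * k')) (of_int (m + m')) (of_int (k + k'))"
    by (simp add: g' h' P_mult)
  have "act ?\<pi> g (act ?\<pi> h f') = act ?\<pi> (g \<otimes>\<^bsub>Gam\<^esub> h) f'"
  proof
    fix n
    have "act ?\<pi> g (act ?\<pi> h f') n = wave (\<omega> * of_int (l - n * k) + t * of_int k) * act ?\<pi> h f' (n - m)"
      unfolding g' by (simp only: Ind_act[OF act_in[OF h fl(2)]])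
    also have "act ?\<pi> h f' (n - m) = wave (\<omega> * of_int (l' - (n - m) * k') + t * of_int k') * f' (n - m - m')"
      unfolding h' by (simp only: Ind_act[OF fl(2)])
    also have "wave (\<omega> * of_int (l - n * k) + t * of_int k) * (wave (\<omega> * of_int (l' - (n - m) * k') + t * of_int k') * f' (n - m - m'))
        = wave ((\<omega> * of_int (l - n * k) + t * of_int k) + (\<omega> * of_int (l' - (n - m) * k') + t * of_int k')) * f' (n - m - m')"
      by (simp only: wave_add mult.assoc)
    also have "(\<omega> * of_int (l - n * k) + t * of_int k) + (\<omega> * of_int (l' - (n - m) * k') + t * of_int k')
        = \<omega> * of_int (l + l' + m * k' - n * (k + k')) + t * of_int (k + k')"
      by (simp add: algebra_simps)
    also have "wave \<dots> * f' (n - m - m') = act ?\<pi> (g \<otimes>\<^bsub>Gam\<^esub> h) f' n"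
      unfolding mult by (simp only: Ind_act[OF fl(2)] diff_diff_eq)
    finally show "act ?\<pi> g (act ?\<pi> h f') n = act ?\<pi> (g \<otimes>\<^bsub>Gam\<^esub> h) f' n" .
  qed
  then show "ip (rspace ?\<pi>) f (act ?\<pi> g (act ?\<pi> h f')) = ip (rspace ?\<pi>) f (act ?\<pi> (g \<otimes>\<^bsub>Gam\<^esub> h) f')" by simp
next
  fix f f' assume "f' \<in> vecs (rspace (Ind_K_Gam \<omega> t))"
  then have "act (Ind_K_Gam \<omega> t) \<one>\<^bsub>Gam\<^esub> f' = f'"
    using Ind_act[of f' \<omega> t 0 0 0] by (simp add: P_one)
  then show "ip (rspace (Ind_K_Gam \<omega> t)) f (act (Ind_K_Gam \<omega> t) \<one>\<^bsub>Gam\<^esub> f') = ip (rspace (Ind_K_Gam \<omega> t)) f f'"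
    by simp
qed

lemma ip_Ind_act:
  assumes "v \<in> vecs (l2 UNIV)"
  shows "ip (l2 UNIV) (act (Ind_K_Gam \<omega> t) (P (of_int l) (of_int m) (of_int k)) v) w
    = (LINT n|count_space UNIV. wave (\<omega> * of_int (l - n * k) + t * of_int k) * v (n - m) * cnj (w n))"
  by (simp only: Ind_act[OF assms]) (simp add: L2_def)

lemma Ind_field: "unitary_rep_field Gam (fibre_measure s) (\<lambda>t. Ind_K_Gam s t)"
proof (intro unitary_rep_field.intro group_Gam unitary_rep_field_axioms.intro unitary_rep_Ind)
  show "hilb_field (fibre_measure s) (const_sections (fibre_measure s) (\<lambda>t. rspace (Ind_K_Gam s t))) (\<lambda>t. rspace (Ind_K_Gam s t))"
    using hilb_field_l2 by simp
  fix g and v w :: "int \<Rightarrow> complex"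
  assume g: "g \<in> carrier Gam"
    and v: "\<And>t. t \<in> space (fibre_measure s) \<Longrightarrow> v \<in> vecs (rspace (Ind_K_Gam s t))"
  obtain l m k :: int where g': "g = P (of_int l) (of_int m) (of_int k)" using g by (rule Gam_int_cases)
  have "(\<lambda>t. LINT n|count_space UNIV. wave (s * of_int (l - n * k) + t * of_int k) * v (n - m) * cnj (w n)) \<in> borel_measurable (fibre_measure s)"
    by (rule borel_measurable_integral_countable) (simp add: fibre_measure_def measurable_restrict_space1)
  then show "(\<lambda>t. ip (rspace (Ind_K_Gam s t)) (act (Ind_K_Gam s t) g v) w) \<in> borel_measurable (fibre_measure s)"
    by (rule measurable_cong[THEN iffD1, rotated]) (use v in \<open>simp add: g' ip_Ind_act\<close>)
qed

definition fibre_rep :: "real \<Rightarrow> (real^3^3, real \<Rightarrow> int \<Rightarrow> complex) rep" where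
  "fibre_rep s = direct_integral_rep (fibre_measure s) (\<lambda>t. Ind_K_Gam s t)"

lemma rspace_fibre_rep [simp]: "rspace (fibre_rep s) = fibre_space s"
  by (simp add: fibre_rep_def direct_integral_rep_def)

lemma act_fibre_rep: "act (fibre_rep s) g F = (\<lambda>t. act (Ind_K_Gam s t) g (F t))"
  by (simp add: fibre_rep_def direct_integral_rep_def)

lemma unitary_rep_fibre_rep: "unitary_rep Gam (fibre_rep s)"
  unfolding fibre_rep_def by (rule unitary_rep_field.unitary_rep_direct_integral[OF Ind_field])

lemma fibre_in_l2: "F \<in> vecs (fibre_space s) \<Longrightarrow> t \<in> {0..<\<bar>s\<bar>} \<Longrightarrow> F t \<in> vecs (l2 UNIV)"
  using fibre.msecD[of s F t] by (simp add: fibre.vecs_DI)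

lemma fibre_rep_field: "unitary_rep_field Gam base_measure fibre_rep"
proof (intro unitary_rep_field.intro group_Gam unitary_rep_field_axioms.intro unitary_rep_fibre_rep)
  show "hilb_field base_measure (const_sections base_measure (\<lambda>s. rspace (fibre_rep s))) (\<lambda>s. rspace (fibre_rep s))"
    using hilb_field_fibre_space[of base_measure] by simp
  fix g and v w :: "real \<Rightarrow> int \<Rightarrow> complex"
  assume g: "g \<in> carrier Gam"
    and v: "\<And>s. s \<in> space base_measure \<Longrightarrow> v \<in> vecs (rspace (fibre_rep s))"
    and w: "\<And>s. s \<in> space base_measure \<Longrightarrow> w \<in> vecs (rspace (fibre_rep s))"
  obtain l m k :: int where g': "g = P (of_int l) (of_int m) (of_int k)" using g by (rule Gam_int_cases)
  \<comment> \<open>The fibre over 1 contains all others, so extending by zero from it gives functions that do not depend on s.\<close>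
  define V where "V n t = indicator {0..<\<bar>1::real\<bar>} t *\<^sub>R v t n" for n t
  define W where "W n t = indicator {0..<\<bar>1::real\<bar>} t *\<^sub>R w t n" for n t
  have [measurable]: "V n \<in> borel_measurable borel" "W n \<in> borel_measurable borel" for n
    using fibre_coordinate_L2(1)[of v 1 n] fibre_coordinate_L2(1)[of w 1 n] v[of 1] w[of 1]
    by (simp_all add: V_def[abs_def] W_def[abs_def])
  define Q where "Q p = (LINT n|count_space UNIV. wave (fst p * of_int (l - n * k) + snd p * of_int k) * V (n - m) (snd p) * cnj (W n (snd p)))"
    for p :: "real \<times> real"
  have [measurable]: "Q \<in> borel_measurable (borel \<Otimes>\<^sub>M borel)"
    unfolding Q_def by (rule borel_measurable_integral_countable) measurable
  have "(\<lambda>s. LINT t|lborel. (if 0 \<le> t \<and> t < \<bar>s\<bar> then Q (s, t) else 0)) \<in> borel_measurable borel"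
    by measurable
  then have "(\<lambda>s. LINT t|lborel. (if 0 \<le> t \<and> t < \<bar>s\<bar> then Q (s, t) else 0)) \<in> borel_measurable base_measure"
    by (rule measurable_base_measureI)
  then show "(\<lambda>s. ip (rspace (fibre_rep s)) (act (fibre_rep s) g v) w) \<in> borel_measurable base_measure"
  proof (rule measurable_cong[THEN iffD1, rotated])
    fix s assume s: "s \<in> space base_measure"
    have "ip (l2 UNIV) (act (Ind_K_Gam s t) g (v t)) (w t) = Q (s, t)" if "t \<in> {0..<\<bar>s\<bar>}" for t
    proof -
      have "v t \<in> vecs (l2 UNIV)" using v[OF s] that fibre_in_l2 by simp
      then show ?thesis
        unfolding g' ip_Ind_act[OF \<open>v t \<in> vecs (l2 UNIV)\<close>] Q_def
        using that s by (intro lebesgue_integral_cong refl) (auto simp: V_def W_def)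
    qed
    then have "(LINT t|lborel. (if 0 \<le> t \<and> t < \<bar>s\<bar> then Q (s, t) else 0))
        = (LINT t|lborel. indicator {0..<\<bar>s\<bar>} t *\<^sub>R ip (l2 UNIV) (act (Ind_K_Gam s t) g (v t)) (w t))"
      by (intro lebesgue_integral_cong refl) (auto simp: indicator_def)
    then show "(LINT t|lborel. (if 0 \<le> t \<and> t < \<bar>s\<bar> then Q (s, t) else 0)) = ip (rspace (fibre_rep s)) (act (fibre_rep s) g v) w"
      by (simp add: act_fibre_rep ip_fibre_space fibre_measure_integrals)
  qed
qed

text \<open>
A shift that depends on the sign and makes the tiles of \<open>s\<close> and of \<open>s - 1\<close> adjacent; with the same coordinate
for both signs the tiles would overlap.
\<close>

definition offset :: "real \<Rightarrow> int" where "offset r = (if 0 < r then 1 else 0)"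

text \<open>
For \<open>r \<noteq> 0\<close> the factor makes this constant function a unit vector of the fibre over \<open>[0,\<bar>r\<bar>)\<close>.
\<close>

definition tile_vector :: "real \<Rightarrow> real \<Rightarrow> int \<Rightarrow> complex" where
  "tile_vector r t n = of_real (1 / sqrt \<bar>r\<bar>) * unit_vec (offset r) n"

lemma tile_vector_in_l2: "tile_vector r t \<in> vecs (l2 UNIV)"
proof -
  interpret pre_hilb "l2 (UNIV :: int set)" using hilbert_L2 by (rule hilbert.axioms(1))
  have "vscale (l2 UNIV) (of_real (1 / sqrt \<bar>r\<bar>)) (unit_vec (offset r)) \<in> vecs (l2 UNIV)"
    by (intro scale_in unit_vec_in) simp
  then show ?thesis by (simp add: L2_def tile_vector_def[abs_def])
qed

lemma tile_vector_in: "tile_vector r \<in> vecs (fibre_space r)"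
  unfolding fibre.vecs_DI
proof
  show "fibre.msec r (tile_vector r)"
    by (intro fibre_msecI tile_vector_in_l2) (simp add: tile_vector_def)
  have "integrable (fibre_measure r) (\<lambda>t. Re (ip (l2 UNIV) (tile_vector r 0) (tile_vector r 0)))"
    by (simp add: fibre_measure_integrals)
  then show "integrable (fibre_measure r) (\<lambda>t. Re (ip (l2 UNIV) (tile_vector r t) (tile_vector r t)))"
    by (simp add: tile_vector_def[abs_def])
qed

abbreviation tile_orbit :: "int \<Rightarrow> int \<Rightarrow> real \<Rightarrow> real \<Rightarrow> int \<Rightarrow> complex" where
  "tile_orbit m k r \<equiv> act (fibre_rep r) (P 0 (of_int m) (of_int k)) (tile_vector r)"

lemma tile_vector_orbit:
  "tile_orbit m k r
    = (\<lambda>t n. of_real (1 / sqrt \<bar>r\<bar>) * wave (of_int k * (t - r * of_int n)) * unit_vec (m + offset r) n)"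
proof (intro ext)
  fix t n
  have "act (fibre_rep r) (P (of_int 0) (of_int m) (of_int k)) (tile_vector r) t n
      = wave (r * of_int (0 - n * k) + t * of_int k) * tile_vector r t (n - m)"
    by (simp only: act_fibre_rep Ind_act[OF tile_vector_in_l2])
  also have "r * of_int (0 - n * k) + t * of_int k = of_int k * (t - r * of_int n)"
    by (simp add: algebra_simps)
  also have "wave \<dots> * tile_vector r t (n - m) = of_real (1 / sqrt \<bar>r\<bar>) * wave (of_int k * (t - r * of_int n)) * unit_vec (m + offset r) n"
    by (auto simp: tile_vector_def unit_vec_def)
  finally show "tile_orbit m k r t n
      = of_real (1 / sqrt \<bar>r\<bar>) * wave (of_int k * (t - r * of_int n)) * unit_vec (m + offset r) n" by simp
qed

text \<open>
The coordinate \<open>m + offset r\<close> of \<open>f\<close> on \<open>[0,\<bar>r\<bar>)\<close>, moved to \<open>[-r,0)\<close> if \<open>r > 0\<close> and left in place if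
\<open>r < 0\<close>.
\<close>

definition tile :: "real \<Rightarrow> int \<Rightarrow> (real \<Rightarrow> int \<Rightarrow> complex) \<Rightarrow> real \<Rightarrow> complex" where
  "tile r m f u = sqrt \<bar>r\<bar> *\<^sub>R indicator {0..<\<bar>r\<bar>} (u + r * of_int (offset r)) *\<^sub>R f (u + r * of_int (offset r)) (m + offset r)"

lemma ip_scaled_unit_vec: "ip (l2 UNIV) f (\<lambda>n. c n * unit_vec i n) = cnj (c i) * f i"
proof -
  have "f n * cnj (c n * unit_vec i n) = cnj (c i) * (f n * cnj (unit_vec i n))" for n
    by (simp add: unit_vec_def)
  then have "ip (l2 UNIV) f (\<lambda>n. c n * unit_vec i n) = (LINT n|count_space UNIV. cnj (c i) * (f n * cnj (unit_vec i n)))"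
    by (simp only: L2_def hilb.select_convs)
  also have "\<dots> = cnj (c i) * ip (l2 UNIV) f (unit_vec i)"
    by (simp only: integral_mult_right_zero) (simp add: L2_def)
  finally show ?thesis by (simp add: ip_unit_vec)
qed

text \<open>
The phase \<open>exp (2 pi i k r n)\<close> at \<open>n = m + offset r\<close> is absorbed by the translation up to the factor that
only depends on \<open>r m k\<close>.
\<close>

lemma tile_coefficient:
  assumes f: "f \<in> vecs (fibre_space r)" and r: "r \<noteq> 0" "\<bar>r\<bar> \<le> 1"
  shows "integrable lborel (tile r m f)"
    and "\<bar>r\<bar> *\<^sub>R ip (fibre_space r) f (tile_orbit m k r)
      = wave (r * of_int (m * k)) * (LINT u|lborel. tile r m f u * wave (of_int (- k) * u))"
proof -
  let ?n = "m + offset r"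
  have "integrable lborel (\<lambda>t. indicator {0..<\<bar>r\<bar>} t *\<^sub>R f t ?n)"
    using r by (intro borel_integrable_L2_interval[where a = 0] fibre_coordinate_L2[OF f]) (auto simp: indicator_def)
  from lborel_integrable_real_affine[OF this, of 1 "r * of_int (offset r)"]
  have "integrable lborel (\<lambda>u. sqrt \<bar>r\<bar> *\<^sub>R indicator {0..<\<bar>r\<bar>} (r * of_int (offset r) + 1 * u)
      *\<^sub>R f (r * of_int (offset r) + 1 * u) ?n)"
    by (intro integrable_scaleR_right) simp
  then show "integrable lborel (tile r m f)"
    by (simp add: tile_def[abs_def] add.commute)
  have root: "\<bar>r\<bar> * (1 / sqrt \<bar>r\<bar>) = sqrt \<bar>r\<bar>"
    using r by (simp add: real_div_sqrt)
  define c where "c t n = of_real (1 / sqrt \<bar>r\<bar>) * wave (of_int k * (t - r * of_int n))" for t and n :: int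
  have "\<bar>r\<bar> *\<^sub>R ip (fibre_space r) f (tile_orbit m k r)
      = \<bar>r\<bar> *\<^sub>R (LINT t|lborel. indicator {0..<\<bar>r\<bar>} t *\<^sub>R (cnj (c t ?n) * f t ?n))"
    unfolding tile_vector_orbit ip_fibre_space fibre_measure_integrals c_def[symmetric] ip_scaled_unit_vec ..
  also have "\<dots> = (LINT t|lborel. \<bar>r\<bar> *\<^sub>R indicator {0..<\<bar>r\<bar>} t *\<^sub>R (cnj (c t ?n) * f t ?n))"
    by (rule integral_scaleR_right[symmetric])
  also have "\<dots> = (LINT u|lborel. \<bar>r\<bar> *\<^sub>R indicator {0..<\<bar>r\<bar>} (r * of_int (offset r) + 1 * u) *\<^sub>R
      (cnj (c (r * of_int (offset r) + 1 * u) ?n) * f (r * of_int (offset r) + 1 * u) ?n))"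
    by (subst lborel_integral_real_affine[of 1 _ "r * of_int (offset r)"]) simp_all
  also have "\<dots> = (LINT u|lborel. wave (r * of_int (m * k)) * (tile r m f u * wave (of_int (- k) * u)))"
  proof (intro lebesgue_integral_cong refl)
    fix u
    let ?t = "r * of_int (offset r) + 1 * u"
    have "- (of_int k * (?t - r * of_int ?n)) = r * of_int (m * k) + of_int (- k) * u"
      by (simp add: algebra_simps)
    then have "cnj (c ?t ?n) = of_real (1 / sqrt \<bar>r\<bar>) * (wave (r * of_int (m * k)) * wave (of_int (- k) * u))"
      by (simp only: c_def complex_cnj_mult complex_cnj_complex_of_real cnj_wave wave_add)
    moreover have "\<bar>r\<bar> *\<^sub>R (of_real (1 / sqrt \<bar>r\<bar>) * z) = sqrt \<bar>r\<bar> *\<^sub>R z" for z :: complex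
      by (simp only: scaleR_conv_of_real mult.assoc[symmetric] of_real_mult[symmetric] root)
    ultimately show "\<bar>r\<bar> *\<^sub>R indicator {0..<\<bar>r\<bar>} ?t *\<^sub>R (cnj (c ?t ?n) * f ?t ?n)
        = wave (r * of_int (m * k)) * (tile r m f u * wave (of_int (- k) * u))"
      by (simp add: tile_def indicator_def add.commute mult_ac del: of_int_mult of_int_minus)
  qed
  finally show "\<bar>r\<bar> *\<^sub>R ip (fibre_space r) f (tile_orbit m k r)
      = wave (r * of_int (m * k)) * (LINT u|lborel. tile r m f u * wave (of_int (- k) * u))"
    by simp
qed

text \<open>
As for the Schroedinger representations, the folded coefficients are the Fourier coefficients of one
function, now glued from tiles on \<open>[-s,0)\<close> and \<open>[0,1-s)\<close>.
\<close>

lemma tile_fold: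
  assumes s: "0 < s" "s < 1" and F: "F s \<in> vecs (fibre_space s)" "F (s - 1) \<in> vecs (fibre_space (s - 1))"
  shows "fold_unit (\<lambda>r. ip (fibre_space r) (F r) (tile_orbit m k r)) s
    = wave (s * of_int (m * k)) * (LINT u|lborel. (tile s m (F s) u + tile (s - 1) m (F (s - 1)) u) * wave (of_int (- k) * u))"
proof -
  have int: "integrable lborel (\<lambda>u. tile s m (F s) u * wave (of_int (- k) * u))"
    "integrable lborel (\<lambda>u. tile (s - 1) m (F (s - 1)) u * wave (of_int (- k) * u))"
    using s by (auto intro!: integrable_mult_bounded[where B = 1] tile_coefficient F)
  show ?thesis
    unfolding fold_unit_def
    using tile_coefficient(2)[OF F(1), of m k] tile_coefficient(2)[OF F(2), of m k] s int
      wave_shift_int[of s "m * k"]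
    by (simp add: distrib_left distrib_right del: of_int_mult of_int_minus)
qed

lemma tile_pair_orthonormal:
  assumes s: "0 < s" "s < 1"
  shows "fold_unit (\<lambda>r. ip (fibre_space r) (tile_orbit m k r)
      (tile_orbit m' k' r)) s = (if m = m' \<and> k = k' then 1 else 0)"
proof -
  let ?F = "tile_orbit m k"
  have F: "?F r \<in> vecs (fibre_space r)" for r
    using unitary_rep.act_in[OF unitary_rep_fibre_rep, of "P 0 (of_int m) (of_int k)" "tile_vector r" r] tile_vector_in
    by (simp add: P_in_Gam)
  have tile: "tile r m' (?F r) u = (if m = m' then wave (- (r * of_int (m * k))) * wave (of_int k * u)
      * indicator {0..<\<bar>r\<bar>} (u + r * of_int (offset r)) else 0)" if "r \<noteq> 0" for r u
  proof (cases "m = m'")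
    case True
    have "of_int k * (u + r * of_int (offset r) - r * of_int (m + offset r)) = - (r * of_int (m * k)) + of_int k * u"
      by (simp add: algebra_simps)
    then have "?F r (u + r * of_int (offset r)) (m + offset r)
        = of_real (1 / sqrt \<bar>r\<bar>) * (wave (- (r * of_int (m * k))) * wave (of_int k * u))"
      unfolding tile_vector_orbit by (simp only: wave_add[symmetric]) (simp add: unit_vec_def)
    then show ?thesis using True that
      by (simp add: tile_def scaleR_conv_of_real indicator_def del: of_int_mult)
  qed (simp add: tile_def tile_vector_orbit unit_vec_def)
  have "(LINT u|lborel. (tile s m' (?F s) u + tile (s - 1) m' (?F (s - 1)) u) * wave (of_int (- k') * u))
      = (LINT u|lborel. (if m = m' then wave (- (s * of_int (m * k))) else 0) * (indicator {-s..<-s+1} u *\<^sub>R wave (of_int (k - k') * u)))"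
  proof (intro lebesgue_integral_cong refl)
    fix u
    define c where "c = (if m = m' then wave (- (s * of_int (m * k))) else 0)"
    have "wave (- ((s - 1) * of_int (m * k))) = wave (- (s * of_int (m * k)))"
      using wave_shift_int[of s "- (m * k)"] by simp
    then have "tile (s - 1) m' (?F (s - 1)) u = c * wave (of_int k * u) * indicator {0..<1-s} u"
      using tile[of "s - 1" u] s by (cases "m = m'") (simp_all add: c_def offset_def indicator_def del: of_int_mult)
    moreover have "tile s m' (?F s) u = c * wave (of_int k * u) * indicator {-s..<0} u"
      using tile[of s u] s by (auto simp: c_def offset_def indicator_def)
    ultimately have "(tile s m' (?F s) u + tile (s - 1) m' (?F (s - 1)) u) * wave (of_int (- k') * u)
        = c * ((indicator {-s..<0} u + indicator {0..<1-s} u) * (wave (of_int k * u) * wave (of_int (- k') * u)))"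
      by (simp add: algebra_simps)
    also have "(indicator {-s..<0} u + indicator {0..<1-s} u :: complex) = indicator {-s..<-s+1} u"
      using s by (auto simp: indicator_def)
    also have "wave (of_int k * u) * wave (of_int (- k') * u) = wave (of_int (k - k') * u)"
      by (simp add: wave_add[symmetric] algebra_simps)
    finally show "(tile s m' (?F s) u + tile (s - 1) m' (?F (s - 1)) u) * wave (of_int (- k') * u)
        = (if m = m' then wave (- (s * of_int (m * k))) else 0) * (indicator {-s..<-s+1} u *\<^sub>R wave (of_int (k - k') * u))"
      unfolding c_def by (simp add: indicator_def)
  qed
  also have "\<dots> = (if m = m' then wave (- (s * of_int (m * k))) else 0) * (if k = k' then 1 else 0)"
    by (simp only: integral_mult_right_zero wave_integral_period) simp
  finally show ?thesis
    unfolding tile_fold[OF s, of ?F, OF F F] by (auto simp: wave_add[symmetric])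
qed

lemma tile_pair_total:
  assumes s: "0 < s" "s < 1" and F: "F s \<in> vecs (fibre_space s)" "F (s - 1) \<in> vecs (fibre_space (s - 1))"
    and zero: "\<And>m k. fold_unit (\<lambda>r. ip (fibre_space r) (F r) (tile_orbit m k r)) s = 0"
  shows "nrm (fibre_space s) (F s) = 0 \<and> nrm (fibre_space (s - 1)) (F (s - 1)) = 0"
proof -
  have null: "AE u in lborel. tile s m (F s) u + tile (s - 1) m (F (s - 1)) u = 0" for m
  proof (rule fourier_unique[where a = "- s"])
    show "integrable lborel (\<lambda>u. tile s m (F s) u + tile (s - 1) m (F (s - 1)) u)"
      using s F by (intro Bochner_Integration.integrable_add tile_coefficient) auto
    show "tile s m (F s) u + tile (s - 1) m (F (s - 1)) u = 0" if "u \<notin> {-s..<-s+1}" for u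
      using that s by (auto simp: tile_def offset_def indicator_def)
    show "(LINT u|lborel. (tile s m (F s) u + tile (s - 1) m (F (s - 1)) u) * wave (of_int k * u)) = 0" for k
      using zero[of m "- k"] tile_fold[OF s, of F m "- k", OF F]
      by (simp del: of_int_mult) (metis cmod_wave norm_zero zero_neq_one)
  qed
  have norm0: "nrm (fibre_space r) f = 0"
    if f: "f \<in> vecs (fibre_space r)" and r: "r \<noteq> 0" "\<bar>r\<bar> \<le> 1" and tile0: "\<And>m. AE u in lborel. tile r m f u = 0" for f r
  proof -
    have "AE t in lborel. indicator {0..<\<bar>r\<bar>} t *\<^sub>R f t n = 0" for n
    proof -
      have [measurable]: "tile r (n - offset r) f \<in> borel_measurable borel"
        using tile_coefficient(1)[OF f r] by auto
      have "AE t in lborel. tile r (n - offset r) f (- (r * of_int (offset r)) + 1 * t) = 0"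
        by (rule AE_borel_affine[OF _ _ tile0]) auto
      then show ?thesis by eventually_elim (use r in \<open>simp add: tile_def\<close>)
    qed
    then have "AE t in lborel. \<forall>n. indicator {0..<\<bar>r\<bar>} t *\<^sub>R f t n = 0"
      by (intro AE_all_countable[THEN iffD2] allI)
    then have "AE t in lborel. indicator {0..<\<bar>r\<bar>} t *\<^sub>R ip (l2 UNIV) (f t) (f t) = 0"
      by eventually_elim (auto simp: indicator_def L2_def)
    then have "ip (fibre_space r) f f = 0"
      unfolding ip_fibre_space fibre_measure_integrals by (rule integral_eq_zero_AE)
    then show ?thesis by (simp add: nrm_def)
  qed
  have z1: "AE u in lborel. tile s m (F s) u = 0" for m
    using null[of m]
    by eventually_elim (use s in \<open>auto simp: tile_def offset_def indicator_def split: if_splits\<close>)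
  have z2: "AE u in lborel. tile (s - 1) m (F (s - 1)) u = 0" for m
    using null[of m]
    by eventually_elim (use s in \<open>auto simp: tile_def offset_def indicator_def split: if_splits\<close>)
  show ?thesis using norm0[OF F(1) _ _ z1] norm0[OF F(2) _ _ z2] s by simp
qed

lemma tile_vector_field:
  "tile_vector \<in> vecs (direct_integral_const base_measure (\<lambda>s. rspace (fibre_rep s)))"
proof -
  interpret unitary_rep_field Gam base_measure fibre_rep by (rule fibre_rep_field)
  have ms: "msec tile_vector"
    unfolding msec_def
  proof (intro conjI ballI)
    show "tile_vector s \<in> vecs (rspace (fibre_rep s))" for s by (simp add: tile_vector_in)
    fix v assume "v \<in> const_sections base_measure (\<lambda>s. rspace (fibre_rep s))"
    then obtain w where w': "v = (\<lambda>_. w)" "\<forall>s\<in>space base_measure. w \<in> vecs (rspace (fibre_rep s))"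
      unfolding const_sections_def by blast
    then have w: "v = (\<lambda>_. w)" "\<And>s. s \<in> {-1..1} \<Longrightarrow> w \<in> vecs (fibre_space s)"
      by simp_all
    define W where "W n t = indicator {0..<\<bar>1::real\<bar>} t *\<^sub>R w t n" for n t
    have [measurable]: "W n \<in> borel_measurable borel" for n
      using fibre_coordinate_L2(1)[of w 1 n] w(2)[of 1] by (simp add: W_def[abs_def])
    have "(\<lambda>s. of_real (1 / sqrt \<bar>s\<bar>) * (LINT t|lborel. (if 0 \<le> t \<and> t < \<bar>s\<bar> then (if 0 < s then cnj (W 1 t) else cnj (W 0 t)) else 0)))
        \<in> borel_measurable borel"
      by measurable
    then have "(\<lambda>s. of_real (1 / sqrt \<bar>s\<bar>) * (LINT t|lborel. (if 0 \<le> t \<and> t < \<bar>s\<bar> then (if 0 < s then cnj (W 1 t) else cnj (W 0 t)) else 0)))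
        \<in> borel_measurable base_measure" by (rule measurable_base_measureI)
    then show "(\<lambda>s. ip (rspace (fibre_rep s)) (tile_vector s) (v s)) \<in> borel_measurable base_measure"
    proof (rule measurable_cong[THEN iffD1, rotated])
      fix s assume s: "s \<in> space base_measure"
      interpret l2: pre_hilb "l2 (UNIV :: int set)" using hilbert_L2 by (rule hilbert.axioms(1))
      have "ip (l2 UNIV) (tile_vector s t) (w t) = of_real (1 / sqrt \<bar>s\<bar>) * cnj (W (offset s) t)" if t: "t \<in> {0..<\<bar>s\<bar>}" for t
      proof -
        have wt: "w t \<in> vecs (l2 UNIV)" by (rule fibre_in_l2[OF w(2)]) (use s t in auto)
        have "ip (l2 UNIV) (tile_vector s t) (w t) = cnj (ip (l2 UNIV) (w t) (tile_vector s t))"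
          by (rule l2.ip_commute[OF wt tile_vector_in_l2])
        also have "\<dots> = of_real (1 / sqrt \<bar>s\<bar>) * cnj (w t (offset s))"
          unfolding tile_vector_def[abs_def] ip_scaled_unit_vec by simp
        finally show ?thesis using t s by (auto simp: W_def indicator_def)
      qed
      then have "ip (fibre_space s) (tile_vector s) w
          = (LINT t|lborel. of_real (1 / sqrt \<bar>s\<bar>) * (if 0 \<le> t \<and> t < \<bar>s\<bar> then (if 0 < s then cnj (W 1 t) else cnj (W 0 t)) else 0))"
        unfolding ip_fibre_space fibre_measure_integrals
        by (intro lebesgue_integral_cong refl) (auto simp: indicator_def offset_def)
      then show "of_real (1 / sqrt \<bar>s\<bar>) * (LINT t|lborel. (if 0 \<le> t \<and> t < \<bar>s\<bar> then (if 0 < s then cnj (W 1 t) else cnj (W 0 t)) else 0))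
          = ip (rspace (fibre_rep s)) (tile_vector s) (v s)"
        unfolding integral_mult_right_zero by (simp add: w(1))
    qed
  qed
  have norm: "Re (ip (fibre_space s) (tile_vector s) (tile_vector s)) = (if s = 0 then 0 else 1)" for s
  proof -
    have "ip (l2 UNIV) (tile_vector s t) (tile_vector s t) = of_real (1 / \<bar>s\<bar>)" for t
    proof -
      have "ip (l2 UNIV) (tile_vector s t) (tile_vector s t) = cnj (of_real (1 / sqrt \<bar>s\<bar>)) * tile_vector s t (offset s)"
        unfolding tile_vector_def[abs_def] ip_scaled_unit_vec ..
      then show ?thesis by (simp add: tile_vector_def unit_vec_def flip: of_real_mult)
    qed
    moreover have "measure (fibre_measure s) {0..<\<bar>s\<bar>} = \<bar>s\<bar>"
      by (simp add: fibre_measure_def measure_restrict_space)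
    ultimately show ?thesis by (simp add: ip_fibre_space)
  qed
  have "integrable base_measure (\<lambda>s. Re (ip (rspace (fibre_rep s)) (tile_vector s) (tile_vector s)))"
    by (rule Bochner_Integration.integrable_bound[OF integrable_base_measure_const[of 1] msec_norm_measurable[OF ms]])
       (simp add: norm)
  then show ?thesis unfolding vecs_DI using ms by simp
qed

interpretation induced: cyclic_field fibre_rep tile_vector
proof (intro cyclic_field.intro fibre_rep_field cyclic_field_axioms.intro tile_vector_field)
  fix s x y and l m k :: int
  assume x: "x \<in> vecs (rspace (fibre_rep s))" and y: "y \<in> vecs (rspace (fibre_rep s))"
  interpret fib: pre_hilb "l2 (UNIV :: int set)" using hilbert_L2 by (rule hilbert.axioms(1))
  have "ip (l2 UNIV) (x t) (act (Ind_K_Gam s t) (P (of_int l) (of_int m) (of_int k)) (y t))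
      = wave (- (of_int l * s)) * ip (l2 UNIV) (x t) (act (Ind_K_Gam s t) (P 0 (of_int m) (of_int k)) (y t))"
    if t: "t \<in> {0..<\<bar>s\<bar>}" for t
  proof -
    have l2: "x t \<in> vecs (l2 UNIV)" "y t \<in> vecs (l2 UNIV)" using x y t by (simp_all add: fibre_in_l2)
    have "act (Ind_K_Gam s t) (P (of_int l) (of_int m) (of_int k)) (y t)
        = vscale (l2 UNIV) (wave (of_int l * s)) (act (Ind_K_Gam s t) (P (of_int 0) (of_int m) (of_int k)) (y t))"
    proof
      fix n
      have "s * of_int (l - n * k) + t * of_int k = of_int l * s + (s * of_int (0 - n * k) + t * of_int k)"
        by (simp add: algebra_simps)
      then show "act (Ind_K_Gam s t) (P (of_int l) (of_int m) (of_int k)) (y t) n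
        = vscale (l2 UNIV) (wave (of_int l * s)) (act (Ind_K_Gam s t) (P (of_int 0) (of_int m) (of_int k)) (y t)) n"
        unfolding Ind_act[OF l2(2)] by (simp only: wave_add) (simp add: L2_def)
    qed
    moreover have "act (Ind_K_Gam s t) (P (of_int 0) (of_int m) (of_int k)) (y t) \<in> vecs (l2 UNIV)"
      using unitary_rep.act_in[OF unitary_rep_Ind, of "P (of_int 0) (of_int m) (of_int k)" "y t" s t] l2
      by (simp add: P_in_Gam)
    ultimately show ?thesis
      using fib.ip_scale_right[OF _ l2(1)] by (simp add: cnj_wave)
  qed
  then have "(LINT t|fibre_measure s. ip (l2 UNIV) (x t) (act (Ind_K_Gam s t) (P (of_int l) (of_int m) (of_int k)) (y t)))
      = (LINT t|fibre_measure s. wave (- (of_int l * s)) * ip (l2 UNIV) (x t) (act (Ind_K_Gam s t) (P 0 (of_int m) (of_int k)) (y t)))"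
    by (intro lebesgue_integral_cong refl) simp
  then show "ip (rspace (fibre_rep s)) x (act (fibre_rep s) (P (of_int l) (of_int m) (of_int k)) y)
      = wave (- (of_int l * s)) * ip (rspace (fibre_rep s)) x (act (fibre_rep s) (P 0 (of_int m) (of_int k)) y)"
    by (simp add: ip_fibre_space act_fibre_rep)
qed (simp_all add: tile_pair_orthonormal tile_pair_total)

theorem theorem6p5:
  shows "unitarily_equivalent Gam
           (left_regular_rep Gam)
           (direct_integral_rep base_measure schroedinger_rep)
       \<and> unitarily_equivalent Gam
           (direct_integral_rep base_measure schroedinger_rep)
           (direct_integral_rep base_measure
              (\<lambda>s. direct_integral_rep (fibre_measure s) (\<lambda>t. Ind_K_Gam s t)))
       \<and> rspace (direct_integral_rep base_measure
              (\<lambda>s. direct_integral_rep (fibre_measure s) (\<lambda>t. Ind_K_Gam s t)))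
         = direct_integral_const base_measure
              (\<lambda>s. direct_integral_const (fibre_measure s) (\<lambda>t. l2 (UNIV :: int set)))"
proof (intro conjI)
  show "unitarily_equivalent Gam (left_regular_rep Gam) (direct_integral_rep base_measure schroedinger_rep)"
    by (rule based_reps_equivalent[OF left_regular_based[OF group_Gam] schroedinger.direct_integral_based])
  show "unitarily_equivalent Gam (direct_integral_rep base_measure schroedinger_rep)
      (direct_integral_rep base_measure (\<lambda>s. direct_integral_rep (fibre_measure s) (\<lambda>t. Ind_K_Gam s t)))"
    using based_reps_equivalent[OF schroedinger.direct_integral_based induced.direct_integral_based]
    by (simp only: fibre_rep_def[abs_def])
qed (simp add: direct_integral_rep_def)

end
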